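(* Let $(U,\Sigma,\mu)$ be a $\sigma$-finite measure space with a full ordered core $\mathcal A$. Then $(L^1_\mu,L^\infty_\mu\!\!\downarrow)$ is an exact Calder\'on couple.
   Context: Functions equal $\mu$-a.e. are identified. An ordered core of $(U,\Sigma,\mu)$ is a subset $\mathcal A\subseteq\Sigma$, totally ordered by inclusion, containing $\emptyset$, whose members all have finite $\mu$-measure. It is $\sigma$-bounded if $\bigcup\mathcal A=\bigcup\mathcal A_0$ for some countable $\mathcal A_0\subseteq\mathcal A$, and full if it is $\sigma$-bounded and $\bigcup\mathcal A=U$. $\sigma(\mathcal A)$ is the $\sigma$-ring generated by $\mathcal A$ (a $\sigma$-algebra on $U$ when $\mathcal A$ is full). Write $u\le_{\mathcal A}v$ if for all $A\in\mathcal A$, $v\in A$ implies $u\in A$. $L^\downarrow(\mathcal A)$ is the set of core decreasing functions: $\sigma(\mathcal A)$-measurable $f:U\to[0,\infty]$ with $f(u)\ge f(v)$ whenever $u\le_{\mathcal A}v$. $L^\infty_\mu\!\!\downarrow$ is the Banach space of $\Sigma$-measurable $f:U\to[-\infty,\infty]$ for which $\|f\|_{L^\infty_\mu\!\downarrow}=\sup\{\int_U|f|g\,d\mu:g\in L^1_\mu\cap L^\downarrow(\mathcal A),\ \|g\|_{L^1_\mu}\le1\}$ is finite. For a compatible couple $(X_0,X_1)$ of Banach spaces, $K(f,t;X_0,X_1)=\inf\{\|f_0\|_{X_0}+t\|f_1\|_{X_1}:f_0+f_1=f\}$ for $f\in X_0+X_1$, $t>0$. An admissible contraction from $(X_0,X_1)$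 to itself is a linear map on $X_0+X_1$ whose restriction to each $X_j$ is a bounded map $X_j\to X_j$ of norm at most $1$, $j=0,1$. The couple is an exact Calder\'on couple if whenever $f,g\in X_0+X_1$ satisfy $K(f,t;X_0,X_1)\le K(g,t;X_0,X_1)$ for all $t>0$, there is an admissible contraction from $(X_0,X_1)$ to itself that maps $g$ to $f$. *)

theory Defs
  imports "HOL-Analysis.Analysis"
begin

subsection \<open>Ordered cores\<close>

definition ordered_core :: "'a measure \<Rightarrow> 'a set set \<Rightarrow> bool" where
  "ordered_core M \<A> \<longleftrightarrow>
     \<A> \<subseteq> sets M \<and> (\<forall>A\<in>\<A>. \<forall>B\<in>\<A>. A \<subseteq> B \<or> B \<subseteq> A) \<and> {} \<in> \<A> \<and>
     (\<forall>A\<in>\<A>. emeasure M A < \<infinity>)"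

definition sigma_bounded :: "'a set set \<Rightarrow> bool" where
  "sigma_bounded \<A> \<longleftrightarrow> (\<exists>\<A>\<^sub>0\<subseteq>\<A>. countable \<A>\<^sub>0 \<and> \<Union>\<A> = \<Union>\<A>\<^sub>0)"

definition full_ordered_core :: "'a measure \<Rightarrow> 'a set set \<Rightarrow> bool" where
  "full_ordered_core M \<A> \<longleftrightarrow> ordered_core M \<A> \<and> sigma_bounded \<A> \<and> \<Union>\<A> = space M"

inductive_set sigma_ring :: "'a set set \<Rightarrow> 'a set set" for \<A> :: "'a set set" where
  basic: "A \<in> \<A> \<Longrightarrow> A \<in> sigma_ring \<A>"
| empty: "{} \<in> sigma_ring \<A>"
| diff: "A \<in> sigma_ring \<A> \<Longrightarrow> B \<in> sigma_ring \<A> \<Longrightarrow> A - B \<in> sigma_ring \<A>"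
| Union: "(\<And>i::nat. F i \<in> sigma_ring \<A>) \<Longrightarrow> (\<Union>i. F i) \<in> sigma_ring \<A>"

text \<open>For a full core the generated sigma-ring is the generated sigma-algebra on the whole
  space, so measurability below can be taken with respect to \<^term>\<open>sigma (space M) \<A>\<close>.\<close>

lemma sigma_ring_full:
  assumes "full_ordered_core M \<A>"
  shows "sigma_ring \<A> = sets (sigma (space M) \<A>)"
proof -
  have sub: "\<A> \<subseteq> Pow (space M)"
    using assms by (auto simp: full_ordered_core_def)
  obtain \<A>\<^sub>0 where A0: "\<A>\<^sub>0 \<subseteq> \<A>" "countable \<A>\<^sub>0" "space M = \<Union>\<A>\<^sub>0" "{} \<in> \<A>"
    using assms by (auto simp: full_ordered_core_def ordered_core_def sigma_bounded_def)
  have "(\<Union>i. from_nat_into (insert {} \<A>\<^sub>0) i) \<in> sigma_ring \<A>"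
    using A0 by (intro sigma_ring.Union sigma_ring.basic)
      (metis from_nat_into insert_not_empty insert_subset subsetD)
  moreover have "(\<Union>i. from_nat_into (insert {} \<A>\<^sub>0) i) = space M"
    using A0 range_from_nat_into[of "insert {} \<A>\<^sub>0"] by auto
  ultimately have top: "space M \<in> sigma_ring \<A>"
    by simp
  have "B \<in> sigma_ring \<A>" if "B \<in> sigma_sets (space M) \<A>" for B
    using that by induction (auto intro: sigma_ring.intros top)
  moreover have "B \<in> sigma_sets (space M) \<A>" if "B \<in> sigma_ring \<A>" for B
    using that
  proof induction
    case (diff A B)
    interpret sigma_algebra "space M" "sigma_sets (space M) \<A>"
      by (rule sigma_algebra_sigma_sets[OF sub])
    show ?case using diff.IH by auto
  qed (auto intro: sigma_sets.intros)
  ultimately show ?thesis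
    using sub by auto
qed

definition core_le :: "'a set set \<Rightarrow> 'a \<Rightarrow> 'a \<Rightarrow> bool" where
  "core_le \<A> u v \<longleftrightarrow> (\<forall>A\<in>\<A>. v \<in> A \<longrightarrow> u \<in> A)"

definition core_decreasing :: "'a measure \<Rightarrow> 'a set set \<Rightarrow> ('a \<Rightarrow> ennreal) set" where
  "core_decreasing M \<A> =
     {f \<in> borel_measurable (sigma (space M) \<A>).
        \<forall>u\<in>space M. \<forall>v\<in>space M. core_le \<A> u v \<longrightarrow> f v \<le> f u}"

subsection \<open>Couples of spaces of measurable functions\<close>

text \<open>A space of extended-real-valued measurable functions is given by its norm, extended by
  \<open>\<infinity>\<close> to all measurable functions. Functions equal almost everywhere are identified by
  phrasing every equation between functions, and the linearity and well-definedness of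
  operators, modulo null sets. In both spaces of interest functions are finite almost
  everywhere (see below), so the convention for \<open>\<infinity> + -\<infinity>\<close> on \<^typ>\<open>ereal\<close> plays no role.\<close>

definition fun_space :: "'a measure \<Rightarrow> (('a \<Rightarrow> ereal) \<Rightarrow> ennreal) \<Rightarrow> ('a \<Rightarrow> ereal) set" where
  "fun_space M N = {f \<in> borel_measurable M. N f < \<infinity>}"

definition L1_norm :: "'a measure \<Rightarrow> ('a \<Rightarrow> ereal) \<Rightarrow> ennreal" where
  "L1_norm M f = (\<integral>\<^sup>+x. e2ennreal \<bar>f x\<bar> \<partial>M)"

definition Linf_down_norm :: "'a measure \<Rightarrow> 'a set set \<Rightarrow> ('a \<Rightarrow> ereal) \<Rightarrow> ennreal" where
  "Linf_down_norm M \<A> f =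
     (SUP g \<in> {g \<in> core_decreasing M \<A>. (\<integral>\<^sup>+x. g x \<partial>M) \<le> 1}.
        \<integral>\<^sup>+x. e2ennreal \<bar>f x\<bar> * g x \<partial>M)"

definition sum_space ::
  "'a measure \<Rightarrow> (('a \<Rightarrow> ereal) \<Rightarrow> ennreal) \<Rightarrow> (('a \<Rightarrow> ereal) \<Rightarrow> ennreal) \<Rightarrow> ('a \<Rightarrow> ereal) set" where
  "sum_space M N\<^sub>0 N\<^sub>1 =
     {f \<in> borel_measurable M.
        \<exists>f\<^sub>0\<in>fun_space M N\<^sub>0. \<exists>f\<^sub>1\<in>fun_space M N\<^sub>1. AE x in M. f x = f\<^sub>0 x + f\<^sub>1 x}"

definition K_functional ::
  "'a measure \<Rightarrow> (('a \<Rightarrow> ereal) \<Rightarrow> ennreal) \<Rightarrow> (('a \<Rightarrow> ereal) \<Rightarrow> ennreal) \<Rightarrow>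
   ('a \<Rightarrow> ereal) \<Rightarrow> real \<Rightarrow> ennreal" where
  "K_functional M N\<^sub>0 N\<^sub>1 f t =
     Inf {N\<^sub>0 f\<^sub>0 + ennreal t * N\<^sub>1 f\<^sub>1 | f\<^sub>0 f\<^sub>1.
            f\<^sub>0 \<in> fun_space M N\<^sub>0 \<and> f\<^sub>1 \<in> fun_space M N\<^sub>1 \<and> (AE x in M. f x = f\<^sub>0 x + f\<^sub>1 x)}"

definition admissible_contraction ::
  "'a measure \<Rightarrow> (('a \<Rightarrow> ereal) \<Rightarrow> ennreal) \<Rightarrow> (('a \<Rightarrow> ereal) \<Rightarrow> ennreal) \<Rightarrow>
   (('a \<Rightarrow> ereal) \<Rightarrow> ('a \<Rightarrow> ereal)) \<Rightarrow> bool" where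
  "admissible_contraction M N\<^sub>0 N\<^sub>1 T \<longleftrightarrow>
     (\<forall>f\<in>sum_space M N\<^sub>0 N\<^sub>1. T f \<in> sum_space M N\<^sub>0 N\<^sub>1) \<and>
     (\<forall>f\<in>sum_space M N\<^sub>0 N\<^sub>1. \<forall>g\<in>sum_space M N\<^sub>0 N\<^sub>1.
        (AE x in M. f x = g x) \<longrightarrow> (AE x in M. T f x = T g x)) \<and>
     (\<forall>f\<in>sum_space M N\<^sub>0 N\<^sub>1. \<forall>g\<in>sum_space M N\<^sub>0 N\<^sub>1.
        AE x in M. T (\<lambda>y. f y + g y) x = T f x + T g x) \<and>
     (\<forall>c::real. \<forall>f\<in>sum_space M N\<^sub>0 N\<^sub>1.
        AE x in M. T (\<lambda>y. ereal c * f y) x = ereal c * T f x) \<and>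
     (\<forall>f\<in>fun_space M N\<^sub>0. T f \<in> fun_space M N\<^sub>0 \<and> N\<^sub>0 (T f) \<le> N\<^sub>0 f) \<and>
     (\<forall>f\<in>fun_space M N\<^sub>1. T f \<in> fun_space M N\<^sub>1 \<and> N\<^sub>1 (T f) \<le> N\<^sub>1 f)"

definition exact_Calderon_couple ::
  "'a measure \<Rightarrow> (('a \<Rightarrow> ereal) \<Rightarrow> ennreal) \<Rightarrow> (('a \<Rightarrow> ereal) \<Rightarrow> ennreal) \<Rightarrow> bool" where
  "exact_Calderon_couple M N\<^sub>0 N\<^sub>1 \<longleftrightarrow>
     (\<forall>f\<in>sum_space M N\<^sub>0 N\<^sub>1. \<forall>g\<in>sum_space M N\<^sub>0 N\<^sub>1.
        (\<forall>t>0. K_functional M N\<^sub>0 N\<^sub>1 f t \<le> K_functional M N\<^sub>0 N\<^sub>1 g t) \<longrightarrow>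
        (\<exists>T. admissible_contraction M N\<^sub>0 N\<^sub>1 T \<and> (AE x in M. T g x = f x)))"

lemma AE_finite_L1:
  assumes "f \<in> fun_space M (L1_norm M)"
  shows "AE x in M. \<bar>f x\<bar> \<noteq> \<infinity>"
proof -
  have m: "(\<lambda>x. e2ennreal \<bar>f x\<bar>) \<in> borel_measurable M"
    using assms by (auto simp: fun_space_def)
  have "AE x in M. e2ennreal \<bar>f x\<bar> \<noteq> \<infinity>"
    using assms by (intro nn_integral_PInf_AE m) (auto simp: fun_space_def L1_norm_def)
  then show ?thesis
    by eventually_elim auto
qed

lemma AE_finite_Linf_down:
  assumes core: "full_ordered_core M \<A>" and f: "f \<in> fun_space M (Linf_down_norm M \<A>)"
  shows "AE x in M. \<bar>f x\<bar> \<noteq> \<infinity>"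
proof -
  have m: "(\<lambda>x. e2ennreal \<bar>f x\<bar>) \<in> borel_measurable M"
    using f by (auto simp: fun_space_def)
  have sub: "\<A> \<subseteq> Pow (space M)"
    using core by (auto simp: full_ordered_core_def)
  have *: "AE x in M. x \<in> A \<longrightarrow> \<bar>f x\<bar> \<noteq> \<infinity>" if A: "A \<in> \<A>" for A
  proof (cases "emeasure M A = 0")
    case True
    moreover have "A \<in> sets M"
      using A core by (auto simp: full_ordered_core_def ordered_core_def)
    ultimately have "AE x in M. x \<notin> A"
      by (intro AE_not_in) auto
    then show ?thesis by eventually_elim auto
  next
    case False
    have AM: "A \<in> sets M" "emeasure M A < \<infinity>"
      using A core by (auto simp: full_ordered_core_def ordered_core_def)
    define c where "c = inverse (emeasure M A)"
    define g where "g = (\<lambda>x. c * indicator A x :: ennreal)"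
    have c: "c * emeasure M A = 1"
      using ennreal_divide_self[of "emeasure M A"] False AM
      by (simp add: c_def divide_ennreal_def mult.commute)
    then have c0: "c \<noteq> 0"
      by auto
    have "A \<in> sets (sigma (space M) \<A>)"
      using A sub by auto
    then have "g \<in> borel_measurable (sigma (space M) \<A>)"
      unfolding g_def by measurable
    moreover have "g v \<le> g u" if "core_le \<A> u v" for u v
      using that A by (auto simp: g_def core_le_def indicator_def)
    ultimately have g: "g \<in> core_decreasing M \<A>"
      by (auto simp: core_decreasing_def)
    moreover have "(\<integral>\<^sup>+x. g x \<partial>M) \<le> 1"
      using AM c by (simp add: g_def nn_integral_cmult_indicator)
    ultimately have "(\<integral>\<^sup>+x. e2ennreal \<bar>f x\<bar> * g x \<partial>M) \<le> Linf_down_norm M \<A> f"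
      unfolding Linf_down_norm_def by (intro SUP_upper) auto
    then have fin: "(\<integral>\<^sup>+x. e2ennreal \<bar>f x\<bar> * g x \<partial>M) \<noteq> \<infinity>"
      using f by (simp add: fun_space_def) (metis top.not_eq_extremum top_unique)
    have "(\<lambda>x. e2ennreal \<bar>f x\<bar> * g x) \<in> borel_measurable M"
      using m AM unfolding g_def by measurable
    then have "AE x in M. e2ennreal \<bar>f x\<bar> * g x \<noteq> \<infinity>"
      using fin by (rule nn_integral_PInf_AE)
    moreover have "e2ennreal \<bar>f x\<bar> * g x = \<infinity>" if "x \<in> A" "\<bar>f x\<bar> = \<infinity>" for x
      using c0 that by (simp add: g_def ennreal_top_mult)
    ultimately show ?thesis
      by (auto elim!: eventually_mono)
  qed
  obtain \<A>\<^sub>0 where A0: "\<A>\<^sub>0 \<subseteq> \<A>" "countable \<A>\<^sub>0" "space M = \<Union>\<A>\<^sub>0"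
    using core unfolding full_ordered_core_def sigma_bounded_def by metis
  have "\<forall>A\<in>\<A>\<^sub>0. AE x in M. x \<in> A \<longrightarrow> \<bar>f x\<bar> \<noteq> \<infinity>"
    by (intro ballI *) (rule subsetD[OF A0(1)])
  then have ae: "AE x in M. \<forall>A\<in>\<A>\<^sub>0. x \<in> A \<longrightarrow> \<bar>f x\<bar> \<noteq> \<infinity>"
    by (simp only: AE_ball_countable[OF A0(2)])
  have "\<bar>f x\<bar> \<noteq> \<infinity>" if x: "x \<in> space M" "\<forall>A\<in>\<A>\<^sub>0. x \<in> A \<longrightarrow> \<bar>f x\<bar> \<noteq> \<infinity>" for x
  proof -
    obtain A where A: "A \<in> \<A>\<^sub>0" "x \<in> A"
      using x(1) unfolding A0(3) by (elim UnionE)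
    show ?thesis
      by (rule x(2)[rule_format, OF A])
  qed
  then have "AE x in M. (\<forall>A\<in>\<A>\<^sub>0. x \<in> A \<longrightarrow> \<bar>f x\<bar> \<noteq> \<infinity>) \<longrightarrow> \<bar>f x\<bar> \<noteq> \<infinity>"
    by (intro AE_I2 impI)
  with ae show ?thesis
    by (rule AE_mp)
qed

end

theory Submission
  imports Defs
begin

text \<open>
  Points of \<open>U\<close> are placed on the half-line by the position map \<open>p(u) = inf {\<mu>(A) | u \<in> A}\<close>,
  the infimum running over a countable part of the core that determines everything up to null
  sets. With \<open>F\<^sub>h(x) = \<integral> h over {p \<le> x}\<close>, for \<open>x\<close> in the closed set \<open>\<Lambda>\<close> of levels (the closure of
  the measures of core members), the down norm of \<open>h\<close> is the least \<open>C\<close> with \<open>F\<^bsub>|h|\<^esub>(x) \<le> C x\<close>, because a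
  decreasing test function is a mixture of indicators of down-sets (\<open>Linf_down_norm_le_iff\<close>).

  Cutting off the first \<open>b\<close> units of mass of \<open>|g|\<close> shows \<open>K(g,t) \<le> b + c t\<close> whenever the line
  \<open>b + c x\<close> lies above \<open>F\<^bsub>|g|\<^esub>\<close>, while \<open>F\<^bsub>|f|\<^esub>(x) \<le> K(f,x)\<close> always. Thus \<open>K(f,\<sqdot>) \<le> K(g,\<sqdot>)\<close> says that
  \<open>F\<^bsub>|f|\<^esub>\<close> lies below the least concave majorant \<open>G\<close> of \<open>F\<^bsub>|g|\<^esub>\<close> (\<open>source_targetI\<close>). After
  multiplication by signs one needs a positive operator \<open>T\<close> with \<open>T|g| = |f|\<close> that contracts both
  norms. It transports mass. Let \<open>Z\<close> be the set of contact points, where \<open>F\<^bsub>|g|\<^esub> = G\<close>.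
  Between consecutive contact points \<open>a < b\<close> the mass is spread evenly over the interval
  \<open>(F\<^bsub>|g|\<^esub>(a), F\<^bsub>|g|\<^esub>(b))\<close> of mass levels; this sends \<open>|g|\<close> to Lebesgue measure on the
  line of mass levels (\<open>push_own_density\<close>). Mass at level \<open>s\<close> is then delivered where \<open>F\<^bsub>|f|\<^esub>\<close>
  passes \<open>s\<close>. No mass is created, so \<open>T\<close> contracts \<open>L\<^sup>1\<close>. If \<open>F\<^sub>h(x) \<le> C x\<close>, then the mass of
  \<open>T h\<close> up to \<open>x\<close> is at most some \<open>(1-\<theta>) F\<^sub>h(a) + \<theta> F\<^sub>h(b) \<le> C ((1-\<theta>) a + \<theta> b)\<close>, and
  \<open>(1-\<theta>) a + \<theta> b \<le> x\<close> because the line through the two contact points lies above \<open>F\<^bsub>|f|\<^esub>\<close> and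
  takes at \<open>(1-\<theta>) a + \<theta> b\<close> a value not exceeding \<open>F\<^bsub>|f|\<^esub>(x)\<close> (\<open>dens_contracts\<close>).

  There may be a last contact point \<open>x\<^sub>0\<close>, after which \<open>G\<close> is affine of slope \<open>m > 0\<close> and is
  approached by \<open>F\<^bsub>|g|\<^esub>\<close> only at infinity. No kernel can produce the part of \<open>|f|\<close> above the
  level \<open>G(x\<^sub>0)\<close>; there \<open>T h\<close> is \<open>|f|\<close> times a Banach limit of \<open>F\<^sub>h(y\<^sub>n) / (m y\<^sub>n)\<close> along points
  \<open>y\<^sub>n\<close> realising the slope \<open>m\<close>. This functional vanishes on \<open>L\<^sup>1\<close> and is at most \<open>C/m\<close> when
  \<open>F\<^sub>h(x) \<le> C x\<close> (\<open>tail_functional_exists\<close>).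
\<close>

section \<open>Banach limits\<close>

definition Banach_limit :: "((nat \<Rightarrow> real) \<Rightarrow> real) \<Rightarrow> bool" where
  "Banach_limit L \<longleftrightarrow>
     (\<forall>a b. Bseq a \<longrightarrow> Bseq b \<longrightarrow> L (\<lambda>n. a n + b n) = L a + L b) \<and>
     (\<forall>c a. Bseq a \<longrightarrow> L (\<lambda>n. c * a n) = c * L a) \<and>
     (\<forall>a. Bseq a \<longrightarrow> (\<forall>n. 0 \<le> a n) \<longrightarrow> 0 \<le> L a) \<and>
     (\<forall>a l. a \<longlonglongrightarrow> l \<longrightarrow> L a = l)"

text \<open>Evaluation at \<open>n\<close> is a point of a product of compact intervals indexed by the
  sequences. By Tychonoff's theorem these points have a cluster point, and every closed condition
  that all evaluations satisfy passes to it.\<close>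

lemma Banach_limit_exists: "\<exists>L. Banach_limit L"
proof -
  define B :: "(nat \<Rightarrow> real) \<Rightarrow> real" where "B a = (SOME K. \<forall>n. \<bar>a n\<bar> \<le> K)" for a
  have B: "\<bar>a n\<bar> \<le> B a" if "Bseq a" for a n
  proof -
    have "\<exists>K. \<forall>n. \<bar>a n\<bar> \<le> K"
      using that by (auto simp: Bseq_def)
    then show ?thesis
      unfolding B_def by (rule someI2_ex) auto
  qed
  \<comment> \<open>Unbounded sequences are evaluated to 0, which keeps the range in a compact product.\<close>
  define e :: "nat \<Rightarrow> (nat \<Rightarrow> real) \<Rightarrow> real" where "e n a = (if Bseq a then a n else 0)" for n a
  define S where "S = PiE UNIV (\<lambda>a. if Bseq a then {- B a..B a} else {0})"
  have "compactin (product_topology (\<lambda>a. euclidean) UNIV) S"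
    unfolding S_def compactin_PiE by auto
  then have "compact S"
    by (metis compactin_euclidean_iff euclidean_product_topology)
  define F where "F = filtermap e sequentially"
  have "e n \<in> S" for n
    using B[of _ n] by (auto simp: e_def S_def abs_le_iff) (smt (verit) )+
  then have "eventually (\<lambda>x. x \<in> S) F"
    by (simp add: F_def eventually_filtermap)
  moreover have "F \<noteq> bot"
    by (simp add: F_def filtermap_bot_iff)
  ultimately obtain L where L: "inf (nhds L) F \<noteq> bot"
    using \<open>compact S\<close> unfolding compact_filter by blast
  have close: "P L" if cl: "closed (Collect P)" and ev: "\<And>n. P (e n)" for P
  proof (rule ccontr)
    assume "\<not> P L"
    then have "L \<in> - Collect P"
      by simp
    with cl have "eventually (\<lambda>x. x \<in> - Collect P) (nhds L)"
      by (auto simp: open_Compl eventually_nhds intro!: exI[of _ "- Collect P"])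
    moreover have "eventually P F"
      using ev by (simp add: F_def eventually_filtermap)
    ultimately have "eventually (\<lambda>x. False) (inf (nhds L) F)"
      by (auto simp: eventually_inf)
    with L show False
      by (simp add: trivial_limit_def)
  qed
  have coord: "continuous_on UNIV (\<lambda>x :: (nat \<Rightarrow> real) \<Rightarrow> real. x a)" for a
    by (rule continuous_on_product_coordinates)
  have Bseq_sum: "Bseq (\<lambda>n. a n + b n)" if "Bseq a" "Bseq b" for a b :: "nat \<Rightarrow> real"
    by (rule BseqI'[of _ "B a + B b"]) (use B[OF that(1)] B[OF that(2)] in \<open>simp add: abs_triangle_ineq order_trans[OF abs_triangle_ineq add_mono]\<close>)
  have "Banach_limit L"
    unfolding Banach_limit_def
  proof (intro conjI allI impI)
    show "L (\<lambda>n. a n + b n) = L a + L b" if "Bseq a" "Bseq b" for a b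
      by (rule close) (use that Bseq_sum[OF that] in \<open>auto simp: e_def intro!: closed_Collect_eq continuous_on_add coord\<close>)
    show "L (\<lambda>n. c * a n) = c * L a" if "Bseq a" for c a
      by (rule close) (use that Bseq_mult[OF Bfun_const[of c] that] in
          \<open>auto simp: e_def intro!: closed_Collect_eq continuous_on_mult continuous_on_const coord\<close>)
    show "0 \<le> L a" if "Bseq a" "\<forall>n. 0 \<le> a n" for a
      by (rule close) (use that in \<open>auto simp: e_def intro!: closed_Collect_le continuous_on_const coord\<close>)
    show "L a = l" if a: "a \<longlonglongrightarrow> l" for a l
    proof (rule ccontr)
      assume ne: "L a \<noteq> l"
      define r where "r = dist (L a) l / 2"
      have r: "r > 0" using ne by (simp add: r_def)
      have "Bseq a"
        using a by (intro convergent_imp_Bseq convergentI)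
      have "open {x :: (nat \<Rightarrow> real) \<Rightarrow> real. dist (x a) (L a) < r}"
        by (intro open_Collect_less continuous_on_dist continuous_on_const coord)
      then have "eventually (\<lambda>x. dist (x a) (L a) < r) (nhds L)"
        unfolding eventually_nhds using r by (intro exI conjI) auto
      moreover have "eventually (\<lambda>n. dist (a n) l < r) sequentially"
        using a r by (rule tendstoD)
      then have "eventually (\<lambda>x. dist (x a) l < r) F"
        using \<open>Bseq a\<close> by (simp add: F_def eventually_filtermap e_def)
      ultimately have "eventually (\<lambda>x. dist (x a) (L a) < r \<and> dist (x a) l < r) (inf (nhds L) F)"
        unfolding eventually_inf by blast
      moreover have "\<not> (dist y (L a) < r \<and> dist y l < r)" for y
        unfolding r_def using dist_triangle[of "L a" l y] by (auto simp: dist_commute)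
      ultimately have "eventually (\<lambda>x. False) (inf (nhds L) F)"
        by simp
      with L show False
        by (simp add: trivial_limit_def)
    qed
  qed
  then show ?thesis by blast
qed

section \<open>Mass levels along a closed set of positions\<close>

text \<open>Inserting 0 gives the right value at positions with nothing to their left, for every set that
  contains 0.\<close>

definition left_neighbour :: "real set \<Rightarrow> real \<Rightarrow> real" where
  "left_neighbour Z y = Sup (insert 0 {z \<in> Z. z < y})"

text \<open>Positions beyond the whole set get its supremum, so that the map is monotone, hence Borel.\<close>

definition right_neighbour :: "real set \<Rightarrow> real \<Rightarrow> real" where
  "right_neighbour Z y = (if \<exists>z\<in>Z. y \<le> z then Inf {z \<in> Z. y \<le> z} else Sup Z)"

text \<open>As \<open>\<theta>\<close> runs uniformly through \<open>[0,1]\<close>, the mass at position \<open>y\<close> is spread evenly over the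
  interval of mass levels between the two neighbours of \<open>y\<close> in \<open>Z\<close>. The same parameter also
  breaks up atoms of the mass distribution, at which a plain cumulative function would jump.\<close>

definition mass_level :: "(real \<Rightarrow> real) \<Rightarrow> real set \<Rightarrow> real \<Rightarrow> real \<Rightarrow> real" where
  "mass_level F Z y \<theta> =
     (1 - \<theta>) * F (left_neighbour Z y) + \<theta> * F (right_neighbour Z y)"

locale closed_levels =
  fixes Z :: "real set" and F :: "real \<Rightarrow> real"
  assumes closed_Z: "closed Z" and zero_Z: "0 \<in> Z" and Z_nonneg: "Z \<subseteq> {0..}"
    and mono_F: "mono F" and cont_F: "continuous_on Z F" and F_0: "F 0 = 0"
begin

lemma F_nonneg: "0 \<le> y \<Longrightarrow> 0 \<le> F y"
  using mono_F F_0 by (metis monoD)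

lemma left_neighbour_le: "0 \<le> y \<Longrightarrow> left_neighbour Z y \<le> y"
  unfolding left_neighbour_def by (rule cSup_least) auto

lemma le_left_neighbour: "z \<in> Z \<Longrightarrow> z < y \<Longrightarrow> z \<le> left_neighbour Z y"
  unfolding left_neighbour_def by (rule cSup_upper) (auto intro!: bdd_aboveI[of _ "max 0 y"])

lemma left_neighbour_nonneg: "0 \<le> left_neighbour Z y"
  unfolding left_neighbour_def by (rule cSup_upper) (auto intro!: bdd_aboveI[of _ "max 0 y"])

lemma right_neighbour_eq: "z \<in> Z \<Longrightarrow> y \<le> z \<Longrightarrow> right_neighbour Z y = Inf {z \<in> Z. y \<le> z}"
  by (auto simp: right_neighbour_def)

lemma le_right_neighbour: "z \<in> Z \<Longrightarrow> y \<le> z \<Longrightarrow> y \<le> right_neighbour Z y"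
  unfolding right_neighbour_eq by (rule cInf_greatest) auto

lemma right_neighbour_le: "z \<in> Z \<Longrightarrow> y \<le> z \<Longrightarrow> right_neighbour Z y \<le> z"
  unfolding right_neighbour_eq by (rule cInf_lower) (auto intro!: bdd_belowI[of _ y])

lemma mono_left_neighbour: "mono (left_neighbour Z)"
proof (rule monoI)
  fix x y :: real assume "x \<le> y"
  then show "left_neighbour Z x \<le> left_neighbour Z y"
    unfolding left_neighbour_def
    by (intro cSup_subset_mono) (auto intro!: bdd_aboveI[of _ "max 0 y"])
qed

lemma mono_right_neighbour: "mono (right_neighbour Z)"
proof (rule monoI)
  fix x y :: real assume xy: "x \<le> y"
  show "right_neighbour Z x \<le> right_neighbour Z y"
  proof (cases "\<exists>z\<in>Z. y \<le> z")
    case True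
    then obtain z where z: "z \<in> Z" "y \<le> z" by auto
    show ?thesis
      unfolding right_neighbour_eq[OF z] right_neighbour_eq[OF z(1) order_trans[OF xy z(2)]]
      using z xy by (intro cInf_superset_mono) (auto intro!: bdd_belowI[of _ x])
  next
    case False
    then have bdd: "bdd_above Z" by (meson bdd_aboveI not_le less_imp_le)
    show ?thesis
    proof (cases "\<exists>z\<in>Z. x \<le> z")
      case True
      then obtain z where z: "z \<in> Z" "x \<le> z" by auto
      have "right_neighbour Z x \<le> z" using z by (rule right_neighbour_le)
      also have "z \<le> Sup Z" using z bdd by (intro cSup_upper)
      finally show ?thesis using False by (simp add: right_neighbour_def)
    qed (use False in \<open>simp add: right_neighbour_def\<close>)
  qed
qed

lemma mass_level_le:
  assumes "0 \<le> y" "z \<in> Z" "y \<le> z" "0 \<le> \<theta>" "\<theta> \<le> 1"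
  shows "mass_level F Z y \<theta> \<le> F z"
proof -
  have "F (left_neighbour Z y) \<le> F z" "F (right_neighbour Z y) \<le> F z"
    using left_neighbour_le[of y] right_neighbour_le[of z y] assms
    by (auto intro!: monoD[OF mono_F])
  then show ?thesis
    unfolding mass_level_def using assms
    by (intro convex_bound_le) auto
qed

lemma le_mass_level:
  assumes "0 \<le> y" "y \<le> z" "z \<in> Z" "0 \<le> \<theta>" "\<theta> \<le> 1" "F (left_neighbour Z y) \<ge> s"
  shows "s \<le> mass_level F Z y \<theta>"
proof -
  have "left_neighbour Z y \<le> right_neighbour Z y"
    using left_neighbour_le[OF assms(1)] le_right_neighbour[OF assms(3,2)] by simp
  then have "s \<le> F (right_neighbour Z y)"
    using assms(6) monoD[OF mono_F] by (meson order_trans)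
  then have "- mass_level F Z y \<theta> \<le> - s"
    using assms convex_bound_le[of "- F (left_neighbour Z y)" "-s" "- F (right_neighbour Z y)" "1 - \<theta>" \<theta>]
    by (simp add: mass_level_def)
  then show ?thesis by simp
qed

text \<open>The sublevel set of a level \<open>s\<close> is \<open>{y \<le> a}\<close> together with the fraction \<open>\<theta>\<^sub>0\<close> of \<open>{a < y \<le> b}\<close>,
  where \<open>a\<close> is the last position with \<open>F a \<le> s\<close> and \<open>b\<close> the infimum of those with \<open>F b > s\<close>.
  Taking the last such \<open>a\<close> makes this exact, without exceptional null sets.\<close>

lemma mass_level_le_iff:
  assumes s: "0 \<le> s" and z0: "z0 \<in> Z" "s < F z0"
  obtains a b \<theta>\<^sub>0 where "a \<in> Z" "b \<in> Z" "a \<le> b" "0 \<le> \<theta>\<^sub>0" "\<theta>\<^sub>0 \<le> 1"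
    "s = (1 - \<theta>\<^sub>0) * F a + \<theta>\<^sub>0 * F b"
    "\<forall>y\<ge>0. \<forall>\<theta>\<in>{0..1}. (\<exists>z\<in>Z. y \<le> z) \<longrightarrow>
       (mass_level F Z y \<theta> \<le> s \<longleftrightarrow> y \<le> a \<or> y \<le> b \<and> \<theta> \<le> \<theta>\<^sub>0)"
    "a = b \<and> F a = s \<or> a < b \<and> F a \<le> s \<and> s < F b \<and> (\<forall>z\<in>Z. z \<le> a \<or> b \<le> z)"
proof -
  define A where "A = Z \<inter> F -` {..s}"
  define B where "B = {z \<in> Z. s < F z}"
  have A0: "0 \<in> A"
    using zero_Z s by (simp add: A_def F_0)
  have A_lt: "z < z'" if "z \<in> A" "z' \<in> B" for z z'
    using that monoD[OF mono_F, of z' z] by (force simp: A_def B_def not_less[symmetric])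
  have z0B: "z0 \<in> B"
    using z0 by (simp add: B_def)
  have bdd: "bdd_above A" "bdd_below B"
    using A_lt z0B A0 by (meson bdd_aboveI bdd_belowI less_imp_le)+
  define a where "a = Sup A"
  define b where "b = Inf B"
  have "closed A"
    unfolding A_def using cont_F closed_Z by (intro continuous_closed_preimage) auto
  then have aA: "a \<in> A"
    unfolding a_def using A0 bdd by (intro closed_contains_Sup) auto
  have "b \<in> closure B"
    unfolding b_def using z0B bdd by (intro closure_contains_Inf) auto
  moreover have "closed (Z \<inter> F -` {s..})"
    using cont_F closed_Z by (intro continuous_closed_preimage) auto
  then have "closure B \<subseteq> Z \<inter> F -` {s..}"
    by (rule closure_minimal[rotated]) (auto simp: B_def)
  ultimately have b: "b \<in> Z" "s \<le> F b"
    by auto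
  have le_a: "z \<le> a" if "z \<in> A" for z
    unfolding a_def using that bdd(1) by (rule cSup_upper)
  have b_le: "b \<le> z" if "z \<in> B" for z
    unfolding b_def using that bdd(2) by (rule cInf_lower)
  have a: "a \<in> Z" "F a \<le> s"
    using aA by (auto simp: A_def)
  have ab: "a \<le> b"
    unfolding b_def using z0B A_lt[OF aA] by (intro cInf_greatest) (auto intro: less_imp_le)
  have gap: "z \<le> a \<or> b \<le> z" if "z \<in> Z" for z
    using le_a[of z] b_le[of z] that by (cases "F z \<le> s") (auto simp: A_def B_def)
  have low: "mass_level F Z y \<theta> \<le> s" if "0 \<le> y" "y \<le> a" "0 \<le> \<theta>" "\<theta> \<le> 1" for y \<theta>
    using mass_level_le[of y a \<theta>] that a by simp
  show thesis
  proof (cases "F b = s")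
    case True
    then have "b \<in> A"
      using b by (simp add: A_def)
    then have eq: "a = b"
      using le_a ab by force
    have high: "s < mass_level F Z y \<theta>" if y: "a < y" "z \<in> Z" "y \<le> z" "0 \<le> \<theta>" "\<theta> \<le> 1" for y z \<theta>
    proof -
      have "Inf B < y"
        using y eq by (simp add: b_def)
      moreover have "B \<noteq> {}" using z0B by auto
      ultimately obtain z' where z': "z' \<in> B" "z' < y"
        using cInf_lessD by metis
      then have "F z' \<le> F (left_neighbour Z y)"
        by (intro monoD[OF mono_F] le_left_neighbour) (auto simp: B_def)
      moreover have "0 \<le> y"
        using y a Z_nonneg by auto
      ultimately have "F z' \<le> mass_level F Z y \<theta>"
        using y by (intro le_mass_level[of y z]) auto
      with z' show ?thesis by (simp add: B_def)
    qed
    show thesis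
    proof (rule that[of a a 0])
      have "mass_level F Z y \<theta> \<le> s \<longleftrightarrow> y \<le> a \<or> y \<le> a \<and> \<theta> \<le> 0"
        if "0 \<le> y" "\<exists>z\<in>Z. y \<le> z" "0 \<le> \<theta>" "\<theta> \<le> 1" for y \<theta>
        using that low[of y \<theta>] high[of y _ \<theta>] by (meson not_less)
      then show "\<forall>y\<ge>0. \<forall>\<theta>\<in>{0..1}. (\<exists>z\<in>Z. y \<le> z) \<longrightarrow>
          (mass_level F Z y \<theta> \<le> s \<longleftrightarrow> y \<le> a \<or> y \<le> a \<and> \<theta> \<le> 0)"
        by auto
    qed (use a True eq in auto)
  next
    case False
    then have sb: "s < F b" using b by simp
    then have ab': "a < b" using a ab by (metis not_less order_le_less)
    define \<theta>\<^sub>0 where "\<theta>\<^sub>0 = (s - F a) / (F b - F a)"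
    have d: "F b - F a > 0" using a sb by simp
    show thesis
    proof (rule that[of a b \<theta>\<^sub>0])
      show "0 \<le> \<theta>\<^sub>0" "\<theta>\<^sub>0 \<le> 1"
        unfolding \<theta>\<^sub>0_def using d a sb by (auto simp: divide_simps)
      show "s = (1 - \<theta>\<^sub>0) * F a + \<theta>\<^sub>0 * F b"
        unfolding \<theta>\<^sub>0_def using d by (simp add: divide_simps) (simp add: algebra_simps)
      have "mass_level F Z y \<theta> \<le> s \<longleftrightarrow> y \<le> a \<or> y \<le> b \<and> \<theta> \<le> \<theta>\<^sub>0"
        if y: "0 \<le> y" "\<exists>z\<in>Z. y \<le> z" "0 \<le> \<theta>" "\<theta> \<le> 1" for y \<theta>
      proof -
        consider "y \<le> a" | "a < y" "y \<le> b" | "b < y" by linarith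
        then show ?thesis
        proof cases
          case 1
          then show ?thesis using low y by simp
        next
          case 2
          have "left_neighbour Z y = a"
            unfolding left_neighbour_def
            by (rule cSup_eq_maximum) (use 2 a gap Z_nonneg in force)+
          moreover have "right_neighbour Z y = b"
            unfolding right_neighbour_eq[OF b(1) 2(2)]
            by (rule cInf_eq_minimum) (use 2 b gap in force)+
          ultimately have "mass_level F Z y \<theta> = F a + \<theta> * (F b - F a)"
            by (simp add: mass_level_def algebra_simps)
          then show ?thesis
            using 2 d by (simp add: \<theta>\<^sub>0_def pos_le_divide_eq) linarith
        next
          case 3
          have "F b \<le> F (left_neighbour Z y)"
            using 3 b by (intro monoD[OF mono_F] le_left_neighbour) auto
          then have "F b \<le> mass_level F Z y \<theta>"
            using y by (auto intro: le_mass_level)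
          then show ?thesis using 3 ab sb by auto
        qed
      qed
      then show "\<forall>y\<ge>0. \<forall>\<theta>\<in>{0..1}. (\<exists>z\<in>Z. y \<le> z) \<longrightarrow>
          (mass_level F Z y \<theta> \<le> s \<longleftrightarrow> y \<le> a \<or> y \<le> b \<and> \<theta> \<le> \<theta>\<^sub>0)"
        by simp
    qed (use a b ab ab' sb gap in auto)
  qed
qed

text \<open>Reduces suprema over the set to monotone limits of sequences.\<close>

lemma cofinal_sequence:
  obtains z :: "nat \<Rightarrow> real" where "incseq z" "\<And>n. z n \<in> Z" "\<And>y. y \<in> Z \<Longrightarrow> \<exists>n. y \<le> z n"
proof (cases "bdd_above Z")
  case True
  then have "Sup Z \<in> Z"
    using closed_Z zero_Z by (intro closed_contains_Sup) auto
  with True show thesis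
    by (intro that[of "\<lambda>_. Sup Z"]) (auto intro: cSup_upper)
next
  case False
  then have ex: "\<exists>z\<in>Z. x \<le> z" for x
    by (meson bdd_above.I le_cases)
  define z where "z n = right_neighbour Z (real n)" for n
  have z: "z n \<in> Z" for n
  proof -
    have "closed {z \<in> Z. real n \<le> z}"
      using closed_Int[OF closed_Z closed_atLeast[of "real n"]] by (simp add: Int_def)
    then have "Inf {z \<in> Z. real n \<le> z} \<in> {z \<in> Z. real n \<le> z}"
      using ex[of "real n"] by (intro closed_contains_Inf) (auto intro!: bdd_belowI[of _ "real n"])
    moreover obtain w where "w \<in> Z" "real n \<le> w" using ex by blast
    ultimately show ?thesis by (simp add: z_def right_neighbour_eq)
  qed
  have ge: "real n \<le> z n" for n
    using ex[of "real n"] by (auto simp: z_def intro: le_right_neighbour)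
  show thesis
  proof
    show "incseq z"
    proof (rule incseq_SucI)
      show "z n \<le> z (Suc n)" for n
        using right_neighbour_le[of "z (Suc n)" "real n"] z[of "Suc n"] ge[of "Suc n"]
        by (simp add: z_def)
    qed
    show "\<exists>n. y \<le> z n" for y
      using ge by (meson order_trans real_arch_simple)
  qed (rule z)
qed

end

section \<open>Contact points of the least concave majorant\<close>

text \<open>The cumulative mass \<open>F\<close> of a function as a function on the set \<open>\<Lambda>\<close> of levels. Linear growth
  expresses that the function lies in the sum of the two spaces.\<close>

locale mass_profile =
  fixes \<Lambda> :: "real set" and F :: "real \<Rightarrow> real" and K :: real
  assumes closed_\<Lambda>: "closed \<Lambda>" and zero_\<Lambda>: "0 \<in> \<Lambda>" and \<Lambda>_nonneg: "\<Lambda> \<subseteq> {0..}"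
    and mono_F: "mono F" and cont_F: "continuous_on \<Lambda> F" and F_0: "F 0 = 0"
    and F_growth: "\<And>y. y \<in> \<Lambda> \<Longrightarrow> F y \<le> K + K * y"
begin

definition majorant :: "real \<Rightarrow> real \<Rightarrow> bool" where
  "majorant b c \<longleftrightarrow> 0 \<le> c \<and> (\<forall>y\<in>\<Lambda>. F y \<le> b + c * y)"

definition touches :: "real \<Rightarrow> real \<Rightarrow> bool" where
  "touches z c \<longleftrightarrow> (\<forall>y\<in>\<Lambda>. F y \<le> F z + c * (y - z))"

text \<open>The slope at infinity of the least concave majorant of \<open>F\<close>: the infimum of the slopes of all
  affine majorants.\<close>

definition asymptotic_slope :: real where
  "asymptotic_slope = Inf {c. \<exists>b. majorant b c}"

text \<open>Points where an affine majorant of sufficient slope touches the graph of \<open>F\<close>, that is, where \<open>F\<close>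
  meets its least concave majorant. The origin is added by hand, since the majorant may leave it
  with infinite slope.\<close>

definition contacts :: "real set" where
  "contacts = insert 0 {z \<in> \<Lambda>. \<exists>c \<ge> asymptotic_slope. touches z c}"

lemma K_nonneg: "0 \<le> K"
  using F_growth[OF zero_\<Lambda>] F_0 by simp

lemma majorant_nonneg: "majorant b c \<Longrightarrow> 0 \<le> b"
  using zero_\<Lambda> F_0 by (force simp: majorant_def)

lemma majorant_K: "majorant K K"
  using F_growth K_nonneg by (simp add: majorant_def)

lemma asymptotic_slope_nonneg: "0 \<le> asymptotic_slope"
  unfolding asymptotic_slope_def using majorant_K
  by (intro cInf_greatest) (auto simp: majorant_def)

lemma asymptotic_slope_le: "majorant b c \<Longrightarrow> asymptotic_slope \<le> c"
  unfolding asymptotic_slope_def by (intro cInf_lower bdd_belowI[of _ 0]) (auto simp: majorant_def)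

lemma majorant_above:
  assumes "asymptotic_slope < c"
  obtains b c' where "majorant b c'" "c' < c"
proof -
  have "{c. \<exists>b. majorant b c} \<noteq> {}"
    using majorant_K by auto
  from cInf_lessD[OF this, of c] assms show thesis
    using that by (auto simp: asymptotic_slope_def)
qed

text \<open>For a slope \<open>c\<close> above the asymptotic one, \<open>F y - c y\<close> does not exceed its value at the origin outside
  a bounded interval, so that its maximum over \<open>\<Lambda>\<close> is attained on a compact part.\<close>

lemma touches_above:
  assumes "asymptotic_slope < c"
  obtains z where "z \<in> \<Lambda>" "touches z c"
proof -
  obtain b c' where b: "majorant b c'" "c' < c"
    using majorant_above[OF assms] .
  define R where "R = b / (c - c')"
  have b0: "0 \<le> b" using b(1) by (rule majorant_nonneg)
  then have R: "R \<ge> 0" using b by (simp add: R_def)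
  have "compact (\<Lambda> \<inter> {0..R})"
    using closed_\<Lambda> by (simp add: closed_Int_compact)
  moreover have "0 \<in> \<Lambda> \<inter> {0..R}"
    using zero_\<Lambda> R by simp
  moreover have "continuous_on (\<Lambda> \<inter> {0..R}) (\<lambda>y. F y - c * y)"
    by (intro continuous_intros continuous_on_subset[OF cont_F]) auto
  ultimately obtain z where z: "z \<in> \<Lambda> \<inter> {0..R}" "\<And>y. y \<in> \<Lambda> \<inter> {0..R} \<Longrightarrow> F y - c * y \<le> F z - c * z"
    using continuous_attains_sup[of "\<Lambda> \<inter> {0..R}" "\<lambda>y. F y - c * y"] by blast
  have "F y - c * y \<le> F z - c * z" if y: "y \<in> \<Lambda>" for y
  proof (cases "y \<le> R")
    case True
    then show ?thesis using z y \<Lambda>_nonneg by auto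
  next
    case False
    then have "b \<le> (c - c') * y"
      using b by (simp add: R_def pos_divide_less_eq not_le mult.commute)
    then have "F y - c * y \<le> 0"
      using b(1) y by (auto simp: majorant_def algebra_simps)
    also have "0 \<le> F z - c * z"
      using z(2)[of 0] zero_\<Lambda> R by (simp add: F_0)
    finally show ?thesis .
  qed
  with z show thesis
    by (intro that[of z]) (auto simp: touches_def algebra_simps)
qed

lemma majorant_touches:
  assumes "touches z c" "0 \<le> c" 
  shows "majorant (F z - c * z) c"
  using assms by (auto simp: majorant_def touches_def algebra_simps)

lemma contacts_subset: "contacts \<subseteq> \<Lambda>"
  using zero_\<Lambda> by (auto simp: contacts_def)

text \<open>At a limit \<open>l > 0\<close> the touching slopes \<open>c\<close> stay bounded, because comparison with the origin gives
  \<open>c z \<le> F z\<close>; a convergent subsequence of slopes touches at \<open>l\<close>.\<close>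

lemma closed_contacts: "closed contacts"
  unfolding closed_sequential_limits
proof (intro allI impI)
  fix x l assume A: "(\<forall>n. x n \<in> contacts) \<and> x \<longlonglongrightarrow> l"
  then have xl: "x \<longlonglongrightarrow> l" and x: "\<And>n. x n \<in> contacts" by auto
  have l: "l \<in> \<Lambda>"
    using closed_sequentially[OF closed_\<Lambda> _ xl] x contacts_subset by blast
  show "l \<in> contacts"
  proof (cases "l = 0")
    case True
    then show ?thesis by (simp add: contacts_def)
  next
    case False
    then have l0: "l > 0" using l \<Lambda>_nonneg by force
    from xl l0 have "eventually (\<lambda>n. l / 2 < x n) sequentially"
      by (intro order_tendstoD(1)) auto
    then obtain N where N: "\<And>n. n \<ge> N \<Longrightarrow> l / 2 < x n"
      by (auto simp: eventually_sequentially)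
    have "\<exists>c \<ge> asymptotic_slope. touches (x (n + N)) c" for n
      using x[of "n + N"] N[of "n + N"] l0 by (auto simp: contacts_def)
    then obtain c where c: "\<And>n. c n \<ge> asymptotic_slope" "\<And>n. touches (x (n + N)) (c n)"
      by metis
    have xL: "x n \<in> \<Lambda>" for n
      using x contacts_subset by auto
    obtain B where B: "\<And>n. \<bar>x n\<bar> \<le> B"
      using convergent_imp_Bseq[OF convergentI[OF xl]] by (auto simp: Bseq_def)
    have c_bd: "c n \<in> {asymptotic_slope..F B / (l / 2)}" for n
    proof -
      have "0 \<le> F (x (n + N)) + c n * (0 - x (n + N))"
        using c(2)[of n] zero_\<Lambda> F_0 by (auto simp: touches_def)
      moreover have "F (x (n + N)) \<le> F B"
        using B[of "n + N"] by (intro monoD[OF mono_F]) auto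
      moreover have "c n * (l / 2) \<le> c n * x (n + N)"
        using N[of "n + N"] c(1)[of n] asymptotic_slope_nonneg by (intro mult_left_mono) auto
      ultimately have "c n * (l / 2) \<le> F B" by simp
      then show ?thesis
        using c(1)[of n] l0 by (simp add: pos_le_divide_eq)
    qed
    have "seq_compact {asymptotic_slope..F B / (l / 2)}"
      using compact_imp_seq_compact compact_Icc by blast
    then obtain c' r where r: "c' \<in> {asymptotic_slope..F B / (l / 2)}" "strict_mono r"
        "(c \<circ> r) \<longlonglongrightarrow> c'"
      using c_bd unfolding seq_compact_def by blast
    define x' where "x' k = x (r k + N)" for k
    have x': "x' \<longlonglongrightarrow> l"
      using LIMSEQ_subseq_LIMSEQ[OF LIMSEQ_ignore_initial_segment[OF xl, of N] r(2)]
      by (simp add: x'_def[abs_def] o_def)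
    have Fx': "(\<lambda>k. F (x' k)) \<longlonglongrightarrow> F l"
      by (rule continuous_on_tendsto_compose[OF cont_F x' l]) (simp add: x'_def xL)
    have "F y \<le> F l + c' * (y - l)" if y: "y \<in> \<Lambda>" for y
    proof (rule LIMSEQ_le_const)
      show "(\<lambda>k. F (x' k) + (c \<circ> r) k * (y - x' k)) \<longlonglongrightarrow> F l + c' * (y - l)"
        by (intro tendsto_intros Fx' r x')
      show "\<exists>N. \<forall>n\<ge>N. F y \<le> F (x' n) + (c \<circ> r) n * (y - x' n)"
        using c(2) y by (auto simp: touches_def x'_def)
    qed
    then show ?thesis
      using l r(1) by (auto simp: contacts_def touches_def)
  qed
qed

text \<open>If \<open>F\<close> exceeded the chord over a gap of the contact set, then a maximum point of \<open>F\<close> minus the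
  chord would be a further contact point. It cannot lie in the gap, and outside the gap the slopes
  touching at \<open>a\<close> or at \<open>b\<close> forbid it. A chord of the asymptotic slope is itself the line
  touching at \<open>b\<close>.\<close>

lemma chord_touches:
  assumes a: "a \<in> contacts" and b: "b \<in> contacts" and ab: "a < b"
    and gap: "\<And>z. z \<in> contacts \<Longrightarrow> z \<le> a \<or> b \<le> z"
    and c: "c = (F b - F a) / (b - a)"
  shows "touches a c"
proof -
  have Fb: "F b = F a + c * (b - a)"
    using ab c by simp
  have a0: "0 \<le> a" using a contacts_subset \<Lambda>_nonneg by auto
  obtain cb where cb: "cb \<ge> asymptotic_slope" "touches b cb"
    using b a0 ab by (auto simp: contacts_def)
  have "F a \<le> F b + cb * (a - b)"
    using cb a contacts_subset by (auto simp: touches_def)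
  then have "cb * (b - a) \<le> c * (b - a)"
    using Fb by (simp add: algebra_simps)
  then have cbc: "cb \<le> c"
    using ab by simp
  show ?thesis
  proof (cases "c = asymptotic_slope")
    case True
    then have "touches b c" using cb cbc by simp
    then show ?thesis
      by (auto simp: touches_def Fb algebra_simps)
  next
    case False
    then have "asymptotic_slope < c" using cb cbc by simp
    then obtain z where z: "z \<in> \<Lambda>" "touches z c"
      by (rule touches_above)
    have "F z \<le> F a + c * (z - a)"
    proof (rule ccontr)
      assume "\<not> ?thesis"
      then have gt: "F z > F a + c * (z - a)" by simp
      have "z \<in> contacts"
        using z \<open>asymptotic_slope < c\<close> by (auto simp: contacts_def)
      then consider "z = a" | "z < a" | "z = b" | "b < z" using gap by force
      then show False
      proof cases
        case 2
        then have "a \<noteq> 0" using z \<Lambda>_nonneg by auto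
        then obtain ca where ca: "touches a ca"
          using a by (auto simp: contacts_def)
        have "F z \<le> F a + ca * (z - a)" "F b \<le> F a + ca * (b - a)"
          using ca z b contacts_subset by (auto simp: touches_def)
        then have "c * (z - a) < ca * (z - a)" "c * (b - a) \<le> ca * (b - a)"
          using gt Fb by auto
        then show False using 2 ab by (simp add: mult_less_cancel_right)
      next
        case 4
        have "F z \<le> F b + cb * (z - b)"
          using cb z by (auto simp: touches_def)
        also have "\<dots> \<le> F b + c * (z - b)"
          using cbc 4 by (intro add_left_mono mult_right_mono) auto
        also have "\<dots> = F a + c * (z - a)"
          by (simp add: Fb algebra_simps)
        finally show False using gt by simp
      qed (use gt Fb in auto)
    qed
    moreover have "F y \<le> F z + c * (y - z)" if "y \<in> \<Lambda>" for y
      using z that by (auto simp: touches_def)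
    ultimately show ?thesis
      unfolding touches_def by (force simp: algebra_simps)
  qed
qed

text \<open>Every positive mass level below the supremum of \<open>F\<close> over the contact set is a value of an affine
  majorant of positive slope that touches at both neighbouring contact points: of the chord, or of
  a line touching at the single point where \<open>F\<close> takes that level.\<close>

lemma contact_line:
  assumes ab: "a \<in> contacts" "b \<in> contacts"
    "a = b \<and> F a = s \<or> a < b \<and> F a \<le> s \<and> s < F b \<and> (\<forall>z\<in>contacts. z \<le> a \<or> b \<le> z)"
    and z: "z \<in> contacts" "s < F z" and s: "0 < s"
  obtains \<beta> c where "majorant \<beta> c" "0 < c" "F a = \<beta> + c * a" "F b = \<beta> + c * b"
proof -
  have zL: "z \<in> \<Lambda>" using z contacts_subset by auto
  consider "a = b" "F a = s" | "a < b" "F a \<le> s" "s < F b" "\<forall>z\<in>contacts. z \<le> a \<or> b \<le> z"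
    using ab by auto
  then have "\<exists>c>0. touches a c \<and> F b = F a + c * (b - a)"
  proof cases
    case 1
    then have "a \<noteq> 0" using s F_0 by auto
    then obtain c where c: "c \<ge> asymptotic_slope" "touches a c"
      using ab(1) by (auto simp: contacts_def)
    have "c \<noteq> 0"
      using c(2) zL z 1 by (auto simp: touches_def)
    then have "c > 0"
      using c(1) asymptotic_slope_nonneg by simp
    then show ?thesis using c 1 by auto
  next
    case 2
    define c where "c = (F b - F a) / (b - a)"
    have "touches a c"
      using 2 ab by (intro chord_touches[OF ab(1,2) _ _ c_def]) auto
    then show ?thesis
      using 2 by (intro exI[of _ c]) (auto simp: c_def)
  qed
  then obtain c where c: "c > 0" "touches a c" "F b = F a + c * (b - a)" by auto
  show thesis
  proof
    show "majorant (F a - c * a) c"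
      using c by (intro majorant_touches) auto
  qed (use c in \<open>auto simp: algebra_simps\<close>)
qed

lemma majorant_from_contacts:
  assumes x0: "x0 \<in> contacts" "\<And>z. z \<in> contacts \<Longrightarrow> z \<le> x0" and c: "asymptotic_slope < c"
  shows "majorant (F x0 - asymptotic_slope * x0) c"
proof -
  let ?m = asymptotic_slope
  obtain z where z: "z \<in> \<Lambda>" "touches z c"
    using touches_above[OF c] .
  then have zc: "z \<in> contacts" using c by (auto simp: contacts_def)
  have z0: "0 \<le> z" using z \<Lambda>_nonneg by auto
  have "F z \<le> F x0 + ?m * (z - x0)"
  proof (cases "x0 = 0")
    case True
    then have "z = x0" using x0(2)[OF zc] z0 by simp
    then show ?thesis by simp
  next
    case False
    then obtain c0 where c0: "c0 \<ge> ?m" "touches x0 c0"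
      using x0(1) by (auto simp: contacts_def)
    have "F z \<le> F x0 + c0 * (z - x0)"
      using c0 z by (auto simp: touches_def)
    also have "\<dots> \<le> F x0 + ?m * (z - x0)"
      using c0 x0(2)[OF zc] by (intro add_left_mono mult_right_mono_neg) auto
    finally show ?thesis .
  qed
  moreover have "?m * z \<le> c * z"
    using c z0 by (intro mult_right_mono) auto
  ultimately have "F z - c * z \<le> F x0 - ?m * x0"
    by (simp add: algebra_simps)
  moreover have "majorant (F z - c * z) c"
    using z c asymptotic_slope_nonneg by (intro majorant_touches) auto
  ultimately show ?thesis
    by (fastforce simp: majorant_def)
qed

text \<open>If some value that lies below all affine majorants exceeds the supremum of \<open>F\<close> over
  the contact set, then the contact set ends and the majorant continues with positive slope.
  With asymptotic slope 0, lines touching at contact points would come arbitrarily close to that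
  supremum at \<open>x\<close>; a contact point \<open>z\<close> satisfies \<open>m z \<le> F z\<close> for the asymptotic slope \<open>m\<close>, which
  bounds the contact set.\<close>

lemma beyond_contacts:
  assumes S: "\<And>z. z \<in> contacts \<Longrightarrow> F z \<le> S" "S < s"
    and below: "\<And>\<beta> c. majorant \<beta> c \<Longrightarrow> s \<le> \<beta> + c * x" and x: "x \<in> \<Lambda>"
  shows "0 < asymptotic_slope" "bdd_above contacts"
proof -
  let ?m = asymptotic_slope
  show m: "0 < ?m"
  proof (rule ccontr)
    assume "\<not> 0 < ?m"
    then have m0: "?m = 0" using asymptotic_slope_nonneg by simp
    have x0: "0 \<le> x" using x \<Lambda>_nonneg by auto
    define c where "c = (s - S) / (x + 1)"
    have c: "0 < c" using S x0 by (simp add: c_def)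
    obtain z where z: "z \<in> \<Lambda>" "touches z c"
      using touches_above[of c] m0 c by auto
    have "z \<in> contacts" using z c m0 by (auto simp: contacts_def)
    then have "F z \<le> S" by (rule S)
    moreover have "s \<le> F z - c * z + c * x"
      using z c by (intro below majorant_touches) auto
    moreover have "0 \<le> c * z" using c z \<Lambda>_nonneg by auto
    moreover have "s - S = c * (x + 1)" using x0 by (simp add: c_def)
    ultimately show False
      using c by (simp add: algebra_simps)
  qed
  show "bdd_above contacts"
  proof (rule bdd_aboveI)
    fix z assume z: "z \<in> contacts"
    show "z \<le> \<bar>s\<bar> / ?m"
    proof (cases "z = 0")
      case False
      then obtain c where c: "c \<ge> ?m" "touches z c"
        using z by (auto simp: contacts_def)
      have "0 \<le> z" using z contacts_subset \<Lambda>_nonneg by auto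
      then have "?m * z \<le> c * z"
        using c by (intro mult_right_mono) auto
      also have "c * z \<le> F z"
        using c zero_\<Lambda> F_0 by (force simp: touches_def)
      also have "F z \<le> \<bar>s\<bar>" using S(1)[OF z] S(2) by simp
      finally show ?thesis
        using m by (simp add: pos_le_divide_eq mult.commute)
    qed (use m in simp)
  qed
qed


text \<open>After the last contact point the majorant is the line of the asymptotic slope.\<close>

lemma affine_bound_of_majorants:
  assumes x0: "x0 \<in> contacts" "\<And>z. z \<in> contacts \<Longrightarrow> z \<le> x0"
    and below: "\<And>\<beta> c. majorant \<beta> c \<Longrightarrow> s \<le> \<beta> + c * x"
  shows "s \<le> F x0 + asymptotic_slope * (x - x0)"
proof (rule field_le_epsilon)
  let ?m = asymptotic_slope
  fix e :: real assume e: "0 < e"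
  define d where "d = e / (\<bar>x\<bar> + 1)"
  have d: "d > 0" using e by (simp add: d_def)
  have "s \<le> (F x0 - ?m * x0) + (?m + d) * x"
    using d by (intro below majorant_from_contacts x0) auto
  moreover have "d * x \<le> d * (\<bar>x\<bar> + 1)"
    using d by (intro mult_left_mono) auto
  moreover have "d * (\<bar>x\<bar> + 1) = e" by (simp add: d_def)
  ultimately show "s \<le> F x0 + ?m * (x - x0) + e"
    by (simp add: algebra_simps)
qed

text \<open>No line of slope below the asymptotic slope is a majorant; violations of such lines with ever
  larger intercepts occur at points that realise the asymptotic slope in the limit.\<close>

lemma asymptotic_sequence:
  assumes m: "0 < asymptotic_slope" and x0: "x0 \<in> contacts" "\<And>z. z \<in> contacts \<Longrightarrow> z \<le> x0"
  obtains y :: "nat \<Rightarrow> real" where "\<And>n. y n \<in> \<Lambda>" "\<And>n. 1 \<le> y n"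
    "filterlim y at_top sequentially" "(\<lambda>n. F (y n) / y n) \<longlonglongrightarrow> asymptotic_slope"
proof -
  let ?m = asymptotic_slope
  define c where "c n = max 0 (?m - 1 / real (Suc n))" for n
  \<comment> \<open>The intercept exceeds the growth bound on \<open>[0, n + 1]\<close>, which forces the witnesses to infinity.\<close>
  define B where "B n = K + (K + 1) * real (Suc n)" for n
  have "\<exists>y\<in>\<Lambda>. F y > B n + c n * y" for n
  proof (rule ccontr)
    assume "\<not> ?thesis"
    then have "majorant (B n) (c n)"
      by (auto simp: majorant_def c_def not_less)
    then have "?m \<le> c n" by (rule asymptotic_slope_le)
    moreover have "c n < ?m" using m by (simp add: c_def)
    ultimately show False by simp
  qed
  then obtain y where y: "\<And>n. y n \<in> \<Lambda>" "\<And>n. F (y n) > B n + c n * y n"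
    by metis
  have y0: "0 \<le> y n" for n using y(1)[of n] \<Lambda>_nonneg by auto
  have ge: "real (Suc n) \<le> y n" for n
  proof (rule ccontr)
    assume "\<not> ?thesis"
    then have "K * y n \<le> K * real (Suc n)"
      using K_nonneg by (intro mult_left_mono) auto
    then have "F (y n) \<le> K + K * real (Suc n)"
      using F_growth[OF y(1)[of n]] by simp
    moreover have "0 \<le> c n * y n" using y0[of n] by (simp add: c_def)
    ultimately show False using y(2)[of n] by (simp add: B_def algebra_simps)
  qed
  have upper: "F z \<le> F x0 + ?m * (z - x0)" if "z \<in> \<Lambda>" for z
    using that by (intro affine_bound_of_majorants x0) (auto simp: majorant_def)
  have pos: "0 < y n" for n using ge[of n] by simp
  have top: "filterlim y at_top sequentially"
    by (rule filterlim_at_top_mono[OF filterlim_real_sequentially])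
      (use ge in \<open>auto intro!: always_eventually order_trans[OF _ ge]\<close>)
  have "(\<lambda>n. F (y n) / y n) \<longlonglongrightarrow> ?m"
  proof (rule tendsto_sandwich)
    have "(\<lambda>n. ?m - 1 / real (Suc n)) \<longlonglongrightarrow> ?m - 0"
      by (intro tendsto_diff tendsto_const LIMSEQ_Suc lim_1_over_n)
    then show "(\<lambda>n. ?m - 1 / real (Suc n)) \<longlonglongrightarrow> ?m" by simp
    have "(\<lambda>n. (F x0 - ?m * x0) / y n + ?m) \<longlonglongrightarrow> 0 + ?m"
      by (intro tendsto_add tendsto_const real_tendsto_divide_at_top[OF tendsto_const top])
    then show "(\<lambda>n. (F x0 - ?m * x0) / y n + ?m) \<longlonglongrightarrow> ?m" by simp
    show "\<forall>\<^sub>F n in sequentially. ?m - 1 / real (Suc n) \<le> F (y n) / y n"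
    proof (rule always_eventually, rule allI)
      fix n
      have "0 \<le> B n" using K_nonneg by (simp add: B_def)
      then have "c n * y n \<le> F (y n)" using y(2)[of n] by simp
      then have "c n \<le> F (y n) / y n" using pos[of n] by (simp add: pos_le_divide_eq)
      then show "?m - 1 / real (Suc n) \<le> F (y n) / y n" by (simp add: c_def)
    qed
    show "\<forall>\<^sub>F n in sequentially. F (y n) / y n \<le> (F x0 - ?m * x0) / y n + ?m"
    proof (rule always_eventually, rule allI)
      fix n
      have "F (y n) \<le> F x0 - ?m * x0 + ?m * y n"
        using upper[OF y(1)[of n]] by (simp add: algebra_simps)
      then show "F (y n) / y n \<le> (F x0 - ?m * x0) / y n + ?m"
        using pos[of n] by (simp add: divide_simps mult.commute)
    qed
  qed
  moreover have "1 \<le> y n" for n using ge[of n] by simp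
  ultimately show thesis using y(1) top by (intro that) auto
qed

end

section \<open>Position maps\<close>

text \<open>What remains of an ordered core: a function placing each point at a level such that the
  measure of \<open>{p \<le> x}\<close> is \<open>x\<close> itself.\<close>

locale position = sigma_finite_measure M for M :: "'a measure" +
  fixes p :: "'a \<Rightarrow> real" and \<Lambda> :: "real set"
  assumes p_meas[measurable]: "p \<in> borel_measurable M"
    and p_in: "\<And>u. u \<in> space M \<Longrightarrow> p u \<in> \<Lambda>"
    and closed_\<Lambda>: "closed \<Lambda>" and zero_\<Lambda>: "0 \<in> \<Lambda>" and \<Lambda>_nonneg: "\<Lambda> \<subseteq> {0..}"
    and emeasure_p: "\<And>x. x \<in> \<Lambda> \<Longrightarrow> emeasure M {u \<in> space M. p u \<le> x} = ennreal x"
begin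

definition cum :: "('a \<Rightarrow> ennreal) \<Rightarrow> real \<Rightarrow> ennreal" where
  "cum h x = (\<integral>\<^sup>+u. h u * indicator {..x} (p u) \<partial>M)"

text \<open>Up to null sets, these are the absolute values of the functions in the sum of \<open>L\<^sup>1\<close> and the down
  space.\<close>

definition tempered :: "('a \<Rightarrow> ennreal) \<Rightarrow> bool" where
  "tempered h \<longleftrightarrow> h \<in> borel_measurable M \<and>
     (\<exists>K\<ge>0. \<forall>x\<in>\<Lambda>. cum h x \<le> ennreal (K + K * x))"

lemma cum_mono: "(\<And>u. u \<in> space M \<Longrightarrow> h u \<le> h' u) \<Longrightarrow> x \<le> x' \<Longrightarrow> cum h x \<le> cum h' x'"
  unfolding cum_def by (intro nn_integral_mono mult_mono) (auto simp: indicator_def)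

lemma cum_cong_AE: "AE u in M. h u = h' u \<Longrightarrow> cum h x = cum h' x"
  unfolding cum_def by (intro nn_integral_cong_AE) auto

lemma cum_add:
  assumes [measurable]: "h \<in> borel_measurable M" "h' \<in> borel_measurable M"
  shows "cum (\<lambda>u. h u + h' u) x = cum h x + cum h' x"
  unfolding cum_def by (subst nn_integral_add[symmetric]) (auto simp: algebra_simps)

lemma cum_cmult:
  assumes [measurable]: "h \<in> borel_measurable M"
  shows "cum (\<lambda>u. c * h u) x = c * cum h x"
  unfolding cum_def by (subst nn_integral_cmult[symmetric]) (auto simp: algebra_simps)

lemma cum_le_integral: "cum h x \<le> (\<integral>\<^sup>+u. h u \<partial>M)"
  unfolding cum_def by (intro nn_integral_mono) (auto simp: indicator_def)

lemma p_nonneg: "u \<in> space M \<Longrightarrow> 0 \<le> p u"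
  using p_in \<Lambda>_nonneg by force

lemma cum_neg: "x < 0 \<Longrightarrow> cum h x = 0"
  unfolding cum_def using p_nonneg
  by (subst nn_integral_0_iff_AE[where u="\<lambda>u. 0", simplified] nn_integral_cong[where v="\<lambda>u. 0"])
     (force simp: indicator_def)+

text \<open>Only levels in \<open>\<Lambda>\<close> matter: no point has its position between two neighbouring levels.\<close>

lemma floor_level:
  assumes "0 \<le> x"
  obtains x' where "x' \<in> \<Lambda>" "x' \<le> x" "\<And>h. cum h x = cum h x'"
proof -
  have "closed (\<Lambda> \<inter> {..x})" using closed_\<Lambda> by (intro closed_Int) auto
  then have S: "Sup (\<Lambda> \<inter> {..x}) \<in> \<Lambda> \<inter> {..x}"
    using assms zero_\<Lambda> by (intro closed_contains_Sup) auto
  have "p u \<le> x \<longleftrightarrow> p u \<le> Sup (\<Lambda> \<inter> {..x})" if "u \<in> space M" for u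
    using S p_in[OF that] by (auto intro!: cSup_upper)
  then have "cum h x = cum h (Sup (\<Lambda> \<inter> {..x}))" for h
    unfolding cum_def by (intro nn_integral_cong) (auto simp: indicator_def)
  with S show thesis by (intro that) auto
qed

lemma cum_0: assumes [measurable]: "h \<in> borel_measurable M" shows "cum h 0 = 0"
proof -
  have "{u \<in> space M. p u \<le> 0} \<in> null_sets M"
    using emeasure_p[OF zero_\<Lambda>] by (intro null_setsI) auto
  then have "AE u in M. \<not> p u \<le> 0"
    by (rule AE_I') auto
  then show ?thesis
    unfolding cum_def by (subst nn_integral_0_iff_AE) auto
qed

lemma tempered_bound:
  assumes "tempered h"
  obtains K where "0 \<le> K" "\<And>x. 0 \<le> x \<Longrightarrow> cum h x \<le> ennreal (K + K * x)"
proof -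
  obtain K where K: "0 \<le> K" "\<And>x. x \<in> \<Lambda> \<Longrightarrow> cum h x \<le> ennreal (K + K * x)"
    using assms by (auto simp: tempered_def)
  show thesis
  proof
    fix x :: real assume x: "0 \<le> x"
    obtain x' where x': "x' \<in> \<Lambda>" "x' \<le> x" "\<And>h. cum h x = cum h x'"
      using floor_level[OF x] by metis
    have "cum h x \<le> ennreal (K + K * x')" using K x' by simp
    also have "\<dots> \<le> ennreal (K + K * x)"
      using x' K(1) by (intro ennreal_leI add_left_mono mult_left_mono)
    finally show "cum h x \<le> ennreal (K + K * x)" .
  qed (rule K)
qed

lemma tempered_meas: "tempered h \<Longrightarrow> h \<in> borel_measurable M"
  by (simp add: tempered_def)

lemma tempered_finite: assumes "tempered h" shows "cum h x < \<infinity>"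
proof -
  obtain K where "\<And>x. 0 \<le> x \<Longrightarrow> cum h x \<le> ennreal (K + K * x)"
    using tempered_bound[OF assms] by metis
  then show ?thesis
    using cum_neg[of x h] by (cases "x < 0") (force simp: not_less intro: le_less_trans[OF _ ennreal_less_top])+
qed

definition rcum :: "('a \<Rightarrow> ennreal) \<Rightarrow> real \<Rightarrow> real" where
  "rcum h x = enn2real (cum h x)"

lemma ennreal_rcum: "tempered h \<Longrightarrow> ennreal (rcum h x) = cum h x"
  unfolding rcum_def using tempered_finite[of h x] by simp

lemma rcum_nonneg: "0 \<le> rcum h x"
  by (simp add: rcum_def)

lemma mono_rcum: "tempered h \<Longrightarrow> mono (rcum h)"
  unfolding rcum_def using tempered_finite[of h]
  by (intro monoI enn2real_mono cum_mono) auto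

lemma rcum_0: "tempered h \<Longrightarrow> rcum h 0 = 0"
  by (simp add: rcum_def cum_0 tempered_meas)

lemma AE_tempered_finite: assumes "tempered h" shows "AE u in M. h u < \<infinity>"
proof -
  note [measurable] = tempered_meas[OF assms]
  have "AE u in M. h u * indicator {..real n} (p u) \<noteq> \<infinity>" for n
    using tempered_finite[OF assms, of "real n"]
    by (intro nn_integral_PInf_AE) (auto simp: cum_def)
  then have "AE u in M. \<forall>n. h u * indicator {..real n} (p u) \<noteq> \<infinity>"
    by (simp add: AE_all_countable)
  then show ?thesis
  proof eventually_elim
    case (elim u)
    obtain n where "p u \<le> real n" using real_arch_simple by blast
    with elim[rule_format, of n] show ?case by (auto simp: top.not_eq_extremum)
  qed
qed

text \<open>Since \<open>{p \<le> x}\<close> has measure \<open>x\<close>, a level that is a limit of smaller levels carries no atom;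
  dominated convergence then applies to the indicators.\<close>

lemma cont_rcum: assumes h: "tempered h" shows "continuous_on \<Lambda> (rcum h)"
  unfolding continuous_on_sequentially
proof (intro allI ballI impI, elim conjE)
  note [measurable] = tempered_meas[OF h]
  fix y x assume x: "x \<in> \<Lambda>" and y: "\<forall>n. y n \<in> \<Lambda>" and lim: "y \<longlonglongrightarrow> x"
  obtain B where B: "\<And>n. \<bar>y n\<bar> \<le> B"
    using convergent_imp_Bseq[OF convergentI[OF lim]] by (auto simp: Bseq_def)
  have "AE u in M. (\<lambda>n. indicator {..y n} (p u) :: ennreal) \<longlonglongrightarrow> indicator {..x} (p u)"
  proof -
    have pt: "(\<lambda>n. indicator {..y n} (p u) :: ennreal) \<longlonglongrightarrow> indicator {..x} (p u)"
      if *: "p u \<noteq> x \<or> (\<exists>N. \<forall>n\<ge>N. x \<le> y n)" for u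
    proof (rule tendsto_eventually)
      consider "p u < x" | "p u > x" | "p u = x" "\<exists>N. \<forall>n\<ge>N. x \<le> y n" using * less_linear[of "p u" x] by blast
      then show "\<forall>\<^sub>F n in sequentially. indicator {..y n} (p u) = (indicator {..x} (p u) :: ennreal)"
      proof cases
        case 1
        with lim have "\<forall>\<^sub>F n in sequentially. p u < y n" by (rule order_tendstoD)
        then show ?thesis by eventually_elim (use 1 in auto)
      next
        case 2
        with lim have "\<forall>\<^sub>F n in sequentially. y n < p u" by (rule order_tendstoD)
        then show ?thesis by eventually_elim (use 2 in auto)
      next
        case 3
        then have "\<forall>\<^sub>F n in sequentially. x \<le> y n" by (simp add: eventually_sequentially)
        then show ?thesis by eventually_elim (use 3 in auto)
      qed
    qed
    show ?thesis
    proof (cases "\<exists>N. \<forall>n\<ge>N. x \<le> y n")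
      case True
      then show ?thesis using pt by auto
    next
      case False
      have small: "emeasure M {u \<in> space M. p u = x} \<le> ennreal e" if e: "0 < e" for e
      proof -
        have "\<forall>\<^sub>F n in sequentially. x - e < y n"
          using lim e by (intro order_tendstoD(1)[OF lim]) auto
        then obtain N where N: "\<And>n. n \<ge> N \<Longrightarrow> x - e < y n"
          by (auto simp: eventually_sequentially)
        obtain n where n: "n \<ge> N" "y n < x" using False by (auto simp: not_le)
        have yn: "0 \<le> y n" using y \<Lambda>_nonneg by auto
        have "{u \<in> space M. p u = x} \<subseteq> {u \<in> space M. p u \<le> x} - {u \<in> space M. p u \<le> y n}"
          using n by auto
        then have "emeasure M {u \<in> space M. p u = x} \<le>
            emeasure M ({u \<in> space M. p u \<le> x} - {u \<in> space M. p u \<le> y n})"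
          by (intro emeasure_mono) auto
        also have "\<dots> = ennreal x - ennreal (y n)"
          using n y by (subst emeasure_Diff) (auto simp: emeasure_p x)
        also have "\<dots> \<le> ennreal e"
          using N[OF n(1)] n yn by (simp add: ennreal_minus)
        finally show ?thesis .
      qed
      have "emeasure M {u \<in> space M. p u = x} \<le> 0"
      proof (rule ennreal_le_epsilon)
        show "emeasure M {u \<in> space M. p u = x} \<le> 0 + ennreal e" if "0 < e" for e
          using small[OF that] by simp
      qed
      then have "AE u in M. p u \<noteq> x"
        by (intro AE_I[of _ _ "{u \<in> space M. p u = x}"]) auto
      then show ?thesis by eventually_elim (simp add: pt)
    qed
  qed
  then have "AE u in M. (\<lambda>n. h u * indicator {..y n} (p u)) \<longlonglongrightarrow> h u * indicator {..x} (p u)"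
    using AE_tempered_finite[OF h]
    by eventually_elim (auto intro!: ennreal_tendsto_cmult)
  then have "(\<lambda>n. cum h (y n)) \<longlonglongrightarrow> cum h x"
    unfolding cum_def
  proof (rule nn_integral_dominated_convergence[where w="\<lambda>u. h u * indicator {..B} (p u)", rotated 5])
    show "AE u in M. h u * indicator {..y j} (p u) \<le> h u * indicator {..B} (p u)" for j
      using B[of j] by (intro AE_I2 mult_left_mono) (auto simp: indicator_def)
    show "(\<integral>\<^sup>+ u. h u * indicator {..B} (p u) \<partial>M) < \<infinity>"
      using tempered_finite[OF h, of B] by (simp add: cum_def)
  qed auto
  then show "(rcum h \<circ> y) \<longlonglongrightarrow> rcum h x"
    unfolding rcum_def o_def using tempered_finite[OF h, of x] by (intro tendsto_enn2real) auto
qed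

lemma closed_levels_rcum:
  assumes "tempered h" "closed Z" "0 \<in> Z" "Z \<subseteq> \<Lambda>"
  shows "closed_levels Z (rcum h)"
  by unfold_locales
    (use assms \<Lambda>_nonneg mono_rcum rcum_0 continuous_on_subset[OF cont_rcum] in auto)

end

section \<open>Pushing densities to the line of mass levels\<close>

abbreviation unif :: "real measure" where
  "unif \<equiv> uniform_measure lborel {0..1}"

lemma sets_unif[measurable_cong, simp]: "sets unif = sets borel"
  by simp

lemma sigma_finite_unif: "sigma_finite_measure unif"
proof -
  interpret finite_measure unif
    by (rule finite_measureI) (simp add: emeasure_uniform_measure)
  show ?thesis by unfold_locales
qed

interpretation unif: sigma_finite_measure unif
  by (rule sigma_finite_unif)

lemma emeasure_unif_UNIV: "emeasure unif UNIV = 1"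
  by (simp add: emeasure_uniform_measure)

lemma emeasure_unif_atMost: "0 \<le> t \<Longrightarrow> t \<le> 1 \<Longrightarrow> emeasure unif {..t} = ennreal t"
proof -
  assume t: "0 \<le> t" "t \<le> 1"
  then have "{0..1} \<inter> {..t} = {0..t}" by auto
  then show ?thesis using t by (simp add: emeasure_uniform_measure divide_ennreal_def)
qed

lemma AE_unif: "AE \<theta> in unif. 0 \<le> \<theta> \<and> \<theta> \<le> 1"
  by (rule AE_uniform_measureI) auto

lemma (in closed_levels) measurable_mass_level[measurable]:
  assumes [measurable]: "f \<in> borel_measurable N" "t \<in> borel_measurable N"
  shows "(\<lambda>x. mass_level F Z (f x) (t x)) \<in> borel_measurable N"
proof -
  have "mono (\<lambda>y. F (left_neighbour Z y))" "mono (\<lambda>y. F (right_neighbour Z y))"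
    using mono_F mono_left_neighbour mono_right_neighbour by (auto simp: mono_def)
  then have [measurable]: "(\<lambda>y. F (left_neighbour Z y)) \<in> borel_measurable borel"
      "(\<lambda>y. F (right_neighbour Z y)) \<in> borel_measurable borel"
    by (auto intro: borel_measurable_mono)
  show ?thesis
    unfolding mass_level_def by measurable
qed

lemma (in closed_levels) covered_borel[measurable]: "{y. \<exists>z\<in>Z. y \<le> z} \<in> sets borel"
proof -
  obtain z :: "nat \<Rightarrow> real" where z: "\<And>n. z n \<in> Z" "\<And>y. y \<in> Z \<Longrightarrow> \<exists>n. y \<le> z n"
    using cofinal_sequence by metis
  have "{y. \<exists>z\<in>Z. y \<le> z} = (\<Union>n. {..z n})"
  proof safe
    fix y z' assume "z' \<in> Z" "y \<le> z'"
    then obtain n where "y \<le> z n" using z(2) by (meson order_trans)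
    then show "y \<in> (\<Union>n. {..z n})" by blast
  qed (use z(1) in auto)
  then show ?thesis by simp
qed

context position
begin

text \<open>The image of \<open>h \<mu>\<close>, restricted to points not beyond the set \<open>Z\<close>, under the randomised mass level;
  uniform randomisation over \<open>\<theta>\<close> is realised by a product with the unit interval.\<close>

definition push :: "real set \<Rightarrow> (real \<Rightarrow> real) \<Rightarrow> ('a \<Rightarrow> ennreal) \<Rightarrow> real measure" where
  "push Z F h =
     distr (density (M \<Otimes>\<^sub>M unif) (\<lambda>(u, \<theta>). h u * indicator {y. \<exists>z\<in>Z. y \<le> z} (p u))) borel
       (\<lambda>(u, \<theta>). mass_level F Z (p u) \<theta>)"

lemma sets_push[simp, measurable_cong]: "sets (push Z F h) = sets borel"
  by (simp add: push_def)

lemma space_push[simp]: "space (push Z F h) = UNIV"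
  by (simp add: push_def)

lemma nn_integral_push:
  assumes "closed_levels Z F" and [measurable]: "h \<in> borel_measurable M" "\<psi> \<in> borel_measurable borel"
  shows "(\<integral>\<^sup>+s. \<psi> s \<partial>push Z F h) =
    (\<integral>\<^sup>+u. h u * indicator {y. \<exists>z\<in>Z. y \<le> z} (p u) * (\<integral>\<^sup>+\<theta>. \<psi> (mass_level F Z (p u) \<theta>) \<partial>unif) \<partial>M)"
proof -
  interpret closed_levels Z F by fact
  have "(\<integral>\<^sup>+s. \<psi> s \<partial>push Z F h) = (\<integral>\<^sup>+u\<theta>. (\<lambda>(u, \<theta>). h u * indicator {y. \<exists>z\<in>Z. y \<le> z} (p u) *
      \<psi> (mass_level F Z (p u) \<theta>)) u\<theta> \<partial>(M \<Otimes>\<^sub>M unif))"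
    unfolding push_def
    by (subst nn_integral_distr, measurable)
      (subst nn_integral_density, auto simp: case_prod_beta' intro!: nn_integral_cong)
  also have "\<dots> = (\<integral>\<^sup>+u. (\<integral>\<^sup>+\<theta>. h u * indicator {y. \<exists>z\<in>Z. y \<le> z} (p u) *
      \<psi> (mass_level F Z (p u) \<theta>) \<partial>unif) \<partial>M)"
    by (subst unif.nn_integral_fst[symmetric]) auto
  also have "\<dots> = (\<integral>\<^sup>+u. h u * indicator {y. \<exists>z\<in>Z. y \<le> z} (p u) *
      (\<integral>\<^sup>+\<theta>. \<psi> (mass_level F Z (p u) \<theta>) \<partial>unif) \<partial>M)"
    by (intro nn_integral_cong nn_integral_cmult) measurable
  finally show ?thesis .
qed

text \<open>The pushed mass of an arbitrary \<open>h\<close> up to level \<open>s\<close> interpolates between its cumulative masses at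
  two neighbouring members of \<open>Z\<close>, with positions and weights that do not depend on \<open>h\<close>. This is
  what makes the cumulative masses of different functions comparable.\<close>

lemma emeasure_push_atMost:
  assumes cl: "closed_levels Z F" and s: "0 \<le> s" "z0 \<in> Z" "s < F z0"
  obtains a b \<theta>\<^sub>0 where "a \<in> Z" "b \<in> Z" "a \<le> b" "0 \<le> \<theta>\<^sub>0" "\<theta>\<^sub>0 \<le> 1"
    "s = (1 - \<theta>\<^sub>0) * F a + \<theta>\<^sub>0 * F b"
    "a = b \<and> F a = s \<or> a < b \<and> F a \<le> s \<and> s < F b \<and> (\<forall>z\<in>Z. z \<le> a \<or> b \<le> z)"
    "\<forall>h\<in>borel_measurable M.
       emeasure (push Z F h) {..s} = ennreal (1 - \<theta>\<^sub>0) * cum h a + ennreal \<theta>\<^sub>0 * cum h b"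
proof -
  interpret closed_levels Z F by fact
  obtain a b \<theta>\<^sub>0 where ab: "a \<in> Z" "b \<in> Z" "a \<le> b" and \<theta>\<^sub>0: "0 \<le> \<theta>\<^sub>0" "\<theta>\<^sub>0 \<le> 1"
    and eq: "s = (1 - \<theta>\<^sub>0) * F a + \<theta>\<^sub>0 * F b"
    and lev: "\<forall>y\<ge>0. \<forall>\<theta>\<in>{0..1}. (\<exists>z\<in>Z. y \<le> z) \<longrightarrow>
       (mass_level F Z y \<theta> \<le> s \<longleftrightarrow> y \<le> a \<or> y \<le> b \<and> \<theta> \<le> \<theta>\<^sub>0)"
    and gap: "a = b \<and> F a = s \<or> a < b \<and> F a \<le> s \<and> s < F b \<and> (\<forall>z\<in>Z. z \<le> a \<or> b \<le> z)"
    by (rule mass_level_le_iff[OF s]) (rule that)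
  have "emeasure (push Z F h) {..s} = ennreal (1 - \<theta>\<^sub>0) * cum h a + ennreal \<theta>\<^sub>0 * cum h b"
    if [measurable]: "h \<in> borel_measurable M" for h
  proof -
    have "emeasure (push Z F h) {..s} = (\<integral>\<^sup>+s'. indicator {..s} s' \<partial>push Z F h)"
      by simp
    also have "\<dots> = (\<integral>\<^sup>+u. h u * indicator {y. \<exists>z\<in>Z. y \<le> z} (p u) *
        (\<integral>\<^sup>+\<theta>. indicator {..s} (mass_level F Z (p u) \<theta>) \<partial>unif) \<partial>M)"
      by (rule nn_integral_push[OF cl]) auto
    also have "\<dots> = (\<integral>\<^sup>+u. ennreal (1 - \<theta>\<^sub>0) * (h u * indicator {..a} (p u)) +
        ennreal \<theta>\<^sub>0 * (h u * indicator {..b} (p u)) \<partial>M)"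
    proof (rule nn_integral_cong)
      fix u assume u: "u \<in> space M"
      let ?I = "\<integral>\<^sup>+\<theta>. indicator {..s} (mass_level F Z (p u) \<theta>) \<partial>unif"
      have I: "?I = (\<integral>\<^sup>+\<theta>. indicator (if p u \<le> a then UNIV else if p u \<le> b then {..\<theta>\<^sub>0} else {}) \<theta> \<partial>unif)"
        if "\<exists>z\<in>Z. p u \<le> z"
      proof (rule nn_integral_cong_AE)
        show "AE \<theta> in unif. indicator {..s} (mass_level F Z (p u) \<theta>) =
            (indicator (if p u \<le> a then UNIV else if p u \<le> b then {..\<theta>\<^sub>0} else {}) \<theta> :: ennreal)"
          using AE_unif
        proof eventually_elim
          case (elim \<theta>)
          then have "mass_level F Z (p u) \<theta> \<le> s \<longleftrightarrow> p u \<le> a \<or> p u \<le> b \<and> \<theta> \<le> \<theta>\<^sub>0"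
            using lev p_nonneg[OF u] that by auto
          then show ?case by (simp add: indicator_def)
        qed
      qed
      show "h u * indicator {y. \<exists>z\<in>Z. y \<le> z} (p u) * ?I =
          ennreal (1 - \<theta>\<^sub>0) * (h u * indicator {..a} (p u)) + ennreal \<theta>\<^sub>0 * (h u * indicator {..b} (p u))"
      proof (cases "p u \<le> b")
        case True
        with ab have cov: "\<exists>z\<in>Z. p u \<le> z" by auto
        show ?thesis
        proof (cases "p u \<le> a")
          case True
          then have "?I = 1"
            using I[OF cov] by (simp add: emeasure_unif_UNIV)
          moreover have "ennreal (1 - \<theta>\<^sub>0) * h u + ennreal \<theta>\<^sub>0 * h u = h u"
            using \<theta>\<^sub>0 by (simp flip: distrib_right ennreal_plus)
          ultimately show ?thesis
            using cov True \<open>p u \<le> b\<close> by simp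
        next
          case False
          then have "?I = ennreal \<theta>\<^sub>0"
            using I[OF cov] True \<theta>\<^sub>0 by (simp add: emeasure_unif_atMost divide_ennreal_def)
          then show ?thesis
            using cov True False by (simp add: mult.commute)
        qed
      next
        case False
        then have "?I = 0" if "\<exists>z\<in>Z. p u \<le> z"
          using I[OF that] ab by simp
        then show ?thesis using False ab by (auto simp: indicator_def)
      qed
    qed
    also have "\<dots> = ennreal (1 - \<theta>\<^sub>0) * cum h a + ennreal \<theta>\<^sub>0 * cum h b"
      unfolding cum_def by (subst nn_integral_add) (auto simp: nn_integral_cmult)
    finally show ?thesis .
  qed
  then show thesis using ab \<theta>\<^sub>0 eq gap by (intro that) auto
qed

lemma emeasure_push_neg:
  assumes cl: "closed_levels Z F" and [measurable]: "h \<in> borel_measurable M" and s: "s < 0"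
  shows "emeasure (push Z F h) {..s} = 0"
proof -
  interpret closed_levels Z F by fact
  have "emeasure (push Z F h) {..s} = (\<integral>\<^sup>+s'. indicator {..s} s' \<partial>push Z F h)"
    by simp
  also have "\<dots> = (\<integral>\<^sup>+u. h u * indicator {y. \<exists>z\<in>Z. y \<le> z} (p u) *
      (\<integral>\<^sup>+\<theta>. indicator {..s} (mass_level F Z (p u) \<theta>) \<partial>unif) \<partial>M)"
    by (rule nn_integral_push[OF cl]) auto
  also have "\<dots> = (\<integral>\<^sup>+u. 0 \<partial>M)"
  proof (rule nn_integral_cong)
    fix u assume u: "u \<in> space M"
    have "(\<integral>\<^sup>+\<theta>. indicator {..s} (mass_level F Z (p u) \<theta>) \<partial>unif) = (\<integral>\<^sup>+\<theta>. 0 \<partial>unif)"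
      if z: "z \<in> Z" "p u \<le> z" for z
    proof (rule nn_integral_cong_AE)
      show "AE \<theta> in unif. indicator {..s} (mass_level F Z (p u) \<theta>) = (0::ennreal)"
        using AE_unif
      proof eventually_elim
        case (elim \<theta>)
        have "0 \<le> mass_level F Z (p u) \<theta>"
          using elim z by (intro le_mass_level[of _ z] p_nonneg u F_nonneg left_neighbour_nonneg) auto
        then show ?case using s by auto
      qed
    qed
    then show "h u * indicator {y. \<exists>z\<in>Z. y \<le> z} (p u) *
        (\<integral>\<^sup>+\<theta>. indicator {..s} (mass_level F Z (p u) \<theta>) \<partial>unif) = 0"
      by (auto simp: indicator_def)
  qed
  finally show ?thesis by simp
qed

lemma emeasure_push_UNIV:
  assumes cl: "closed_levels Z F" and [measurable]: "h \<in> borel_measurable M"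
  shows "emeasure (push Z F h) UNIV = (\<integral>\<^sup>+u. h u * indicator {y. \<exists>z\<in>Z. y \<le> z} (p u) \<partial>M)"
  using nn_integral_push[OF cl, of h "\<lambda>_. 1"] by (simp add: emeasure_unif_UNIV)

lemma emeasure_push_UNIV_SUP:
  assumes cl: "closed_levels Z F" and [measurable]: "h \<in> borel_measurable M"
    and z: "incseq z" "\<And>n. z n \<in> Z" "\<And>y. y \<in> Z \<Longrightarrow> \<exists>n. y \<le> z n"
  shows "emeasure (push Z F h) UNIV = (SUP n. cum h (z n))"
proof -
  have "(\<integral>\<^sup>+u. h u * indicator {y. \<exists>z\<in>Z. y \<le> z} (p u) \<partial>M) =
      (\<integral>\<^sup>+u. (SUP n. h u * indicator {..z n} (p u)) \<partial>M)"
  proof (rule nn_integral_cong)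
    fix u
    have *: "(\<exists>y\<in>Z. p u \<le> y) \<longleftrightarrow> (\<exists>n. p u \<le> z n)"
      using z(2,3) by (meson order_trans)
    show "h u * indicator {y. \<exists>z\<in>Z. y \<le> z} (p u) = (SUP n. h u * indicator {..z n} (p u))"
    proof (cases "\<exists>n. p u \<le> z n")
      case True
      then obtain n where "p u \<le> z n" by auto
      then have "h u \<le> (SUP n. h u * indicator {..z n} (p u))"
        by (intro SUP_upper2[of n]) auto
      moreover have "(SUP n. h u * indicator {..z n} (p u)) \<le> h u"
        by (intro SUP_least) (auto simp: indicator_def)
      ultimately show ?thesis using True * by (auto intro: antisym)
    next
      case False
      then show ?thesis using * by (simp add: indicator_def)
    qed
  qed
  also have "\<dots> = (SUP n. cum h (z n))"
    unfolding cum_def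
  proof (rule nn_integral_monotone_convergence_SUP)
    show "incseq (\<lambda>n u. h u * indicator {..z n} (p u))"
      using z(1) by (intro incseq_SucI le_funI mult_left_mono)
        (auto simp: indicator_def incseq_Suc_iff elim: order_trans)
  qed measurable
  finally show ?thesis using emeasure_push_UNIV[OF cl, of h] by simp
qed

text \<open>Placing the mass of \<open>h\<close> at its own mass levels yields Lebesgue measure on the levels reached: for the density \<open>h\<close> itself
  the interpolation just described returns \<open>s\<close>. Both measures agree on half-lines and therefore
  everywhere.\<close>

theorem push_own_density:
  assumes h: "tempered h" and Z: "closed Z" "0 \<in> Z" "Z \<subseteq> \<Lambda>"
  shows "push Z (rcum h) h = density lborel (indicator {s. 0 \<le> s \<and> (\<exists>z\<in>Z. s < rcum h z)})"
    (is "?P = density lborel (indicator ?B)")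
proof -
  note [measurable] = tempered_meas[OF h]
  have cl: "closed_levels Z (rcum h)" by (rule closed_levels_rcum[OF h Z])
  interpret closed_levels Z "rcum h" by fact
  obtain z where z: "incseq z" "\<And>n. z n \<in> Z" "\<And>y. y \<in> Z \<Longrightarrow> \<exists>n. y \<le> z n"
    using cofinal_sequence by metis
  have B: "?B = (\<Union>n. {0..<rcum h (z n)})"
  proof safe
    fix s z' assume s: "0 \<le> s" "z' \<in> Z" "s < rcum h z'"
    obtain n where "z' \<le> z n" using z(3)[OF s(2)] by blast
    then have "rcum h z' \<le> rcum h (z n)" by (rule monoD[OF mono_F])
    with s have "s \<in> {0..<rcum h (z n)}" by simp
    then show "s \<in> (\<Union>n. {0..<rcum h (z n)})" by blast
  qed (use z(2) in auto)
  then have [measurable]: "?B \<in> sets borel" by simp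
  have "emeasure lborel ?B = (SUP n. emeasure lborel {0..<rcum h (z n)})"
    unfolding B using z(1) mono_F
    by (intro SUP_emeasure_incseq[symmetric])
      (auto simp: incseq_Suc_iff mono_def intro!: less_le_trans[OF _ monoD[OF mono_F]])
  then have B_total: "emeasure lborel ?B = emeasure ?P UNIV"
    using emeasure_push_UNIV_SUP[OF cl _ z, of h] by (simp add: rcum_nonneg ennreal_rcum[OF h])
  have eq: "emeasure ?P {..s} = emeasure lborel (?B \<inter> {..s})" for s
  proof -
    consider "s < 0" | z' where "0 \<le> s" "z' \<in> Z" "s < rcum h z'" | "\<And>z. z \<in> Z \<Longrightarrow> rcum h z \<le> s"
      by (meson not_le)
    then show ?thesis
    proof cases
      case 1
      then have "?B \<inter> {..s} = {}" by auto
      then show ?thesis using emeasure_push_neg[OF cl _ 1, of h] by simp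
    next
      case 2
      obtain a b \<theta>\<^sub>0 where ab: "0 \<le> \<theta>\<^sub>0" "\<theta>\<^sub>0 \<le> 1" "s = (1 - \<theta>\<^sub>0) * rcum h a + \<theta>\<^sub>0 * rcum h b"
        "emeasure ?P {..s} = ennreal (1 - \<theta>\<^sub>0) * cum h a + ennreal \<theta>\<^sub>0 * cum h b"
        by (rule emeasure_push_atMost[OF cl 2])
            (rule that, assumption, assumption, assumption, erule bspec, rule tempered_meas[OF h])
      have "emeasure ?P {..s} = ennreal s"
        using ab(1,2) rcum_nonneg[of h] unfolding ab(4) ennreal_rcum[OF h, symmetric]
        by (subst ab(3)) (simp add: ennreal_plus ennreal_mult)
      moreover have "?B \<inter> {..s} = {0..s}"
        using le_less_trans[OF _ 2(3)] by (auto intro!: bexI[OF _ 2(2)])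
      ultimately show ?thesis using 2 by simp
    next
      case 3
      have "emeasure ?P {..s} = (\<integral>\<^sup>+s'. indicator {..s} s' \<partial>?P)"
        by simp
      also have "\<dots> = (\<integral>\<^sup>+u. h u * indicator {y. \<exists>z\<in>Z. y \<le> z} (p u) *
          (\<integral>\<^sup>+\<theta>. indicator {..s} (mass_level (rcum h) Z (p u) \<theta>) \<partial>unif) \<partial>M)"
        by (rule nn_integral_push[OF cl]) auto
      also have "\<dots> = (\<integral>\<^sup>+u. h u * indicator {y. \<exists>z\<in>Z. y \<le> z} (p u) \<partial>M)"
      proof (rule nn_integral_cong)
        fix u assume u: "u \<in> space M"
        have "(\<integral>\<^sup>+\<theta>. indicator {..s} (mass_level (rcum h) Z (p u) \<theta>) \<partial>unif) = (\<integral>\<^sup>+\<theta>. 1 \<partial>unif)"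
          if z: "z \<in> Z" "p u \<le> z" for z
        proof (rule nn_integral_cong_AE)
          show "AE \<theta> in unif. indicator {..s} (mass_level (rcum h) Z (p u) \<theta>) = (1::ennreal)"
            using AE_unif
          proof eventually_elim
            case (elim \<theta>)
            have "mass_level (rcum h) Z (p u) \<theta> \<le> rcum h z"
              using elim z p_nonneg[OF u] by (intro mass_level_le) auto
            then show ?case using 3[OF z(1)] by auto
          qed
        qed
        then show "h u * indicator {y. \<exists>z\<in>Z. y \<le> z} (p u) *
            (\<integral>\<^sup>+\<theta>. indicator {..s} (mass_level (rcum h) Z (p u) \<theta>) \<partial>unif) =
            h u * indicator {y. \<exists>z\<in>Z. y \<le> z} (p u)"
          by (auto simp: indicator_def emeasure_unif_UNIV)
      qed
      also have "\<dots> = emeasure lborel ?B"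
        unfolding B_total by (rule emeasure_push_UNIV[OF cl, symmetric]) simp
      also have "?B = ?B \<inter> {..s}" using less_le_trans[OF _ 3] by (auto intro: less_imp_le)
      finally show ?thesis .
    qed
  qed
  show ?thesis
  proof (rule measure_eqI_generator_eq[where E="range (\<lambda>a. {..a})" and \<Omega>=UNIV and A="\<lambda>n. {..real n}"])
    show "Int_stable (range (\<lambda>a::real. {..a}))"
      by (auto simp: Int_stable_def)
    have "sets borel = sigma_sets UNIV (range (\<lambda>a::real. {..a}))"
      by (subst borel_eq_atMost) simp
    then show "sets ?P = sigma_sets UNIV (range atMost)"
      "sets (density lborel (indicator ?B)) = sigma_sets UNIV (range atMost)"
      by simp_all
    show "emeasure ?P X = emeasure (density lborel (indicator ?B)) X" if "X \<in> range atMost" for X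
      using that eq by (auto simp: emeasure_density simp flip: indicator_inter_arith)
    show "(\<Union>i. {..real i}) = UNIV"
      using real_arch_simple by auto
    show "emeasure ?P {..real n} \<noteq> \<infinity>" for n
    proof -
      have "emeasure ?P {..real n} \<le> emeasure lborel {0..real n}"
        unfolding eq by (intro emeasure_mono) auto
      then show ?thesis by (auto simp: top_unique)
    qed
  qed auto
qed

end

section \<open>Pulling back from the line of mass levels\<close>

lemma borel_below: "{s :: real. 0 \<le> s \<and> (\<exists>z\<in>Z. s < F z)} \<in> sets borel"
proof -
  have "open (\<Union>z\<in>Z. {..<F z})" by auto
  then have "{0..} \<inter> (\<Union>z\<in>Z. {..<F z}) \<in> sets borel" by (intro sets.Int) auto
  also have "{0..} \<inter> (\<Union>z\<in>Z. {..<F z}) = {s. 0 \<le> s \<and> (\<exists>z\<in>Z. s < F z)}" by auto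
  finally show ?thesis .
qed

context position
begin

lemma closed_levels_\<Lambda>: "tempered f \<Longrightarrow> closed_levels \<Lambda> (rcum f)"
  by (intro closed_levels_rcum closed_\<Lambda> zero_\<Lambda>) auto

text \<open>A density \<open>r\<close> on the line of mass levels is turned into the function whose mass is distributed like
  \<open>r\<close> along the mass levels of \<open>f\<close>; it is dual to \<open>push\<close>.\<close>

definition pull :: "('a \<Rightarrow> ennreal) \<Rightarrow> (real \<Rightarrow> ennreal) \<Rightarrow> 'a \<Rightarrow> ennreal" where
  "pull f r u = f u * (\<integral>\<^sup>+\<theta>. r (mass_level (rcum f) \<Lambda> (p u) \<theta>) \<partial>unif)"

lemma measurable_level:
  assumes "tempered f"
  shows "(\<lambda>(u, \<theta>). mass_level (rcum f) \<Lambda> (p u) \<theta>) \<in> borel_measurable (M \<Otimes>\<^sub>M unif)"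
proof -
  interpret closed_levels \<Lambda> "rcum f" using assms by (rule closed_levels_\<Lambda>)
  show ?thesis by measurable
qed

lemma measurable_pull[measurable]:
  assumes f: "tempered f" and [measurable]: "r \<in> borel_measurable borel"
  shows "pull f r \<in> borel_measurable M"
proof -
  note [measurable] = tempered_meas[OF f] measurable_level[OF f]
  show ?thesis
    unfolding pull_def[abs_def] by measurable
qed

lemma pull_one: "pull f (\<lambda>_. 1) u = f u"
  by (simp add: pull_def emeasure_unif_UNIV)

lemma pull_add:
  assumes f: "tempered f" and u: "u \<in> space M"
    and [measurable]: "r \<in> borel_measurable borel" "r' \<in> borel_measurable borel"
  shows "pull f (\<lambda>s. r s + r' s) u = pull f r u + pull f r' u"
proof -
  interpret closed_levels \<Lambda> "rcum f" using f by (rule closed_levels_\<Lambda>)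
  show ?thesis
    unfolding pull_def by (subst nn_integral_add) (auto simp: distrib_left)
qed

lemma pull_cmult:
  assumes f: "tempered f" and u: "u \<in> space M" and [measurable]: "r \<in> borel_measurable borel"
  shows "pull f (\<lambda>s. c * r s) u = c * pull f r u"
proof -
  interpret closed_levels \<Lambda> "rcum f" using f by (rule closed_levels_\<Lambda>)
  show ?thesis
    unfolding pull_def by (subst nn_integral_cmult) (auto simp: mult_ac)
qed

lemma integral_pull:
  assumes f: "tempered f" and [measurable]: "r \<in> borel_measurable borel"
  shows "(\<integral>\<^sup>+u. pull f r u \<partial>M) =
    (\<integral>\<^sup>+s. r s * indicator {s. 0 \<le> s \<and> (\<exists>z\<in>\<Lambda>. s < rcum f z)} s \<partial>lborel)"
proof -
  note [measurable] = tempered_meas[OF f]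
  let ?B = "{s. 0 \<le> s \<and> (\<exists>z\<in>\<Lambda>. s < rcum f z)}"
  have own: "push \<Lambda> (rcum f) f = density lborel (indicator ?B)"
    by (intro push_own_density f closed_\<Lambda> zero_\<Lambda>) auto
  have B[measurable]: "?B \<in> sets borel" by (rule borel_below)
  have "(\<integral>\<^sup>+u. pull f r u \<partial>M) = (\<integral>\<^sup>+s. r s \<partial>push \<Lambda> (rcum f) f)"
    unfolding nn_integral_push[OF closed_levels_\<Lambda>[OF f] tempered_meas[OF f] assms(2)] pull_def
    by (intro nn_integral_cong) (use p_in in \<open>auto simp: indicator_def\<close>)
  also have "\<dots> = (\<integral>\<^sup>+s. r s * indicator ?B s \<partial>lborel)"
    unfolding own by (subst nn_integral_density) (auto simp: mult.commute)
  finally show ?thesis .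
qed

lemma integral_pull_le:
  assumes f: "tempered f" and [measurable]: "r \<in> borel_measurable borel"
  shows "(\<integral>\<^sup>+u. pull f r u \<partial>M) \<le> (\<integral>\<^sup>+s. r s * indicator {0..} s \<partial>lborel)"
  unfolding integral_pull[OF assms] by (intro nn_integral_mono) (auto simp: indicator_def)

text \<open>Points at positions up to \<open>x\<close> have mass levels at most \<open>F\<^sub>f(x)\<close>.\<close>

lemma cum_pull_le:
  assumes f: "tempered f" and r[measurable]: "r \<in> borel_measurable borel" and x: "x \<in> \<Lambda>"
  shows "cum (pull f r) x \<le> (\<integral>\<^sup>+s. r s * indicator {0..rcum f x} s \<partial>lborel)"
proof -
  interpret closed_levels \<Lambda> "rcum f" using f by (rule closed_levels_\<Lambda>)
  let ?r = "\<lambda>s. r s * indicator {..rcum f x} s"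
  have "cum (pull f r) x \<le> (\<integral>\<^sup>+u. pull f ?r u \<partial>M)"
    unfolding cum_def
  proof (rule nn_integral_mono)
    fix u assume u: "u \<in> space M"
    show "pull f r u * indicator {..x} (p u) \<le> pull f ?r u"
    proof (cases "p u \<le> x")
      case True
      have "pull f r u = pull f ?r u"
        unfolding pull_def
      proof (intro arg_cong[where f="(*) (f u)"] nn_integral_cong_AE)
        show "AE \<theta> in unif. r (mass_level (rcum f) \<Lambda> (p u) \<theta>) = r (mass_level (rcum f) \<Lambda> (p u) \<theta>) *
            indicator {..rcum f x} (mass_level (rcum f) \<Lambda> (p u) \<theta>)"
          using AE_unif
        proof eventually_elim
          case (elim \<theta>)
          then show ?case
            using mass_level_le[OF p_nonneg[OF u] x True] by simp
        qed
      qed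
      then show ?thesis using True by simp
    qed simp
  qed
  also have "\<dots> \<le> (\<integral>\<^sup>+s. ?r s * indicator {0..} s \<partial>lborel)"
    by (intro integral_pull_le f) measurable
  also have "\<dots> = (\<integral>\<^sup>+s. r s * indicator {0..rcum f x} s \<partial>lborel)"
    by (intro nn_integral_cong) (auto simp: indicator_def)
  finally show ?thesis .
qed

lemma pull_cong_AE:
  assumes f: "tempered f" and [measurable]: "r \<in> borel_measurable borel" "r' \<in> borel_measurable borel"
    and eq: "AE s in lborel. 0 \<le> s \<and> (\<exists>z\<in>\<Lambda>. s < rcum f z) \<longrightarrow> r s = r' s"
  shows "AE u in M. pull f r u = pull f r' u"
proof -
  note [measurable] = tempered_meas[OF f]
  interpret closed_levels \<Lambda> "rcum f" using f by (rule closed_levels_\<Lambda>)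
  let ?N = "{s. r s \<noteq> r' s}"
  have N[measurable]: "?N \<in> sets borel" by measurable
  have "(\<integral>\<^sup>+s. indicator ?N s * indicator {s. 0 \<le> s \<and> (\<exists>z\<in>\<Lambda>. s < rcum f z)} s \<partial>lborel) =
      (\<integral>\<^sup>+(s::real). 0 \<partial>lborel)"
  proof (rule nn_integral_cong_AE)
    show "AE s in lborel. indicator ?N s * indicator {s. 0 \<le> s \<and> (\<exists>z\<in>\<Lambda>. s < rcum f z)} s = (0::ennreal)"
      using eq by eventually_elim (auto simp: indicator_def)
  qed
  then have "(\<integral>\<^sup>+u. pull f (indicator ?N) u \<partial>M) = 0"
    by (simp add: integral_pull[OF f])
  moreover have "pull f (indicator ?N) \<in> borel_measurable M"
    by (rule measurable_pull[OF f]) measurable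
  ultimately have "AE u in M. pull f (indicator ?N) u = 0"
    by (subst (asm) nn_integral_0_iff_AE) auto
  then show ?thesis
  proof (rule AE_mp, intro AE_I2 impI)
    fix u assume u: "u \<in> space M" and z: "pull f (indicator ?N) u = 0"
    show "pull f r u = pull f r' u"
    proof (cases "f u = 0")
      case False
      then have "(\<integral>\<^sup>+\<theta>. indicator ?N (mass_level (rcum f) \<Lambda> (p u) \<theta>) \<partial>unif) = 0"
        using z by (simp add: pull_def)
      then have "AE \<theta> in unif. indicator ?N (mass_level (rcum f) \<Lambda> (p u) \<theta>) = (0::ennreal)"
        by (subst (asm) nn_integral_0_iff_AE) auto
      then have "(\<integral>\<^sup>+\<theta>. r (mass_level (rcum f) \<Lambda> (p u) \<theta>) \<partial>unif) =
          (\<integral>\<^sup>+\<theta>. r' (mass_level (rcum f) \<Lambda> (p u) \<theta>) \<partial>unif)"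
        by (intro nn_integral_cong_AE, eventually_elim) (auto simp: indicator_def split: if_splits)
      then show ?thesis by (simp add: pull_def)
    qed (simp add: pull_def)
  qed
qed

text \<open>Assigning to the first part the mass of \<open>g\<close> at levels up to \<open>b\<close> leaves a second part whose
  cumulative mass is at most \<open>max 0 (F\<^sub>g - b)\<close>, which a majorant \<open>b + c x\<close> of \<open>F\<^sub>g\<close> turns into \<open>c x\<close>.\<close>

lemma truncation:
  assumes g: "tempered g" and b: "0 \<le> b" and maj: "\<And>x. x \<in> \<Lambda> \<Longrightarrow> rcum g x \<le> b + c * x"
  obtains \<kappa> :: "'a \<Rightarrow> ennreal" where "\<kappa> \<in> borel_measurable M" "\<And>u. u \<in> space M \<Longrightarrow> \<kappa> u \<le> 1"
    "(\<integral>\<^sup>+u. g u * \<kappa> u \<partial>M) \<le> ennreal b"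
    "\<And>x. x \<in> \<Lambda> \<Longrightarrow> cum (\<lambda>u. g u * (1 - \<kappa> u)) x \<le> ennreal (c * x)"
proof -
  interpret closed_levels \<Lambda> "rcum g" using g by (rule closed_levels_\<Lambda>)
  define \<kappa> where "\<kappa> u = (\<integral>\<^sup>+\<theta>. indicator {..b} (mass_level (rcum g) \<Lambda> (p u) \<theta>) \<partial>unif)" for u
  note [measurable] = measurable_level[OF g]
  have pull0: "g u * \<kappa> u = pull g (indicator {..b}) u" for u
    by (simp add: pull_def \<kappa>_def)
  have compl: "(\<integral>\<^sup>+\<theta>. indicator {b<..} (mass_level (rcum g) \<Lambda> (p u) \<theta>) \<partial>unif) = 1 - \<kappa> u"
    and le1: "\<kappa> u \<le> 1" if u: "u \<in> space M" for u
  proof -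
    have "\<kappa> u + (\<integral>\<^sup>+\<theta>. indicator {b<..} (mass_level (rcum g) \<Lambda> (p u) \<theta>) \<partial>unif) =
        (\<integral>\<^sup>+\<theta>. 1 \<partial>unif)"
      unfolding \<kappa>_def by (subst nn_integral_add[symmetric])
        (auto intro!: nn_integral_cong simp: indicator_def simp del: nn_integral_const)
    then have eq: "\<kappa> u + (\<integral>\<^sup>+\<theta>. indicator {b<..} (mass_level (rcum g) \<Lambda> (p u) \<theta>) \<partial>unif) = 1"
      by (simp add: emeasure_unif_UNIV)
    show \<kappa>1: "\<kappa> u \<le> 1" using eq by (metis le_iff_add)
    show "(\<integral>\<^sup>+\<theta>. indicator {b<..} (mass_level (rcum g) \<Lambda> (p u) \<theta>) \<partial>unif) = 1 - \<kappa> u"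
      unfolding eq[symmetric] by (intro ennreal_add_diff_cancel_left[symmetric]) (use \<kappa>1 in \<open>auto simp: top_unique\<close>)
  qed
  show thesis
  proof
    show "\<kappa> \<in> borel_measurable M"
      unfolding \<kappa>_def by measurable
    show "\<kappa> u \<le> 1" if "u \<in> space M" for u using le1[OF that] .
    have "(\<integral>\<^sup>+u. g u * \<kappa> u \<partial>M) \<le> (\<integral>\<^sup>+s. indicator {..b} s * indicator {0..} s \<partial>lborel)"
      unfolding pull0 by (intro integral_pull_le g) measurable
    also have "\<dots> = (\<integral>\<^sup>+s. indicator {0..b} s \<partial>lborel)"
      by (intro nn_integral_cong) (auto simp: indicator_def)
    also have "\<dots> = ennreal b" using b by simp
    finally show "(\<integral>\<^sup>+u. g u * \<kappa> u \<partial>M) \<le> ennreal b" .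
    fix x assume x: "x \<in> \<Lambda>"
    have "cum (\<lambda>u. g u * (1 - \<kappa> u)) x \<le> cum (pull g (indicator {b<..})) x"
      by (intro cum_mono) (simp_all add: pull_def compl)
    also have "\<dots> \<le> (\<integral>\<^sup>+s. indicator {b<..} s * indicator {0..rcum g x} s \<partial>lborel)"
      by (intro cum_pull_le g x) measurable
    also have "\<dots> = (\<integral>\<^sup>+s. indicator {b<..rcum g x} s \<partial>lborel)"
      using b by (intro nn_integral_cong) (auto simp: indicator_def)
    also have "\<dots> \<le> ennreal (c * x)"
      using maj[OF x] by (cases "b \<le> rcum g x") (auto intro!: ennreal_leI)
    finally show "cum (\<lambda>u. g u * (1 - \<kappa> u)) x \<le> ennreal (c * x)" .
  qed
qed

end

section \<open>Densities of transported mass\<close>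

context position
begin

text \<open>Cutting \<open>h\<close> down to the support of \<open>g\<close> makes \<open>h \<mu>\<close> absolutely continuous with respect to \<open>g \<mu>\<close>,
  hence its image absolutely continuous with respect to the image of \<open>g \<mu>\<close>, which is Lebesgue
  measure on a set of levels.\<close>

definition on_support :: "('a \<Rightarrow> ennreal) \<Rightarrow> ('a \<Rightarrow> ennreal) \<Rightarrow> 'a \<Rightarrow> ennreal" where
  "on_support g h u = (if g u = 0 then 0 else h u)"

definition source_density :: "real set \<Rightarrow> ('a \<Rightarrow> ennreal) \<Rightarrow> ('a \<Rightarrow> ennreal) \<Rightarrow> real \<Rightarrow> ennreal" where
  "source_density Z g h = RN_deriv lborel (push Z (rcum g) (on_support g h))"

lemma measurable_source_density[measurable]: "source_density Z g h \<in> borel_measurable borel"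
  using borel_measurable_RN_deriv[of lborel "push Z (rcum g) (on_support g h)"]
  by (simp add: source_density_def)

lemma measurable_on_support[measurable]:
  assumes [measurable]: "g \<in> borel_measurable M" "h \<in> borel_measurable M"
  shows "on_support g h \<in> borel_measurable M"
  unfolding on_support_def[abs_def] by measurable

lemma on_support_add: "on_support g (\<lambda>u. h u + h' u) u = on_support g h u + on_support g h' u"
  by (simp add: on_support_def)

lemma on_support_cmult: "on_support g (\<lambda>u. c * h u) u = c * on_support g h u"
  by (simp add: on_support_def)

lemma on_support_self: "on_support g g = g"
  by (auto simp: on_support_def)

lemma cum_on_support_le: "cum (on_support g h) x \<le> cum h x"
  by (intro cum_mono) (auto simp: on_support_def indicator_def)

end

locale source = position +
  fixes Z g
  assumes g: "tempered g" and Z: "closed Z" "0 \<in> Z" "Z \<subseteq> \<Lambda>"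
begin

abbreviation "G \<equiv> rcum g"
abbreviation "Below \<equiv> {s. 0 \<le> s \<and> (\<exists>z\<in>Z. s < G z)}"
abbreviation "pushed h \<equiv> push Z G (on_support g h)"
abbreviation "dens h \<equiv> source_density Z g h"

lemma g_meas[measurable]: "g \<in> borel_measurable M"
  using g by (rule tempered_meas)

lemma Below_borel[measurable]: "Below \<in> sets borel"
  by (rule borel_below)

lemma levels: "closed_levels Z G"
  by (rule closed_levels_rcum[OF g Z])

sublocale levels: closed_levels Z G
  by (rule levels)

lemma own: "push Z G g = density lborel (indicator Below)"
  by (rule push_own_density[OF g Z])

text \<open>Pushing uses the same kernel for every function, so null sets are inherited from \<open>g\<close>.\<close>

lemma pushed_null:
  assumes [measurable]: "h \<in> borel_measurable M" "A \<in> sets borel"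
    and null: "emeasure (push Z G g) A = 0"
  shows "emeasure (pushed h) A = 0"
proof -
  let ?I = "\<lambda>u. \<integral>\<^sup>+\<theta>. indicator A (mass_level G Z (p u) \<theta>) \<partial>unif"
  let ?c = "\<lambda>u. indicator {y. \<exists>z\<in>Z. y \<le> z} (p u) :: ennreal"
  have "(\<integral>\<^sup>+u. g u * ?c u * ?I u \<partial>M) = (\<integral>\<^sup>+s. indicator A s \<partial>push Z G g)"
    by (rule nn_integral_push[OF levels, symmetric]) auto
  also have "\<dots> = 0" using null by simp
  finally have "AE u in M. g u * ?c u * ?I u = 0"
    by (subst (asm) nn_integral_0_iff_AE) auto
  then have "AE u in M. on_support g h u * ?c u * ?I u = 0"
    by eventually_elim (auto simp: on_support_def)
  then have "(\<integral>\<^sup>+u. on_support g h u * ?c u * ?I u \<partial>M) = 0"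
    by (subst nn_integral_0_iff_AE) auto
  moreover have "(\<integral>\<^sup>+s. indicator A s \<partial>pushed h) = (\<integral>\<^sup>+u. on_support g h u * ?c u * ?I u \<partial>M)"
    by (rule nn_integral_push[OF levels]) auto
  ultimately show ?thesis by simp
qed

lemma density_dens:
  assumes [measurable]: "h \<in> borel_measurable M"
  shows "density lborel (dens h) = pushed h"
  unfolding source_density_def
proof (rule sigma_finite_measure.density_RN_deriv[OF sigma_finite_lborel])
  show "absolutely_continuous lborel (pushed h)"
    unfolding absolutely_continuous_def
  proof
    fix A :: "real set" assume A: "A \<in> null_sets lborel"
    then have [measurable]: "A \<in> sets borel" by auto
    have "emeasure (push Z G g) A = (\<integral>\<^sup>+s. indicator Below s * indicator A s \<partial>lborel)"
      unfolding own by (subst emeasure_density) auto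
    also have "\<dots> \<le> (\<integral>\<^sup>+s. indicator A s \<partial>lborel)"
      by (intro nn_integral_mono) (auto simp: indicator_def)
    also have "\<dots> = 0" using A by (simp add: null_setsD1)
    finally have "emeasure (pushed h) A = 0"
      by (intro pushed_null) auto
    then show "A \<in> null_sets (pushed h)" by (intro null_setsI) auto
  qed
qed simp

lemma integral_dens:
  assumes [measurable]: "h \<in> borel_measurable M" "A \<in> sets borel"
  shows "(\<integral>\<^sup>+s. dens h s * indicator A s \<partial>lborel) = emeasure (pushed h) A"
  unfolding density_dens[OF assms(1), symmetric] by (subst emeasure_density) auto

text \<open>Additivity, homogeneity and invariance under changes on null sets follow from this uniqueness,
  because \<open>h \<mapsto> pushed h\<close> has these properties exactly.\<close>

lemma dens_unique:
  assumes "h \<in> borel_measurable M" and r[measurable]: "r \<in> borel_measurable borel"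
    and eq: "\<And>A. A \<in> sets borel \<Longrightarrow> emeasure (pushed h) A = (\<integral>\<^sup>+s. r s * indicator A s \<partial>lborel)"
  shows "AE s in lborel. dens h s = r s"
proof -
  have "density lborel r = pushed h"
    by (rule measure_eqI) (auto simp: emeasure_density eq)
  then have "density lborel (dens h) = density lborel r"
    using density_dens[OF assms(1)] by simp
  then show ?thesis
    by (subst (asm) sigma_finite_measure.density_unique_iff[OF sigma_finite_lborel]) auto
qed

lemma emeasure_pushed:
  assumes [measurable]: "h \<in> borel_measurable M" "A \<in> sets borel"
  shows "emeasure (pushed h) A = (\<integral>\<^sup>+u. on_support g h u * indicator {y. \<exists>z\<in>Z. y \<le> z} (p u) *
    (\<integral>\<^sup>+\<theta>. indicator A (mass_level G Z (p u) \<theta>) \<partial>unif) \<partial>M)"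
  using nn_integral_push[OF levels, of "on_support g h" "indicator A"] by simp

lemma dens_add:
  assumes [measurable]: "h \<in> borel_measurable M" "h' \<in> borel_measurable M"
  shows "AE s in lborel. dens (\<lambda>u. h u + h' u) s = dens h s + dens h' s"
proof (rule dens_unique)
  fix A :: "real set" assume [measurable]: "A \<in> sets borel"
  have "emeasure (pushed (\<lambda>u. h u + h' u)) A = emeasure (pushed h) A + emeasure (pushed h') A"
    by (simp add: emeasure_pushed on_support_add distrib_right nn_integral_add)
  also have "\<dots> = (\<integral>\<^sup>+s. (dens h s + dens h' s) * indicator A s \<partial>lborel)"
    by (simp add: integral_dens[symmetric] distrib_right nn_integral_add)
  finally show "emeasure (pushed (\<lambda>u. h u + h' u)) A = \<dots>" .
qed auto

lemma dens_cmult: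
  assumes [measurable]: "h \<in> borel_measurable M"
  shows "AE s in lborel. dens (\<lambda>u. c * h u) s = c * dens h s"
proof (rule dens_unique)
  fix A :: "real set" assume [measurable]: "A \<in> sets borel"
  have "emeasure (pushed (\<lambda>u. c * h u)) A = c * emeasure (pushed h) A"
    by (simp add: emeasure_pushed on_support_cmult mult.assoc nn_integral_cmult)
  also have "\<dots> = (\<integral>\<^sup>+s. (c * dens h s) * indicator A s \<partial>lborel)"
    by (simp add: integral_dens[symmetric] mult.assoc nn_integral_cmult)
  finally show "emeasure (pushed (\<lambda>u. c * h u)) A = \<dots>" .
qed auto

lemma dens_cong:
  assumes [measurable]: "h \<in> borel_measurable M" "h' \<in> borel_measurable M"
    and eq: "AE u in M. h u = h' u"
  shows "AE s in lborel. dens h s = dens h' s"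
proof (rule dens_unique)
  fix A :: "real set" assume [measurable]: "A \<in> sets borel"
  have "emeasure (pushed h) A = emeasure (pushed h') A"
    unfolding emeasure_pushed[OF assms(1) \<open>A \<in> sets borel\<close>] emeasure_pushed[OF assms(2) \<open>A \<in> sets borel\<close>]
    using eq by (intro nn_integral_cong_AE, eventually_elim) (simp add: on_support_def)
  then show "emeasure (pushed h) A = (\<integral>\<^sup>+s. dens h' s * indicator A s \<partial>lborel)"
    by (simp add: integral_dens)
qed auto

lemma dens_self: "AE s in lborel. dens g s = indicator Below s"
proof (rule dens_unique)
  show [measurable]: "indicator Below \<in> borel_measurable borel"
    by simp
  fix A :: "real set" assume [measurable]: "A \<in> sets borel"
  show "emeasure (pushed g) A = (\<integral>\<^sup>+s. indicator Below s * indicator A s \<partial>lborel)"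
    by (simp add: on_support_self own emeasure_density)
qed auto

lemma pushed_Below:
  assumes [measurable]: "h \<in> borel_measurable M"
  shows "emeasure (pushed h) (- Below) = 0"
proof (rule pushed_null)
  show B: "- Below \<in> sets borel"
    by (subst Compl_eq_Diff_UNIV) (intro sets.Diff, auto)
  have "emeasure (push Z G g) (- Below) = (\<integral>\<^sup>+s. indicator Below s * indicator (- Below) s \<partial>lborel)"
    unfolding own using B by (subst emeasure_density) auto
  also have "\<dots> = (\<integral>\<^sup>+(s::real). 0 \<partial>lborel)"
    by (intro nn_integral_cong) (auto simp: indicator_def)
  finally show "emeasure (push Z G g) (- Below) = 0" by simp
qed auto

lemma emeasure_pushed_lessThan_le:
  assumes [measurable]: "h \<in> borel_measurable M"
    and le: "\<And>s. s < t \<Longrightarrow> emeasure (pushed h) {..s} \<le> K"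
  shows "emeasure (pushed h) {..<t} \<le> K"
proof -
  have "{..<t} = (\<Union>n. {..t - 1 / real (Suc n)})"
  proof safe
    fix s assume "s < t"
    then obtain n where "1 / real (Suc n) < t - s"
      using reals_Archimedean[of "t - s"] by (auto simp: inverse_eq_divide)
    then have "s \<in> {..t - 1 / real (Suc n)}" by simp
    then show "s \<in> (\<Union>n. {..t - 1 / real (Suc n)})" by blast
  next
    fix s n assume "s \<le> t - 1 / real (Suc n)"
    moreover have "1 / real (Suc n) > 0" by simp
    ultimately show "s < t" by linarith
  qed
  also have "emeasure (pushed h) \<dots> = (SUP n. emeasure (pushed h) {..t - 1 / real (Suc n)})"
  proof (rule SUP_emeasure_incseq[symmetric])
    show "incseq (\<lambda>n. {..t - 1 / real (Suc n)})"
      by (intro incseq_SucI) (auto simp: frac_le intro: order_trans)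
  qed auto
  also have "\<dots> \<le> K"
    by (intro SUP_least le) simp
  finally show ?thesis .
qed

lemma emeasure_pushed_atMost_0:
  assumes [measurable]: "h \<in> borel_measurable M" and s: "s \<le> 0"
  shows "emeasure (pushed h) {..s} = 0"
proof (rule pushed_null)
  have "emeasure (push Z G g) {..s} = (\<integral>\<^sup>+s'. indicator Below s' * indicator {..s} s' \<partial>lborel)"
    unfolding own by (subst emeasure_density) auto
  also have "\<dots> \<le> (\<integral>\<^sup>+(s'::real). indicator {0} s' \<partial>lborel)"
    using s by (intro nn_integral_mono) (auto simp: indicator_def)
  also have "\<dots> = 0" by simp
  finally show "emeasure (push Z G g) {..s} = 0" by simp
qed auto

text \<open>Levels on the boundary of \<open>Below\<close> are reached by continuity from below, so that bounds are needed
  only at levels covered by the interpolation formula.\<close>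

lemma integral_dens_le:
  assumes [measurable]: "h \<in> borel_measurable M"
    and le: "\<And>s z. 0 < s \<Longrightarrow> s \<le> t \<Longrightarrow> z \<in> Z \<Longrightarrow> s < G z \<Longrightarrow> emeasure (pushed h) {..s} \<le> K"
  shows "(\<integral>\<^sup>+s. dens h s * indicator {0..t} s \<partial>lborel) \<le> K"
proof -
  obtain z where z: "incseq z" "\<And>n. z n \<in> Z" "\<And>y. y \<in> Z \<Longrightarrow> \<exists>n. y \<le> z n"
    using levels.cofinal_sequence by metis
  have B: "Below \<inter> {0..t} \<subseteq> (\<Union>n. {..t} \<inter> {..<G (z n)})"
  proof safe
    fix s z' assume s: "s \<in> {0..t}" "z' \<in> Z" "s < G z'"
    obtain n where "z' \<le> z n" using z(3)[OF s(2)] by blast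
    then have "G z' \<le> G (z n)" by (rule monoD[OF levels.mono_F])
    with s have "s \<in> {..t} \<inter> {..<G (z n)}" by simp
    then show "s \<in> (\<Union>n. {..t} \<inter> {..<G (z n)})" by blast
  qed
  have each: "emeasure (pushed h) {..s} \<le> K" if "s \<le> t" "s < G (z n)" for s n
    using le[of s "z n"] emeasure_pushed_atMost_0[of h s] that z(2) by (cases "s \<le> 0") auto
  have "(\<integral>\<^sup>+s. dens h s * indicator {0..t} s \<partial>lborel) = emeasure (pushed h) {0..t}"
    by (rule integral_dens) auto
  also have "\<dots> \<le> emeasure (pushed h) ((Below \<inter> {0..t}) \<union> - Below)"
    by (intro emeasure_mono) auto
  also have "\<dots> \<le> emeasure (pushed h) (Below \<inter> {0..t}) + emeasure (pushed h) (- Below)"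
    by (intro emeasure_subadditive) auto
  also have "\<dots> = emeasure (pushed h) (Below \<inter> {0..t})"
    by (simp add: pushed_Below)
  also have "\<dots> \<le> emeasure (pushed h) (\<Union>n. {..t} \<inter> {..<G (z n)})"
    using B by (intro emeasure_mono) auto
  also have "\<dots> = (SUP n. emeasure (pushed h) ({..t} \<inter> {..<G (z n)}))"
  proof (rule SUP_emeasure_incseq[symmetric])
    show "incseq (\<lambda>n. {..t} \<inter> {..<G (z n)})"
    proof (rule incseq_SucI)
      fix n
      have "G (z n) \<le> G (z (Suc n))"
        using z(1) by (intro monoD[OF levels.mono_F]) (auto simp: incseq_Suc_iff)
      then show "{..t} \<inter> {..<G (z n)} \<subseteq> {..t} \<inter> {..<G (z (Suc n))}" by auto
    qed
  qed auto
  also have "\<dots> \<le> K"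
  proof (rule SUP_least)
    fix n
    show "emeasure (pushed h) ({..t} \<inter> {..<G (z n)}) \<le> K"
    proof (cases "t < G (z n)")
      case True
      then have "{..t} \<inter> {..<G (z n)} = {..t}" by auto
      then show ?thesis using each[of t n] True by simp
    next
      case False
      then have "{..t} \<inter> {..<G (z n)} = {..<G (z n)}" by auto
      then show ?thesis
        using emeasure_pushed_lessThan_le[of h "G (z n)" K] each[of _ n] False by auto
    qed
  qed
  finally show ?thesis .
qed

lemma integral_dens_total:
  assumes [measurable]: "h \<in> borel_measurable M"
  shows "(\<integral>\<^sup>+s. dens h s * indicator {0..} s \<partial>lborel) \<le> (\<integral>\<^sup>+u. h u \<partial>M)"
proof -
  have "(\<integral>\<^sup>+s. dens h s * indicator {0..} s \<partial>lborel) = emeasure (pushed h) {0..}"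
    by (rule integral_dens) auto
  also have "\<dots> \<le> emeasure (pushed h) UNIV" by (intro emeasure_mono) auto
  also have "\<dots> = (\<integral>\<^sup>+u. on_support g h u * indicator {y. \<exists>z\<in>Z. y \<le> z} (p u) \<partial>M)"
    by (rule emeasure_push_UNIV[OF levels]) auto
  also have "\<dots> \<le> (\<integral>\<^sup>+u. h u \<partial>M)"
    by (intro nn_integral_mono) (auto simp: on_support_def indicator_def)
  finally show ?thesis .
qed

lemma integral_dens_bounded:
  assumes [measurable]: "h \<in> borel_measurable M" and x0: "\<And>z. z \<in> Z \<Longrightarrow> z \<le> x0"
  shows "(\<integral>\<^sup>+s. dens h s * indicator {0..t} s \<partial>lborel) \<le> cum h x0"
proof -
  have "(\<integral>\<^sup>+s. dens h s * indicator {0..t} s \<partial>lborel) = emeasure (pushed h) {0..t}"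
    by (rule integral_dens) auto
  also have "\<dots> \<le> emeasure (pushed h) UNIV" by (intro emeasure_mono) auto
  also have "\<dots> = (\<integral>\<^sup>+u. on_support g h u * indicator {y. \<exists>z\<in>Z. y \<le> z} (p u) \<partial>M)"
    by (rule emeasure_push_UNIV[OF levels]) auto
  also have "\<dots> \<le> cum h x0"
    unfolding cum_def
    by (intro nn_integral_mono) (auto simp: on_support_def indicator_def dest: x0)
  finally show ?thesis .
qed

end

section \<open>The positive contraction\<close>

context position
begin

text \<open>The properties on nonnegative functions from which a contraction for signed functions is built.\<close>

definition positive_contraction :: "(('a \<Rightarrow> ennreal) \<Rightarrow> 'a \<Rightarrow> ennreal) \<Rightarrow> bool" where
  "positive_contraction T \<longleftrightarrow>
     (\<forall>h. tempered h \<longrightarrow> T h \<in> borel_measurable M) \<and>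
     (\<forall>h h'. tempered h \<longrightarrow> tempered h' \<longrightarrow> (AE u in M. h u = h' u) \<longrightarrow> (AE u in M. T h u = T h' u)) \<and>
     (\<forall>h h'. tempered h \<longrightarrow> tempered h' \<longrightarrow> (AE u in M. T (\<lambda>u. h u + h' u) u = T h u + T h' u)) \<and>
     (\<forall>c h. tempered h \<longrightarrow> (AE u in M. T (\<lambda>u. ennreal c * h u) u = ennreal c * T h u)) \<and>
     (\<forall>h. tempered h \<longrightarrow> (\<integral>\<^sup>+u. T h u \<partial>M) \<le> (\<integral>\<^sup>+u. h u \<partial>M)) \<and>
     (\<forall>h C. tempered h \<longrightarrow> 0 \<le> C \<longrightarrow> (\<forall>x\<in>\<Lambda>. cum h x \<le> ennreal (C * x)) \<longrightarrow>
        (\<forall>x\<in>\<Lambda>. cum (T h) x \<le> ennreal (C * x)))"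

lemma tempered_add:
  assumes "tempered h" "tempered h'"
  shows "tempered (\<lambda>u. h u + h' u)"
proof -
  obtain K K' where K: "0 \<le> K" "\<And>x. 0 \<le> x \<Longrightarrow> cum h x \<le> ennreal (K + K * x)"
    and K': "0 \<le> K'" "\<And>x. 0 \<le> x \<Longrightarrow> cum h' x \<le> ennreal (K' + K' * x)"
    using tempered_bound[OF assms(1)] tempered_bound[OF assms(2)] by metis
  have "cum (\<lambda>u. h u + h' u) x \<le> ennreal ((K + K') + (K + K') * x)" if "x \<in> \<Lambda>" for x
  proof -
    have x: "0 \<le> x" using that \<Lambda>_nonneg by auto
    have "cum (\<lambda>u. h u + h' u) x \<le> ennreal (K + K * x) + ennreal (K' + K' * x)"
      unfolding cum_add[OF tempered_meas[OF assms(1)] tempered_meas[OF assms(2)]]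
      using K(2)[OF x] K'(2)[OF x] by (rule add_mono)
    also have "\<dots> = ennreal ((K + K') + (K + K') * x)"
      using K(1) K'(1) x by (subst ennreal_plus[symmetric]) (auto simp: algebra_simps)
    finally show ?thesis .
  qed
  then show ?thesis
    using K(1) K'(1) tempered_meas[OF assms(1)] tempered_meas[OF assms(2)]
    unfolding tempered_def by (intro conjI exI[of _ "K + K'"]) auto
qed

end

text \<open>The last assumption says that \<open>F\<^sub>f\<close> lies below the least concave majorant of \<open>F\<^sub>g\<close>.\<close>

locale source_target = position +
  fixes f g :: "'a \<Rightarrow> ennreal"
  assumes f: "tempered f" and tempered_g: "tempered g"
    and dominated: "\<And>b c x. 0 \<le> c \<Longrightarrow> (\<And>y. y \<in> \<Lambda> \<Longrightarrow> rcum g y \<le> b + c * y) \<Longrightarrow> x \<in> \<Lambda> \<Longrightarrow>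
      rcum f x \<le> b + c * x"
begin

definition "growth = (SOME K. \<forall>y\<in>\<Lambda>. rcum g y \<le> K + K * y)"

sublocale profile: mass_profile \<Lambda> "rcum g" growth
proof
  obtain K where K: "0 \<le> K" "\<And>x. 0 \<le> x \<Longrightarrow> cum g x \<le> ennreal (K + K * x)"
    using tempered_bound[OF tempered_g] by metis
  have "\<forall>y\<in>\<Lambda>. rcum g y \<le> K + K * y"
  proof
    fix y assume "y \<in> \<Lambda>"
    then have y: "0 \<le> y" using \<Lambda>_nonneg by auto
    then have "ennreal (rcum g y) \<le> ennreal (K + K * y)"
      using K(2)[OF y] by (simp add: ennreal_rcum[OF tempered_g])
    then show "rcum g y \<le> K + K * y" using K(1) y by (subst (asm) ennreal_le_iff) auto
  qed
  then have "\<exists>K. \<forall>y\<in>\<Lambda>. rcum g y \<le> K + K * y" ..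
  then have "\<forall>y\<in>\<Lambda>. rcum g y \<le> growth + growth * y"
    unfolding growth_def by (rule someI_ex)
  then show "rcum g y \<le> growth + growth * y" if "y \<in> \<Lambda>" for y using that by blast
qed (use closed_\<Lambda> zero_\<Lambda> \<Lambda>_nonneg mono_rcum cont_rcum rcum_0 tempered_g in auto)

abbreviation "Z \<equiv> profile.contacts"
abbreviation "m \<equiv> profile.asymptotic_slope"

sublocale source M p \<Lambda> Z g
proof
  show "0 \<in> Z" by (simp add: profile.contacts_def)
qed (rule tempered_g profile.closed_contacts profile.contacts_subset)+

lemma f_below_majorant: "profile.majorant b c \<Longrightarrow> x \<in> \<Lambda> \<Longrightarrow> rcum f x \<le> b + c * x"
  by (rule dominated) (auto simp: profile.majorant_def)

text \<open>This is the heart of the construction. The line through the neighbouring contact points \<open>a\<close>, \<open>b\<close>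
  majorises \<open>F\<^sub>g\<close>, hence \<open>F\<^sub>f\<close>; at \<open>(1-\<theta>) a + \<theta> b\<close> it takes the value \<open>s \<le> F\<^sub>f(x)\<close>, which forces
  \<open>(1-\<theta>) a + \<theta> b \<le> x\<close>. The transported mass is bounded by \<open>C\<close> times the left-hand side.\<close>

lemma dens_contracts:
  assumes h: "tempered h" and C: "0 \<le> C" and hC: "\<And>y. y \<in> \<Lambda> \<Longrightarrow> cum h y \<le> ennreal (C * y)"
    and x: "x \<in> \<Lambda>"
  shows "(\<integral>\<^sup>+s. dens h s * indicator {0..rcum f x} s \<partial>lborel) \<le> ennreal (C * x)"
proof (rule integral_dens_le)
  show [measurable]: "h \<in> borel_measurable M" using h by (rule tempered_meas)
  fix s z assume s: "0 < s" "s \<le> rcum f x" and z: "z \<in> Z" "s < G z"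
  have s0: "0 \<le> s" using s by simp
  obtain a b \<theta> where ab: "a \<in> Z" "b \<in> Z" and \<theta>: "0 \<le> \<theta>" "\<theta> \<le> 1"
    and eq: "s = (1 - \<theta>) * G a + \<theta> * G b"
    and gap: "a = b \<and> G a = s \<or> a < b \<and> G a \<le> s \<and> s < G b \<and> (\<forall>z\<in>Z. z \<le> a \<or> b \<le> z)"
    and push: "emeasure (pushed h) {..s} =
      ennreal (1 - \<theta>) * cum (on_support g h) a + ennreal \<theta> * cum (on_support g h) b"
    by (rule emeasure_push_atMost[OF levels s0 z])
      (rule that, assumption, assumption, assumption, assumption, assumption, assumption,
        erule bspec, measurable)
  obtain \<beta> c where line: "profile.majorant \<beta> c" "0 < c" "G a = \<beta> + c * a" "G b = \<beta> + c * b"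
    by (rule profile.contact_line[OF ab gap z s(1)])
  have abL: "a \<in> \<Lambda>" "b \<in> \<Lambda>" "0 \<le> a" "0 \<le> b"
    using ab Z \<Lambda>_nonneg by auto
  have "(1 - \<theta>) * G a + \<theta> * G b = \<beta> + c * ((1 - \<theta>) * a + \<theta> * b)"
    unfolding line(3,4) by (simp add: algebra_simps)
  then have "\<beta> + c * ((1 - \<theta>) * a + \<theta> * b) \<le> \<beta> + c * x"
    using eq s(2) f_below_majorant[OF line(1) x] by simp
  then have tx: "(1 - \<theta>) * a + \<theta> * b \<le> x"
    using line(2) by simp
  have "emeasure (pushed h) {..s} \<le> ennreal (1 - \<theta>) * ennreal (C * a) + ennreal \<theta> * ennreal (C * b)"
    unfolding push using hC[OF abL(1)] hC[OF abL(2)] cum_on_support_le[of g h]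
    by (intro add_mono mult_left_mono order_trans[OF cum_on_support_le]) auto
  also have "\<dots> = ennreal (C * ((1 - \<theta>) * a + \<theta> * b))"
    using \<theta> C abL by (simp add: ennreal_mult[symmetric] ennreal_plus[symmetric] del: ennreal_plus)
      (simp add: algebra_simps)
  also have "\<dots> \<le> ennreal (C * x)"
    using tx C by (intro ennreal_leI mult_left_mono)
  finally show "emeasure (pushed h) {..s} \<le> ennreal (C * x)" .
qed

abbreviation "Beyond \<equiv> {s. \<forall>z\<in>Z. G z \<le> s}"

lemma Beyond_borel[measurable]: "Beyond \<in> sets borel"
proof -
  have "(\<Inter>z\<in>Z. {G z..}) \<in> sets borel" by (intro borel_closed closed_INT) auto
  also have "(\<Inter>z\<in>Z. {G z..}) = Beyond" by auto
  finally show ?thesis .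
qed

text \<open>The requirements on the factor by which \<open>f\<close> is multiplied at the mass levels that transport from
  the contact set cannot reach.\<close>

definition tail_functional :: "(('a \<Rightarrow> ennreal) \<Rightarrow> real) \<Rightarrow> bool" where
  "tail_functional l \<longleftrightarrow>
     (\<forall>h h'. tempered h \<longrightarrow> tempered h' \<longrightarrow> (AE u in M. h u = h' u) \<longrightarrow> l h = l h') \<and>
     (\<forall>h. tempered h \<longrightarrow> 0 \<le> l h) \<and>
     (\<forall>h h'. tempered h \<longrightarrow> tempered h' \<longrightarrow> l (\<lambda>u. h u + h' u) = l h + l h') \<and>
     (\<forall>c h. tempered h \<longrightarrow> 0 \<le> c \<longrightarrow> l (\<lambda>u. ennreal c * h u) = c * l h) \<and>
     (\<forall>h. tempered h \<longrightarrow> (\<integral>\<^sup>+u. h u \<partial>M) < \<infinity> \<longrightarrow> l h = 0) \<and>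
     (\<forall>h C x. tempered h \<longrightarrow> 0 \<le> C \<longrightarrow> (\<forall>y\<in>\<Lambda>. cum h y \<le> ennreal (C * y)) \<longrightarrow> x \<in> \<Lambda> \<longrightarrow>
       (\<integral>\<^sup>+s. dens h s * indicator {0..rcum f x} s \<partial>lborel) +
         ennreal (l h) * emeasure lborel ({0..rcum f x} \<inter> Beyond) \<le> ennreal (C * x)) \<and>
     (\<forall>x s. x \<in> \<Lambda> \<longrightarrow> s < rcum f x \<longrightarrow> s \<in> Beyond \<longrightarrow> l g = 1)"

text \<open>If \<open>F\<^sub>f\<close> never exceeds the mass levels reached from contact points, the zero functional serves.
  Otherwise the contact set ends at some \<open>x\<^sub>0\<close> and the functional is the Banach limit of
  \<open>F\<^sub>h(y\<^sub>n) / y\<^sub>n\<close> divided by the asymptotic slope \<open>m\<close>. The mass of \<open>f\<close> beyond \<open>F\<^sub>g(x\<^sub>0)\<close> up to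
  position \<open>x\<close> is at most \<open>m (x - x\<^sub>0)\<close>, so the tail contributes at most \<open>C (x - x\<^sub>0)\<close>, while
  the transported mass is at most \<open>F\<^sub>h(x\<^sub>0) \<le> C x\<^sub>0\<close>.\<close>

lemma tail_functional_exists: "\<exists>l. tail_functional l"
proof (cases "\<exists>x\<in>\<Lambda>. \<exists>s\<in>Beyond. s < rcum f x")
  case False
  have "tail_functional (\<lambda>_. 0)"
    unfolding tail_functional_def
  proof (intro conjI allI impI)
    fix h C x assume h: "tempered h" "0 \<le> C" "\<forall>y\<in>\<Lambda>. cum h y \<le> ennreal (C * y)" and x: "x \<in> \<Lambda>"
    show "(\<integral>\<^sup>+s. dens h s * indicator {0..rcum f x} s \<partial>lborel) +
         ennreal 0 * emeasure lborel ({0..rcum f x} \<inter> Beyond) \<le> ennreal (C * x)"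
      using dens_contracts[OF h(1,2) _ x] h(3) by simp
  next
    fix x s assume "x \<in> \<Lambda>" "s < rcum f x" "s \<in> Beyond"
    then show "0 = (1::real)" using False by blast
  qed simp_all
  then show ?thesis by blast
next
  case True
  then obtain x1 s1 where x1: "x1 \<in> \<Lambda>" "s1 \<in> Beyond" "s1 < rcum f x1" by auto
  note beyond = profile.beyond_contacts[of s1 "rcum f x1" x1]
  have m: "0 < m" and bdd: "bdd_above Z"
    using x1 f_below_majorant by (auto intro!: beyond)
  define x0 where "x0 = Sup Z"
  have x0: "x0 \<in> Z" "\<And>z. z \<in> Z \<Longrightarrow> z \<le> x0"
    using closed_contains_Sup[OF _ bdd profile.closed_contacts] bdd Z(2)
    by (auto simp: x0_def intro: cSup_upper)
  have x0L: "x0 \<in> \<Lambda>" "0 \<le> x0" using x0(1) Z(3) \<Lambda>_nonneg by auto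
  have f_le: "rcum f x \<le> G x0 + m * (x - x0)" if "x \<in> \<Lambda>" for x
    using that by (intro profile.affine_bound_of_majorants x0 f_below_majorant)
  obtain y where y: "\<And>n. y n \<in> \<Lambda>" "\<And>n. 1 \<le> y n" "filterlim y at_top sequentially"
    "(\<lambda>n. G (y n) / y n) \<longlonglongrightarrow> m"
    using profile.asymptotic_sequence[OF m x0] by metis
  obtain L where "Banach_limit L" using Banach_limit_exists by blast
  then have L: "\<And>a b. Bseq a \<Longrightarrow> Bseq b \<Longrightarrow> L (\<lambda>n. a n + b n) = L a + L b"
    "\<And>c a. Bseq a \<Longrightarrow> L (\<lambda>n. c * a n) = c * L a"
    "\<And>a. Bseq a \<Longrightarrow> (\<And>n. 0 \<le> a n) \<Longrightarrow> 0 \<le> L a"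
    "\<And>a l. a \<longlonglongrightarrow> l \<Longrightarrow> L a = l"
    by (simp_all add: Banach_limit_def)
  have ypos: "0 < y n" for n using y(2)[of n] by simp
  define q where "q h n = rcum h (y n) / y n" for h n
  have q0: "0 \<le> q h n" for h n
    using rcum_nonneg[of h "y n"] ypos[of n] by (simp add: q_def)
  have bounded: "Bseq (q h)" if h: "tempered h" for h
  proof -
    obtain K where K: "0 \<le> K" "\<And>x. 0 \<le> x \<Longrightarrow> cum h x \<le> ennreal (K + K * x)"
      using tempered_bound[OF h] by metis
    have "norm (q h n) \<le> 2 * K" for n
    proof -
      have "ennreal (rcum h (y n)) \<le> ennreal (K + K * y n)"
        using K(2)[of "y n"] ypos[of n] by (simp add: ennreal_rcum[OF h])
      then have "rcum h (y n) \<le> K + K * y n"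
        using K(1) ypos[of n] by (subst (asm) ennreal_le_iff) auto
      also have "\<dots> \<le> K * y n + K * y n"
        using K(1) y(2)[of n] mult_left_mono[of 1 "y n" K] by simp
      finally show ?thesis
        using rcum_nonneg[of h "y n"] ypos[of n] by (simp add: q_def pos_divide_le_eq mult.assoc)
    qed
    then show ?thesis by (rule BseqI')
  qed
  have q_add: "q (\<lambda>u. h u + h' u) = (\<lambda>n. q h n + q h' n)" if "tempered h" "tempered h'" for h h'
    using that tempered_finite[of h] tempered_finite[of h']
    by (auto simp: q_def rcum_def fun_eq_iff cum_add tempered_meas enn2real_plus add_divide_distrib)
  have q_cmult: "q (\<lambda>u. ennreal c * h u) = (\<lambda>n. c * q h n)" if "tempered h" "0 \<le> c" for c h
    using that by (auto simp: q_def rcum_def fun_eq_iff cum_cmult tempered_meas enn2real_mult)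
  define l where "l h = L (q h) / m" for h
  have l_le: "l h \<le> C / m" if h: "tempered h" and C: "0 \<le> C" "\<forall>y\<in>\<Lambda>. cum h y \<le> ennreal (C * y)" for h C
  proof -
    have "q h n \<le> C" for n
    proof -
      have "ennreal (rcum h (y n)) \<le> ennreal (C * y n)"
        using C(2) y(1) by (simp add: ennreal_rcum[OF h])
      then show ?thesis
        using C(1) ypos[of n] by (simp add: ennreal_le_iff q_def pos_divide_le_eq)
    qed
    then have nn: "0 \<le> (-1) * q h n + C" for n by simp
    have B: "Bseq (\<lambda>n. (-1) * q h n)"
      using Bseq_mult[OF Bfun_const bounded[OF h], of "-1"] .
    have "0 \<le> L (\<lambda>n. (-1) * q h n + C)"
      by (intro L(3) Bseq_add B nn)
    also have "\<dots> = (-1) * L (q h) + L (\<lambda>n. C)"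
      using L(1)[OF B Bfun_const, of C] L(2)[OF bounded[OF h], of "-1"] by simp
    also have "L (\<lambda>n. C) = C" by (rule L(4)) simp
    finally show ?thesis using m by (simp add: l_def divide_right_mono)
  qed
  have "tail_functional l"
    unfolding tail_functional_def
  proof (intro conjI allI impI)
    show "l h = l h'" if "AE u in M. h u = h' u" for h h'
      using cum_cong_AE[OF that] by (simp add: l_def q_def[abs_def] rcum_def)
    show l_nonneg: "0 \<le> l h" if "tempered h" for h
      using L(3)[OF bounded[OF that] q0] m by (simp add: l_def)
    show "l (\<lambda>u. h u + h' u) = l h + l h'" if "tempered h" "tempered h'" for h h'
      unfolding l_def q_add[OF that] L(1)[OF bounded[OF that(1)] bounded[OF that(2)]]
      by (rule add_divide_distrib)
    show "l (\<lambda>u. ennreal c * h u) = c * l h" if "tempered h" "0 \<le> c" for c h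
      unfolding l_def q_cmult[OF that] L(2)[OF bounded[OF that(1)]] by simp
    show "l h = 0" if h: "tempered h" and fin: "(\<integral>\<^sup>+u. h u \<partial>M) < \<infinity>" for h
    proof -
      let ?I = "enn2real (\<integral>\<^sup>+u. h u \<partial>M)"
      have "(\<lambda>n. q h n) \<longlonglongrightarrow> 0"
      proof (rule tendsto_sandwich[where f="\<lambda>_. 0"])
        show "(\<lambda>n. ?I / y n) \<longlonglongrightarrow> 0"
          by (intro real_tendsto_divide_at_top[OF tendsto_const y(3)])
        show "\<forall>\<^sub>F n in sequentially. q h n \<le> ?I / y n"
          unfolding q_def rcum_def using fin ypos
          by (intro always_eventually allI divide_right_mono enn2real_mono cum_le_integral)
            (auto intro: less_imp_le)
      qed (use q0 in auto)
      then show ?thesis using L(4) by (simp add: l_def)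
    qed
    show "l g = 1" if "x \<in> \<Lambda>" "s < rcum f x" "s \<in> Beyond" for x s
      using L(4)[of "q g"] y(4) m by (simp add: l_def q_def[abs_def])
    fix h C x assume h: "tempered h" and C: "0 \<le> C" "\<forall>y\<in>\<Lambda>. cum h y \<le> ennreal (C * y)"
      and x: "x \<in> \<Lambda>"
    show "(\<integral>\<^sup>+s. dens h s * indicator {0..rcum f x} s \<partial>lborel) +
         ennreal (l h) * emeasure lborel ({0..rcum f x} \<inter> Beyond) \<le> ennreal (C * x)"
    proof (cases "rcum f x \<le> G x0")
      case True
      have "{0..rcum f x} \<inter> Beyond \<subseteq> {rcum f x}"
        using True x0(1) by (force dest: bspec)
      then have "emeasure lborel ({0..rcum f x} \<inter> Beyond) \<le> emeasure lborel {rcum f x}"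
        by (intro emeasure_mono) auto
      then show ?thesis using dens_contracts[OF h C(1) _ x] C(2) by simp
    next
      case False
      have "{0..rcum f x} \<inter> Beyond \<subseteq> {G x0..rcum f x}"
        using x0(1) by auto
      then have "emeasure lborel ({0..rcum f x} \<inter> Beyond) \<le> emeasure lborel {G x0..rcum f x}"
        by (intro emeasure_mono) auto
      also have "\<dots> = ennreal (rcum f x - G x0)" using False by simp
      finally have "ennreal (l h) * emeasure lborel ({0..rcum f x} \<inter> Beyond) \<le>
          ennreal (l h) * ennreal (rcum f x - G x0)"
        by (rule mult_left_mono) simp
      also have "\<dots> = ennreal (l h * (rcum f x - G x0))"
        using False l_nonneg[OF h] by (simp add: ennreal_mult)
      also have "\<dots> \<le> ennreal (C / m * (m * (x - x0)))"
        using l_le[OF h C] f_le[OF x] False C(1) m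
        by (intro ennreal_leI mult_mono) auto
      also have "\<dots> = ennreal (C * (x - x0))" using m by simp
      finally have tail: "ennreal (l h) * emeasure lborel ({0..rcum f x} \<inter> Beyond) \<le> ennreal (C * (x - x0))" .
      have "0 < m * (x - x0)" using f_le[OF x] False by simp
      then have "x0 \<le> x" using m by (simp add: zero_less_mult_iff)
      have "(\<integral>\<^sup>+s. dens h s * indicator {0..rcum f x} s \<partial>lborel) \<le> cum h x0"
        using x0(2) by (intro integral_dens_bounded tempered_meas h)
      also have "\<dots> \<le> ennreal (C * x0)" using C(2) x0L by blast
      finally have "(\<integral>\<^sup>+s. dens h s * indicator {0..rcum f x} s \<partial>lborel) +
         ennreal (l h) * emeasure lborel ({0..rcum f x} \<inter> Beyond) \<le> ennreal (C * x0) + ennreal (C * (x - x0))"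
        using tail by (rule add_mono)
      also have "\<dots> = ennreal (C * x)"
        using C(1) x0L \<open>x0 \<le> x\<close>
          by (subst ennreal_plus[symmetric]) (auto simp: right_diff_distrib mult_left_mono)
      finally show ?thesis .
    qed
  qed
  then show ?thesis by blast
qed

text \<open>The density of \<open>g\<close> on the line of mass levels is 1 at every level reached from the contact set, and
  the tail functional of \<open>g\<close> is 1 when higher levels occur; pulling back the constant 1 returns
  \<open>f\<close>.\<close>

theorem positive_contraction_exists:
  obtains T where "positive_contraction T" "AE u in M. T g u = f u"
proof -
  obtain l where l: "tail_functional l" using tail_functional_exists by blast
  note l' = l[unfolded tail_functional_def]
  note l_cong = l'[THEN conjunct1, THEN spec, THEN spec, THEN mp, THEN mp, THEN mp]
  note l_nonneg = l'[THEN conjunct2, THEN conjunct1, THEN spec, THEN mp]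
  note l_add = l'[THEN conjunct2, THEN conjunct2, THEN conjunct1, THEN spec, THEN spec, THEN
      mp, THEN mp]
  note l_cmult = l'[THEN conjunct2, THEN conjunct2, THEN conjunct2, THEN conjunct1, THEN
      spec, THEN spec, THEN mp, THEN mp]
  note l_L1 = l'[THEN conjunct2, THEN conjunct2, THEN conjunct2, THEN conjunct2, THEN
      conjunct1, THEN spec, THEN mp, THEN mp]
  note l_bound = l'[THEN conjunct2, THEN conjunct2, THEN conjunct2, THEN conjunct2, THEN
      conjunct2, THEN conjunct1, THEN spec, THEN spec, THEN spec, THEN mp, THEN mp, THEN mp,
      THEN mp]
  note l_g = l'[THEN conjunct2, THEN conjunct2, THEN conjunct2, THEN conjunct2, THEN
      conjunct2, THEN conjunct2, THEN spec, THEN spec, THEN mp, THEN mp, THEN mp]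
  define R where "R h s = dens h s + ennreal (l h) * indicator Beyond s" for h s
  have R_meas[measurable]: "R h \<in> borel_measurable borel" for h
    unfolding R_def[abs_def] by measurable
  define T where "T h = pull f (R h)" for h
  show thesis
  proof
    have "AE s in lborel. 0 \<le> s \<and> (\<exists>z\<in>\<Lambda>. s < rcum f z) \<longrightarrow> R g s = 1"
      using dens_self
    proof eventually_elim
      case (elim s)
      show ?case
      proof
        assume s: "0 \<le> s \<and> (\<exists>z\<in>\<Lambda>. s < rcum f z)"
        show "R g s = 1"
        proof (cases "\<exists>z\<in>Z. s < G z")
          case True
          then have "s \<in> Below" "s \<notin> Beyond" using s by (auto simp: not_le)
          then show ?thesis using elim by (simp add: R_def)
        next
          case False
          then have "s \<notin> Below" "s \<in> Beyond" by (auto simp: not_less)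
          moreover from this s have "l g = 1" using l_g[of _ s] by blast
          ultimately show ?thesis using elim by (simp add: R_def)
        qed
      qed
    qed
    then have "AE u in M. pull f (R g) u = pull f (\<lambda>_. 1) u"
      by (intro pull_cong_AE f) auto
    then show "AE u in M. T g u = f u"
      by (simp add: T_def pull_one)
    show "positive_contraction T"
      unfolding positive_contraction_def
    proof (intro conjI allI impI)
      show "T h \<in> borel_measurable M" for h
        unfolding T_def by (intro measurable_pull f) measurable
      fix h assume h: "tempered h"
      note h_meas[measurable] = tempered_meas[OF h]
      show "AE u in M. T h u = T h' u" if h': "tempered h'" and eq: "AE u in M. h u = h' u" for h'
      proof -
        have "AE s in lborel. R h s = R h' s"
          using dens_cong[OF h_meas tempered_meas[OF h'] eq]
          by eventually_elim (simp add: R_def l_cong[OF h h' eq])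
        then show ?thesis
          unfolding T_def by (intro pull_cong_AE f) auto
      qed
      show "AE u in M. T (\<lambda>u. h u + h' u) u = T h u + T h' u" if h': "tempered h'" for h'
      proof -
        have "AE s in lborel. R (\<lambda>u. h u + h' u) s = R h s + R h' s"
          using dens_add[OF h_meas tempered_meas[OF h']]
        proof eventually_elim
          case (elim s)
          have "ennreal (l (\<lambda>u. h u + h' u)) = ennreal (l h) + ennreal (l h')"
            unfolding l_add[OF h h'] using l_nonneg[OF h] l_nonneg[OF h'] by simp
          then show ?case
            unfolding R_def elim by (simp only: distrib_right add_ac)
        qed
        then have "AE u in M. T (\<lambda>u. h u + h' u) u = pull f (\<lambda>s. R h s + R h' s) u"
          unfolding T_def by (intro pull_cong_AE f) auto
        then show ?thesis
          by (rule AE_mp) (intro AE_I2 impI, simp add: T_def pull_add[OF f])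
      qed
      show "AE u in M. T (\<lambda>u. ennreal c * h u) u = ennreal c * T h u" for c
      proof -
        define c' where "c' = max 0 c"
        have c': "ennreal c = ennreal c'" "0 \<le> c'" by (auto simp: c'_def max_def ennreal_neg)
        have "AE s in lborel. R (\<lambda>u. ennreal c * h u) s = ennreal c * R h s"
          using dens_cmult[OF h_meas, of "ennreal c"]
        proof eventually_elim
          case (elim s)
          have "ennreal (l (\<lambda>u. ennreal c * h u)) = ennreal c * ennreal (l h)"
            unfolding c'(1) l_cmult[OF h c'(2)] using c'(2) l_nonneg[OF h] by (simp add: ennreal_mult)
          then show ?case
            unfolding R_def elim by (simp only: distrib_left mult.assoc)
        qed
        then have "AE u in M. T (\<lambda>u. ennreal c * h u) u = pull f (\<lambda>s. ennreal c * R h s) u"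
          unfolding T_def by (intro pull_cong_AE f) auto
        then show ?thesis
          by (rule AE_mp) (intro AE_I2 impI, simp add: T_def pull_cmult[OF f])
      qed
      show "(\<integral>\<^sup>+u. T h u \<partial>M) \<le> (\<integral>\<^sup>+u. h u \<partial>M)"
      proof (cases "(\<integral>\<^sup>+u. h u \<partial>M) < \<infinity>")
        case True
        have "(\<integral>\<^sup>+u. T h u \<partial>M) \<le> (\<integral>\<^sup>+s. R h s * indicator {0..} s \<partial>lborel)"
          unfolding T_def by (intro integral_pull_le f) measurable
        also have "\<dots> = (\<integral>\<^sup>+s. dens h s * indicator {0..} s \<partial>lborel)"
          by (simp add: R_def l_L1[OF h True])
        also have "\<dots> \<le> (\<integral>\<^sup>+u. h u \<partial>M)" by (rule integral_dens_total) measurable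
        finally show ?thesis .
      qed (simp add: not_less top_unique)
      fix C x assume C: "0 \<le> C" "\<forall>y\<in>\<Lambda>. cum h y \<le> ennreal (C * y)"
      show "\<forall>x\<in>\<Lambda>. cum (T h) x \<le> ennreal (C * x)"
      proof
        fix x assume x: "x \<in> \<Lambda>"
        have "cum (T h) x \<le> (\<integral>\<^sup>+s. R h s * indicator {0..rcum f x} s \<partial>lborel)"
          unfolding T_def by (intro cum_pull_le f x) measurable
        also have "\<dots> = (\<integral>\<^sup>+s. dens h s * indicator {0..rcum f x} s +
            ennreal (l h) * indicator ({0..rcum f x} \<inter> Beyond) s \<partial>lborel)"
          by (intro nn_integral_cong) (auto simp: R_def indicator_def)
        also have "\<dots> = (\<integral>\<^sup>+s. dens h s * indicator {0..rcum f x} s \<partial>lborel) +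
            ennreal (l h) * emeasure lborel ({0..rcum f x} \<inter> Beyond)"
          by (subst nn_integral_add) (auto simp: nn_integral_cmult)
        also have "\<dots> \<le> ennreal (C * x)" by (rule l_bound[OF h C x])
        finally show "cum (T h) x \<le> ennreal (C * x)" .
      qed
    qed
  qed
qed

end

section \<open>From positive contractions to the Calderon property\<close>

definition eabs :: "('a \<Rightarrow> ereal) \<Rightarrow> 'a \<Rightarrow> ennreal" where
  "eabs f u = e2ennreal \<bar>f u\<bar>"

lemma measurable_eabs[measurable]:
  assumes [measurable]: "f \<in> borel_measurable M"
  shows "eabs f \<in> borel_measurable M"
  unfolding eabs_def[abs_def] by measurable

lemma e2ennreal_abs_scale: "e2ennreal \<bar>a * enn2ereal k\<bar> = e2ennreal \<bar>a\<bar> * k"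
proof -
  have "\<bar>a * b\<bar> = \<bar>a\<bar> * b" if "0 \<le> b" for b :: ereal
    using that by (cases a; cases b) (auto simp: abs_mult)
  then have "\<bar>a * enn2ereal k\<bar> = enn2ereal (e2ennreal \<bar>a\<bar>) * enn2ereal k"
    by (simp add: enn2ereal_e2ennreal)
  also have "\<dots> = enn2ereal (e2ennreal \<bar>a\<bar> * k)"
    by (rule times_ennreal.rep_eq[symmetric])
  finally show ?thesis by simp
qed

lemma enn2real_add3_eq:
  assumes "a + (b + c) = a' + (b' + c')"
    and fin: "a < \<infinity>" "b < \<infinity>" "c < \<infinity>" "a' < \<infinity>" "b' < \<infinity>" "c' < \<infinity>"
  shows "enn2real a + (enn2real b + enn2real c) = enn2real a' + (enn2real b' + enn2real c')"
proof -
  have "enn2real (a + (b + c)) = enn2real a + (enn2real b + enn2real c)"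
    "enn2real (a' + (b' + c')) = enn2real a' + (enn2real b' + enn2real c')"
    using fin by (simp_all add: enn2real_plus)
  with assms(1) show ?thesis by simp
qed

lemma e2ennreal_cmult:
  assumes c: "0 \<le> c"
  shows "e2ennreal (ereal c * x) = ennreal c * e2ennreal x"
proof (cases "0 \<le> x")
  case True
  then have "ereal c * x = enn2ereal (ennreal c * e2ennreal x)"
    using c by (simp add: times_ennreal.rep_eq enn2ereal_e2ennreal enn2ereal_ennreal)
  then show ?thesis by simp
next
  case False
  then have "ereal c * x \<le> 0"
    using c by (cases x) (auto simp: mult_nonneg_nonpos)
  then show ?thesis using False by (simp add: e2ennreal_neg)
qed

lemma e2ennreal_cmult_neg:
  assumes c: "c \<le> 0"
  shows "e2ennreal (ereal c * x) = ennreal (- c) * e2ennreal (- x)"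
proof -
  have "ereal c * x = ereal (- c) * - x"
    by (cases x) auto
  then show ?thesis using e2ennreal_cmult[of "- c" "- x"] c by simp
qed

lemma e2ennreal_add_le: "e2ennreal \<bar>a + b\<bar> \<le> e2ennreal \<bar>a\<bar> + e2ennreal \<bar>b\<bar>"
proof -
  have "\<bar>a + b\<bar> \<le> \<bar>a\<bar> + \<bar>b\<bar>"
    by (cases a; cases b) auto
  then have "e2ennreal \<bar>a + b\<bar> \<le> e2ennreal (\<bar>a\<bar> + \<bar>b\<bar>)"
    by (rule e2ennreal_mono)
  also have "\<dots> = e2ennreal \<bar>a\<bar> + e2ennreal \<bar>b\<bar>"
    by (cases a; cases b) (auto simp: e2ennreal_ereal ennreal_plus simp flip: ennreal_plus)
  finally show ?thesis .
qed

text \<open>An abstract form of the down norm: its balls are described by cumulative masses. This description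
  is where the ordered core enters.\<close>

locale down_couple = position +
  fixes N :: "('a \<Rightarrow> ereal) \<Rightarrow> ennreal"
  assumes N_le_iff: "\<And>f C. f \<in> borel_measurable M \<Longrightarrow> 0 \<le> C \<Longrightarrow>
    N f \<le> ennreal C \<longleftrightarrow> (\<forall>x\<in>\<Lambda>. cum (eabs f) x \<le> ennreal (C * x))"
begin

abbreviation "N\<^sub>0 \<equiv> L1_norm M"
abbreviation "X\<^sub>0 \<equiv> fun_space M N\<^sub>0"
abbreviation "X\<^sub>1 \<equiv> fun_space M N"
abbreviation "X \<equiv> sum_space M N\<^sub>0 N"

lemma L1_norm_eabs: "N\<^sub>0 f = (\<integral>\<^sup>+u. eabs f u \<partial>M)"
  by (simp add: L1_norm_def eabs_def)

lemma X1_bound: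
  assumes "f \<in> X\<^sub>1"
  obtains C where "0 \<le> C" "N f = ennreal C" "\<forall>x\<in>\<Lambda>. cum (eabs f) x \<le> ennreal (C * x)"
proof -
  have f: "f \<in> borel_measurable M" "N f < \<infinity>" using assms by (auto simp: fun_space_def)
  then have e: "N f = ennreal (enn2real (N f))" by simp
  then have "\<forall>x\<in>\<Lambda>. cum (eabs f) x \<le> ennreal (enn2real (N f) * x)"
    by (subst N_le_iff[symmetric]) (use f in auto)
  then show thesis using e by (intro that[of "enn2real (N f)"]) auto
qed

lemma zero_X1: "(\<lambda>u. 0) \<in> X\<^sub>1"
proof -
  have "N (\<lambda>u. 0) \<le> ennreal 0"
    by (subst N_le_iff) (auto simp: cum_def eabs_def e2ennreal_neg)
  then show ?thesis by (simp add: fun_space_def)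
qed

lemma zero_X0: "(\<lambda>u. 0) \<in> X\<^sub>0"
  by (simp add: fun_space_def L1_norm_def e2ennreal_neg)

lemma sum_spaceI:
  "h \<in> borel_measurable M \<Longrightarrow> f\<^sub>0 \<in> X\<^sub>0 \<Longrightarrow> f\<^sub>1 \<in> X\<^sub>1 \<Longrightarrow> AE u in M. h u = f\<^sub>0 u + f\<^sub>1 u \<Longrightarrow> h \<in> X"
  unfolding sum_space_def by blast

lemma X0_subset: "h \<in> X\<^sub>0 \<Longrightarrow> h \<in> X"
  by (rule sum_spaceI[OF _ _ zero_X1]) (auto simp: fun_space_def)

lemma X1_subset: "h \<in> X\<^sub>1 \<Longrightarrow> h \<in> X"
  by (rule sum_spaceI[OF _ zero_X0]) (auto simp: fun_space_def)

lemma X_meas: "h \<in> X \<Longrightarrow> h \<in> borel_measurable M"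
  by (simp add: sum_space_def)

lemma cum_eabs_le_split:
  assumes [measurable]: "f\<^sub>0 \<in> borel_measurable M" "f\<^sub>1 \<in> borel_measurable M"
    and eq: "AE u in M. h u = f\<^sub>0 u + f\<^sub>1 u"
  shows "cum (eabs h) x \<le> N\<^sub>0 f\<^sub>0 + cum (eabs f\<^sub>1) x"
proof -
  have "cum (eabs h) x = cum (eabs (\<lambda>u. f\<^sub>0 u + f\<^sub>1 u)) x"
    using eq by (intro cum_cong_AE, eventually_elim) (simp add: eabs_def)
  also have "\<dots> \<le> cum (\<lambda>u. eabs f\<^sub>0 u + eabs f\<^sub>1 u) x"
    by (intro cum_mono) (auto simp: eabs_def e2ennreal_add_le)
  also have "\<dots> = cum (eabs f\<^sub>0) x + cum (eabs f\<^sub>1) x"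
    by (intro cum_add) measurable
  also have "\<dots> \<le> N\<^sub>0 f\<^sub>0 + cum (eabs f\<^sub>1) x"
    unfolding L1_norm_eabs by (intro add_right_mono cum_le_integral)
  finally show ?thesis .
qed

lemma tempered_eabs: assumes "h \<in> X" shows "tempered (eabs h)"
proof -
  obtain f\<^sub>0 f\<^sub>1 where f: "f\<^sub>0 \<in> X\<^sub>0" "f\<^sub>1 \<in> X\<^sub>1" "AE u in M. h u = f\<^sub>0 u + f\<^sub>1 u"
    using assms by (auto simp: sum_space_def)
  obtain C where C: "0 \<le> C" "\<forall>x\<in>\<Lambda>. cum (eabs f\<^sub>1) x \<le> ennreal (C * x)"
    using X1_bound[OF f(2)] by metis
  define K where "K = enn2real (N\<^sub>0 f\<^sub>0)"
  have K: "N\<^sub>0 f\<^sub>0 = ennreal K" "0 \<le> K" using f(1) by (auto simp: K_def fun_space_def)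
  have "cum (eabs h) x \<le> ennreal ((K + C) + (K + C) * x)" if x: "x \<in> \<Lambda>" for x
  proof -
    have x0: "0 \<le> x" using x \<Lambda>_nonneg by auto
    have "cum (eabs h) x \<le> N\<^sub>0 f\<^sub>0 + cum (eabs f\<^sub>1) x"
      using f by (intro cum_eabs_le_split) (auto simp: fun_space_def)
    also have "\<dots> \<le> ennreal K + ennreal (C * x)"
      unfolding K using C(2) x by (intro add_left_mono) blast
    also have "\<dots> = ennreal (K + C * x)"
      using C(1) K(2) x0 by simp
    also have "\<dots> \<le> ennreal ((K + C) + (K + C) * x)"
      using C(1) K(2) x0 by (intro ennreal_leI) (simp add: algebra_simps)
    finally show ?thesis .
  qed
  moreover have "eabs h \<in> borel_measurable M"
    using X_meas[OF assms] by measurable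
  ultimately show ?thesis
    unfolding tempered_def using C(1) K(2) by (intro conjI exI[of _ "K + C"]) auto
qed

lemma cum_le_K_functional:
  assumes x: "x \<in> \<Lambda>" "0 < x"
  shows "cum (eabs h) x \<le> K_functional M N\<^sub>0 N h x"
  unfolding K_functional_def
proof (rule Inf_greatest, clarsimp)
  fix f\<^sub>0 f\<^sub>1 assume f: "f\<^sub>0 \<in> X\<^sub>0" "f\<^sub>1 \<in> X\<^sub>1" "AE u in M. h u = f\<^sub>0 u + f\<^sub>1 u"
  obtain C where C: "0 \<le> C" "N f\<^sub>1 = ennreal C" "\<forall>x\<in>\<Lambda>. cum (eabs f\<^sub>1) x \<le> ennreal (C * x)"
    using X1_bound[OF f(2)] by metis
  have "cum (eabs h) x \<le> N\<^sub>0 f\<^sub>0 + cum (eabs f\<^sub>1) x"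
    using f by (intro cum_eabs_le_split) (auto simp: fun_space_def)
  also have "\<dots> \<le> N\<^sub>0 f\<^sub>0 + ennreal x * N f\<^sub>1"
  proof (rule add_left_mono)
    have "ennreal x * N f\<^sub>1 = ennreal (C * x)"
      using C(1) x by (simp add: C(2) ennreal_mult mult.commute)
    then show "cum (eabs f\<^sub>1) x \<le> ennreal x * N f\<^sub>1" using C(3) x by simp
  qed
  finally show "cum (eabs h) x \<le> N\<^sub>0 f\<^sub>0 + ennreal x * N f\<^sub>1" .
qed

text \<open>The decomposition is the truncation at mass level \<open>b\<close>.\<close>

lemma K_functional_le:
  assumes h: "h \<in> X" and b: "0 \<le> b" "0 \<le> c" and maj: "\<And>y. y \<in> \<Lambda> \<Longrightarrow> rcum (eabs h) y \<le> b + c * y"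
    and t: "0 < t"
  shows "K_functional M N\<^sub>0 N h t \<le> ennreal (b + c * t)"
proof -
  note [measurable] = X_meas[OF h]
  obtain \<kappa> :: "'a \<Rightarrow> ennreal" where \<kappa>[measurable]: "\<kappa> \<in> borel_measurable M" and
    \<kappa>1: "\<And>u. u \<in> space M \<Longrightarrow> \<kappa> u \<le> 1" and
    I0: "(\<integral>\<^sup>+u. eabs h u * \<kappa> u \<partial>M) \<le> ennreal b" and
    I1: "\<And>x. x \<in> \<Lambda> \<Longrightarrow> cum (\<lambda>u. eabs h u * (1 - \<kappa> u)) x \<le> ennreal (c * x)"
    using truncation[OF tempered_eabs[OF h] b(1) maj] by blast
  define f\<^sub>0 where "f\<^sub>0 u = h u * enn2ereal (\<kappa> u)" for u
  define f\<^sub>1 where "f\<^sub>1 u = h u * enn2ereal (1 - \<kappa> u)" for u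
  have [measurable]: "f\<^sub>0 \<in> borel_measurable M" "f\<^sub>1 \<in> borel_measurable M"
    unfolding f\<^sub>0_def f\<^sub>1_def by measurable
  have scale: "eabs (\<lambda>u. h u * enn2ereal (k u)) = (\<lambda>u. eabs h u * k u)" for k :: "'a \<Rightarrow> ennreal"
    by (simp add: fun_eq_iff eabs_def e2ennreal_abs_scale)
  have e0: "eabs f\<^sub>0 = (\<lambda>u. eabs h u * \<kappa> u)" and e1: "eabs f\<^sub>1 = (\<lambda>u. eabs h u * (1 - \<kappa> u))"
    unfolding f\<^sub>0_def[abs_def] f\<^sub>1_def[abs_def] by (rule scale)+
  have N0: "N\<^sub>0 f\<^sub>0 \<le> ennreal b"
    using I0 by (simp add: L1_norm_eabs e0)
  have N1: "N f\<^sub>1 \<le> ennreal c"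
    by (subst N_le_iff) (use I1 b in \<open>auto simp: e1\<close>)
  have "f\<^sub>0 \<in> X\<^sub>0" "f\<^sub>1 \<in> X\<^sub>1"
    using N0 N1 by (auto simp: fun_space_def intro: le_less_trans)
  moreover have "AE u in M. h u = f\<^sub>0 u + f\<^sub>1 u"
  proof (rule AE_I2)
    fix u assume u: "u \<in> space M"
    have "\<kappa> u + (1 - \<kappa> u) = 1"
      using diff_add_cancel_ennreal[OF \<kappa>1[OF u]] by (metis add.commute)
    then have "enn2ereal (\<kappa> u) + enn2ereal (1 - \<kappa> u) = 1"
      by (metis one_ennreal.rep_eq plus_ennreal.rep_eq)
    moreover have "h u * (enn2ereal (\<kappa> u) + enn2ereal (1 - \<kappa> u)) = f\<^sub>0 u + f\<^sub>1 u"
      unfolding f\<^sub>0_def f\<^sub>1_def by (intro ereal_right_distrib) auto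
    ultimately show "h u = f\<^sub>0 u + f\<^sub>1 u" by simp
  qed
  ultimately have "K_functional M N\<^sub>0 N h t \<le> N\<^sub>0 f\<^sub>0 + ennreal t * N f\<^sub>1"
    unfolding K_functional_def by (intro Inf_lower) auto
  also have "\<dots> \<le> ennreal b + ennreal t * ennreal c"
    using N0 N1 by (intro add_mono mult_left_mono) auto
  also have "\<dots> = ennreal (b + c * t)"
    using b t by (simp add: ennreal_mult mult.commute)
  finally show ?thesis .
qed

text \<open>A line \<open>b + c x\<close> above the cumulative mass of \<open>|g|\<close> bounds \<open>K(g,x)\<close>, hence \<open>K(f,x)\<close>, which in turn
  bounds the cumulative mass of \<open>|f|\<close> at \<open>x\<close>.\<close>

lemma source_targetI:
  assumes f: "f \<in> X" and g: "g \<in> X"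
    and K: "\<And>t. 0 < t \<Longrightarrow> K_functional M N\<^sub>0 N f t \<le> K_functional M N\<^sub>0 N g t"
  shows "source_target M p \<Lambda> (eabs f) (eabs g)"
proof
  show "tempered (eabs f)" "tempered (eabs g)"
    using f g by (auto intro: tempered_eabs)
  fix b c x assume c: "0 \<le> c" and maj: "\<And>y. y \<in> \<Lambda> \<Longrightarrow> rcum (eabs g) y \<le> b + c * y" and x: "x \<in> \<Lambda>"
  have b: "0 \<le> b"
    using maj[OF zero_\<Lambda>] rcum_0[OF tempered_eabs[OF g]] by simp
  show "rcum (eabs f) x \<le> b + c * x"
  proof (cases "x = 0")
    case True
    then show ?thesis using rcum_0[OF tempered_eabs[OF f]] b by simp
  next
    case False
    then have x0: "0 < x" using x \<Lambda>_nonneg by force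
    have "ennreal (rcum (eabs f) x) = cum (eabs f) x"
      by (rule ennreal_rcum[OF tempered_eabs[OF f]])
    also have "\<dots> \<le> K_functional M N\<^sub>0 N f x" by (rule cum_le_K_functional[OF x x0])
    also have "\<dots> \<le> K_functional M N\<^sub>0 N g x" by (rule K[OF x0])
    also have "\<dots> \<le> ennreal (b + c * x)" by (rule K_functional_le[OF g b c maj x0])
    finally show ?thesis using b c x0 by (subst (asm) ennreal_le_iff) auto
  qed
qed

lemma tempered_mono:
  assumes "tempered h" "h' \<in> borel_measurable M" "\<And>u. u \<in> space M \<Longrightarrow> h' u \<le> h u"
  shows "tempered h'"
proof -
  have "cum h' x \<le> cum h x" for x using assms(3) by (intro cum_mono) auto
  then show ?thesis
    using assms(1,2) unfolding tempered_def by (meson order_trans)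
qed

text \<open>A tempered function is an \<open>L\<^sup>1\<close> function plus one of finite down norm, both nonnegative, and the two
  parts are controlled by the two contraction properties.\<close>

lemma tempered_image:
  assumes T: "positive_contraction T" and h: "tempered h"
  shows "tempered (T h)"
proof -
  note h_meas[measurable] = tempered_meas[OF h]
  obtain K where K: "0 \<le> K" "\<And>x. 0 \<le> x \<Longrightarrow> cum h x \<le> ennreal (K + K * x)"
    using tempered_bound[OF h] by metis
  have "rcum h x \<le> K + K * x" if "x \<in> \<Lambda>" for x
  proof -
    have x: "0 \<le> x" using that \<Lambda>_nonneg by auto
    then have "ennreal (rcum h x) \<le> ennreal (K + K * x)"
      using K(2) by (simp add: ennreal_rcum[OF h])
    then show ?thesis using K(1) x by (subst (asm) ennreal_le_iff) auto
  qed
  then obtain \<kappa> :: "'a \<Rightarrow> ennreal" where \<kappa>[measurable]: "\<kappa> \<in> borel_measurable M" and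
    \<kappa>1: "\<And>u. u \<in> space M \<Longrightarrow> \<kappa> u \<le> 1" and
    I0: "(\<integral>\<^sup>+u. h u * \<kappa> u \<partial>M) \<le> ennreal K" and
    I1: "\<And>x. x \<in> \<Lambda> \<Longrightarrow> cum (\<lambda>u. h u * (1 - \<kappa> u)) x \<le> ennreal (K * x)"
    using truncation[OF h K(1), of K] by blast
  let ?a = "\<lambda>u. h u * \<kappa> u" and ?b = "\<lambda>u. h u * (1 - \<kappa> u)"
  have split: "?a u + ?b u = h u" if "u \<in> space M" for u
    using diff_add_cancel_ennreal[OF \<kappa>1[OF that]] by (metis add.commute distrib_left mult.right_neutral)
  have le: "?a u \<le> h u" "?b u \<le> h u" if "u \<in> space M" for u
    using mult_left_mono[OF \<kappa>1[OF that], of "h u"]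
      mult_left_mono[OF diff_le_self_ennreal[of 1 "\<kappa> u"], of "h u"] by auto
  have ab: "tempered ?a" "tempered ?b"
    by (rule tempered_mono[OF h], use le in auto)+
  have T_ab[measurable]: "T ?a \<in> borel_measurable M" "T ?b \<in> borel_measurable M" "T h \<in> borel_measurable M"
    using T ab h by (simp_all add: positive_contraction_def)
  have "AE u in M. T (\<lambda>u. ?a u + ?b u) u = T ?a u + T ?b u"
    using T ab unfolding positive_contraction_def by blast
  moreover have "AE u in M. T h u = T (\<lambda>u. ?a u + ?b u) u"
  proof -
    have "AE u in M. h u = ?a u + ?b u" using split by (intro AE_I2) simp
    then show ?thesis
      using T h tempered_add[OF ab] by (simp add: positive_contraction_def)
  qed
  ultimately have eq: "AE u in M. T h u = T ?a u + T ?b u"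
    by eventually_elim simp
  have "cum (T h) x \<le> ennreal (K + K * x)" if x: "x \<in> \<Lambda>" for x
  proof -
    have x0: "0 \<le> x" using x \<Lambda>_nonneg by auto
    have "cum (T h) x = cum (\<lambda>u. T ?a u + T ?b u) x" using eq by (rule cum_cong_AE)
    also have "\<dots> = cum (T ?a) x + cum (T ?b) x" by (intro cum_add) measurable
    also have "\<dots> \<le> ennreal K + ennreal (K * x)"
    proof (rule add_mono)
      have "cum (T ?a) x \<le> (\<integral>\<^sup>+u. T ?a u \<partial>M)" by (rule cum_le_integral)
      also have "\<dots> \<le> (\<integral>\<^sup>+u. ?a u \<partial>M)"
        using T ab by (simp add: positive_contraction_def)
      finally show "cum (T ?a) x \<le> ennreal K" using I0 by simp
      have "\<forall>x\<in>\<Lambda>. cum (T ?b) x \<le> ennreal (K * x)"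
        using T ab I1 K(1) by (simp add: positive_contraction_def)
      then show "cum (T ?b) x \<le> ennreal (K * x)" using x by blast
    qed
    also have "\<dots> = ennreal (K + K * x)" using K(1) x0 by simp
    finally show ?thesis .
  qed
  then show ?thesis
    unfolding tempered_def using K(1) T_ab by blast
qed

text \<open>Multiplication by the sign of \<open>g\<close> turns \<open>g\<close> into \<open>|g|\<close>; the operator acts on positive and negative
  parts, and the sign of \<open>f\<close> is restored afterwards. The values are real, so that no sums of
  opposite infinities occur.\<close>

definition signed_extension ::
  "('a \<Rightarrow> ereal) \<Rightarrow> ('a \<Rightarrow> ereal) \<Rightarrow> (('a \<Rightarrow> ennreal) \<Rightarrow> 'a \<Rightarrow> ennreal) \<Rightarrow> ('a \<Rightarrow> ereal) \<Rightarrow> 'a \<Rightarrow> ereal" where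
  "signed_extension f g T h u =
     ereal ((if f u < 0 then -1 else 1) *
       (enn2real (T (\<lambda>v. e2ennreal (if g v < 0 then - h v else h v)) u) -
        enn2real (T (\<lambda>v. e2ennreal (if g v < 0 then h v else - h v)) u)))"

end

locale signed_operator = down_couple +
  fixes f g :: "'a \<Rightarrow> ereal" and T :: "('a \<Rightarrow> ennreal) \<Rightarrow> 'a \<Rightarrow> ennreal"
  assumes f_meas[measurable]: "f \<in> borel_measurable M" and g_meas[measurable]: "g \<in> borel_measurable M"
    and T: "positive_contraction T"
begin

abbreviation "S \<equiv> signed_extension f g T"

definition up :: "('a \<Rightarrow> ereal) \<Rightarrow> 'a \<Rightarrow> ennreal" where
  "up h v = e2ennreal (if g v < 0 then - h v else h v)"

definition dn :: "('a \<Rightarrow> ereal) \<Rightarrow> 'a \<Rightarrow> ennreal" where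
  "dn h v = e2ennreal (if g v < 0 then h v else - h v)"

definition sgn_f :: "'a \<Rightarrow> real" where
  "sgn_f u = (if f u < 0 then -1 else 1)"

lemma S_eq: "S h u = ereal (sgn_f u * (enn2real (T (up h) u) - enn2real (T (dn h) u)))"
  by (simp add: signed_extension_def up_def[abs_def] dn_def[abs_def] sgn_f_def)

lemma measurable_up_dn[measurable]:
  assumes [measurable]: "h \<in> borel_measurable M"
  shows "up h \<in> borel_measurable M" "dn h \<in> borel_measurable M"
  unfolding up_def[abs_def] dn_def[abs_def] by measurable

lemma sgn_f_meas[measurable]: "sgn_f \<in> borel_measurable M"
  unfolding sgn_f_def[abs_def] by measurable

lemma up_dn: "up h u + dn h u = eabs h u"
  unfolding up_def dn_def eabs_def
  by (cases "0 \<le> h u") (auto simp: e2ennreal_neg)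

lemma tempered_up_dn:
  assumes "h \<in> X" shows "tempered (up h)" "tempered (dn h)"
  using X_meas[OF assms] up_dn[of h]
  by (auto intro!: tempered_mono[OF tempered_eabs[OF assms]] simp flip: up_dn)

lemma T_meas: "tempered h \<Longrightarrow> T h \<in> borel_measurable M"
  and T_cong: "tempered h \<Longrightarrow> tempered h' \<Longrightarrow> AE u in M. h u = h' u \<Longrightarrow> AE u in M. T h u = T h' u"
  and T_add: "tempered h \<Longrightarrow> tempered h' \<Longrightarrow> AE u in M. T (\<lambda>u. h u + h' u) u = T h u + T h' u"
  and T_cmult: "tempered h \<Longrightarrow> AE u in M. T (\<lambda>u. ennreal c * h u) u = ennreal c * T h u"
  and T_L1: "tempered h \<Longrightarrow> (\<integral>\<^sup>+u. T h u \<partial>M) \<le> (\<integral>\<^sup>+u. h u \<partial>M)"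
  and T_down: "tempered h \<Longrightarrow> 0 \<le> C \<Longrightarrow> \<forall>x\<in>\<Lambda>. cum h x \<le> ennreal (C * x) \<Longrightarrow>
    \<forall>x\<in>\<Lambda>. cum (T h) x \<le> ennreal (C * x)"
  using T unfolding positive_contraction_def by simp_all

lemma T_finite: "tempered h \<Longrightarrow> AE u in M. T h u < \<infinity>"
  by (rule AE_tempered_finite[OF tempered_image[OF T]])

lemma S_meas: assumes "h \<in> X" shows "S h \<in> borel_measurable M"
proof -
  note [measurable] = T_meas[OF tempered_up_dn(1)[OF assms]] T_meas[OF tempered_up_dn(2)[OF assms]]
  show ?thesis unfolding S_eq[abs_def] by measurable
qed

lemma eabs_S_le:
  assumes h: "h \<in> X"
  shows "AE u in M. eabs (S h) u \<le> T (eabs h) u"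
proof -
  note t = tempered_up_dn[OF h]
  have "AE u in M. T (eabs h) u = T (up h) u + T (dn h) u"
    using T_add[OF t] by (simp add: up_dn)
  then show ?thesis
    using T_finite[OF t(1)] T_finite[OF t(2)]
  proof eventually_elim
    case (elim u)
    have "\<bar>enn2real (T (up h) u) - enn2real (T (dn h) u)\<bar> \<le> enn2real (T (up h) u) + enn2real (T (dn h) u)"
      using enn2real_nonneg[of "T (up h) u"] enn2real_nonneg[of "T (dn h) u"] by linarith
    then have "ennreal \<bar>enn2real (T (up h) u) - enn2real (T (dn h) u)\<bar> \<le>
        ennreal (enn2real (T (up h) u) + enn2real (T (dn h) u))"
      by (rule ennreal_leI)
    also have "ennreal \<bar>enn2real (T (up h) u) - enn2real (T (dn h) u)\<bar> = eabs (S h) u"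
      by (simp add: eabs_def S_eq sgn_f_def abs_minus_commute)
    also have "ennreal (enn2real (T (up h) u) + enn2real (T (dn h) u)) = T (eabs h) u"
      using elim by simp
    finally show ?case .
  qed
qed

lemma S_cong:
  assumes h: "h \<in> X" "h' \<in> X" and eq: "AE u in M. h u = h' u"
  shows "AE u in M. S h u = S h' u"
proof -
  have "AE u in M. up h u = up h' u" "AE u in M. dn h u = dn h' u"
    using eq by (eventually_elim, simp add: up_def dn_def)+
  then have "AE u in M. T (up h) u = T (up h') u" "AE u in M. T (dn h) u = T (dn h') u"
    using tempered_up_dn[OF h(1)] tempered_up_dn[OF h(2)] by (simp_all add: T_cong)
  then show ?thesis by eventually_elim (simp add: S_eq)
qed

lemma sum_space_add:
  assumes h: "h \<in> X" "h' \<in> X"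
  shows "(\<lambda>u. h u + h' u) \<in> X"
proof -
  obtain a b where a: "a \<in> X\<^sub>0" "b \<in> X\<^sub>1" "AE u in M. h u = a u + b u"
    using h(1) by (auto simp: sum_space_def)
  obtain a' b' where a': "a' \<in> X\<^sub>0" "b' \<in> X\<^sub>1" "AE u in M. h' u = a' u + b' u"
    using h(2) by (auto simp: sum_space_def)
  have [measurable]: "a \<in> borel_measurable M" "a' \<in> borel_measurable M"
    "b \<in> borel_measurable M" "b' \<in> borel_measurable M"
    using a a' by (auto simp: fun_space_def)
  show ?thesis
  proof (rule sum_spaceI)
    show "(\<lambda>u. h u + h' u) \<in> borel_measurable M"
      using h[THEN X_meas] by measurable
    have "N\<^sub>0 (\<lambda>u. a u + a' u) \<le> N\<^sub>0 a + N\<^sub>0 a'"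
      unfolding L1_norm_eabs
      by (subst nn_integral_add[symmetric]) (auto simp: eabs_def intro!: nn_integral_mono e2ennreal_add_le)
    also have "\<dots> < \<infinity>" using a(1) a'(1) by (simp add: fun_space_def)
    finally show "(\<lambda>u. a u + a' u) \<in> X\<^sub>0" by (simp add: fun_space_def)
    obtain C where C: "0 \<le> C" "\<forall>x\<in>\<Lambda>. cum (eabs b) x \<le> ennreal (C * x)"
      using X1_bound[OF a(2)] by metis
    obtain C' where C': "0 \<le> C'" "\<forall>x\<in>\<Lambda>. cum (eabs b') x \<le> ennreal (C' * x)"
      using X1_bound[OF a'(2)] by metis
    have "N (\<lambda>u. b u + b' u) \<le> ennreal (C + C')"
    proof (subst N_le_iff, measurable)
      show "0 \<le> C + C'" using C C' by simp
      show "\<forall>x\<in>\<Lambda>. cum (eabs (\<lambda>u. b u + b' u)) x \<le> ennreal ((C + C') * x)"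
      proof
        fix x assume x: "x \<in> \<Lambda>"
        then have x0: "0 \<le> x" using \<Lambda>_nonneg by auto
        have "cum (eabs (\<lambda>u. b u + b' u)) x \<le> cum (\<lambda>u. eabs b u + eabs b' u) x"
          by (intro cum_mono) (auto simp: eabs_def e2ennreal_add_le)
        also have "\<dots> = cum (eabs b) x + cum (eabs b') x" by (intro cum_add) measurable
        also have "\<dots> \<le> ennreal (C * x) + ennreal (C' * x)"
          using C(2) C'(2) x by (intro add_mono) auto
        also have "\<dots> = ennreal ((C + C') * x)"
          using C C' x0 by (simp add: distrib_right)
        finally show "cum (eabs (\<lambda>u. b u + b' u)) x \<le> ennreal ((C + C') * x)" .
      qed
    qed
    then show "(\<lambda>u. b u + b' u) \<in> X\<^sub>1" by (auto simp: fun_space_def intro: le_less_trans)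
    show "AE u in M. h u + h' u = (a u + a' u) + (b u + b' u)"
      using a(3) a'(3) by eventually_elim (simp add: add_ac)
  qed
qed

lemma AE_finite: assumes "h \<in> X" shows "AE u in M. \<bar>h u\<bar> \<noteq> \<infinity>"
  using AE_tempered_finite[OF tempered_eabs[OF assms]]
  by eventually_elim (auto simp: eabs_def)

text \<open>With \<open>k = h + h'\<close>, the identity \<open>k\<^sup>+ + h\<^sup>- + h'\<^sup>- = k\<^sup>- + h\<^sup>+ + h'\<^sup>+\<close> avoids subtraction and is
  respected by the additive operator on nonnegative functions.\<close>

lemma S_add:
  assumes h: "h \<in> X" "h' \<in> X"
  shows "AE u in M. S (\<lambda>u. h u + h' u) u = S h u + S h' u"
proof -
  let ?k = "\<lambda>u. h u + h' u"
  note t = tempered_up_dn[OF h(1)] and t' = tempered_up_dn[OF h(2)]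
    and tk = tempered_up_dn[OF sum_space_add[OF h]]
  let ?l = "\<lambda>u. up ?k u + (dn h u + dn h' u)" and ?r = "\<lambda>u. dn ?k u + (up h u + up h' u)"
  have "AE u in M. ?l u = ?r u"
    using AE_finite[OF h(1)] AE_finite[OF h(2)]
  proof eventually_elim
    case (elim u)
    obtain a b where ab: "h u = ereal a" "h' u = ereal b"
      using elim by (auto elim!: ereal_infinity_cases)
    have "ennreal (a + b) + (ennreal (- a) + ennreal (- b)) = ennreal (- (a + b)) + (ennreal a + ennreal b)" for a b
      by (cases "0 \<le> a"; cases "0 \<le> b"; cases "0 \<le> a + b")
        (auto simp: ennreal_neg ennreal_plus[symmetric] simp del: ennreal_plus)
    from this[of a b] this[of "- a" "- b"] show ?case
      by (auto simp: up_def dn_def ab algebra_simps)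
  qed
  then have "AE u in M. T ?l u = T ?r u"
    by (intro T_cong tempered_add tk t t')
  then show ?thesis
    using T_add[OF tk(1) tempered_add[OF t(2) t'(2)]] T_add[OF tk(2) tempered_add[OF t(1) t'(1)]]
      T_add[OF t(2) t'(2)] T_add[OF t(1) t'(1)] T_finite[OF t(1)] T_finite[OF t(2)]
      T_finite[OF t'(1)] T_finite[OF t'(2)] T_finite[OF tk(1)] T_finite[OF tk(2)]
  proof eventually_elim
    case (elim u)
    have "T (up ?k) u + (T (dn h) u + T (dn h') u) = T (dn ?k) u + (T (up h) u + T (up h') u)"
      using elim by simp
    then have "enn2real (T (up ?k) u) + (enn2real (T (dn h) u) + enn2real (T (dn h') u)) =
        enn2real (T (dn ?k) u) + (enn2real (T (up h) u) + enn2real (T (up h') u))"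
      using elim(6-11) by (intro enn2real_add3_eq) auto
    then have "enn2real (T (up ?k) u) - enn2real (T (dn ?k) u) =
        (enn2real (T (up h) u) - enn2real (T (dn h) u)) + (enn2real (T (up h') u) - enn2real (T (dn h') u))"
      by simp
    then show ?case by (simp add: S_eq distrib_left)
  qed
qed

lemma S_cmult:
  assumes h: "h \<in> X"
  shows "AE u in M. S (\<lambda>u. ereal c * h u) u = ereal c * S h u"
proof -
  note t = tempered_up_dn[OF h]
  show ?thesis
  proof (cases "0 \<le> c")
    case True
    have "up (\<lambda>u. ereal c * h u) = (\<lambda>u. ennreal c * up h u)"
      "dn (\<lambda>u. ereal c * h u) = (\<lambda>u. ennreal c * dn h u)"
      using e2ennreal_cmult[OF True] by (auto simp: up_def dn_def fun_eq_iff simp flip: ereal_mult_minus_right)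
    then show ?thesis
      using T_cmult[OF t(1), of c] T_cmult[OF t(2), of c]
      by (auto elim!: eventually_elim2 simp: S_eq enn2real_mult True right_diff_distrib mult_ac)
  next
    case False
    then have "c \<le> 0" by simp
    then have "up (\<lambda>u. ereal c * h u) = (\<lambda>u. ennreal (- c) * dn h u)"
      "dn (\<lambda>u. ereal c * h u) = (\<lambda>u. ennreal (- c) * up h u)"
      using e2ennreal_cmult_neg by (auto simp: up_def dn_def fun_eq_iff simp flip: ereal_mult_minus_right)
    then show ?thesis
      using T_cmult[OF t(1), of "- c"] T_cmult[OF t(2), of "- c"] False
      by (auto elim!: eventually_elim2 simp: S_eq enn2real_mult right_diff_distrib mult_ac)
  qed
qed

lemma S_X0: assumes h: "h \<in> X\<^sub>0" shows "S h \<in> X\<^sub>0 \<and> N\<^sub>0 (S h) \<le> N\<^sub>0 h"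
proof -
  have hX: "h \<in> X" using h by (rule X0_subset)
  have "N\<^sub>0 (S h) \<le> (\<integral>\<^sup>+u. T (eabs h) u \<partial>M)"
    unfolding L1_norm_eabs by (intro nn_integral_mono_AE eabs_S_le hX)
  also have "\<dots> \<le> N\<^sub>0 h"
    unfolding L1_norm_eabs by (intro T_L1 tempered_eabs hX)
  finally show ?thesis
    using h S_meas[OF hX] by (auto simp: fun_space_def)
qed

lemma S_X1: assumes h: "h \<in> X\<^sub>1" shows "S h \<in> X\<^sub>1 \<and> N (S h) \<le> N h"
proof -
  have hX: "h \<in> X" using h by (rule X1_subset)
  obtain C where C: "0 \<le> C" "N h = ennreal C" "\<forall>x\<in>\<Lambda>. cum (eabs h) x \<le> ennreal (C * x)"
    using X1_bound[OF h] by metis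
  have "cum (eabs (S h)) x \<le> cum (T (eabs h)) x" for x
    unfolding cum_def using eabs_S_le[OF hX]
    by (intro nn_integral_mono_AE, eventually_elim) (auto intro: mult_right_mono)
  then have "\<forall>x\<in>\<Lambda>. cum (eabs (S h)) x \<le> ennreal (C * x)"
    using T_down[OF tempered_eabs[OF hX] C(1,3)] by (meson order_trans)
  then have "N (S h) \<le> N h"
    unfolding C(2) by (subst N_le_iff) (use C S_meas[OF hX] in auto)
  then show ?thesis
    using h S_meas[OF hX] by (auto simp: fun_space_def)
qed

lemma S_X: assumes h: "h \<in> X" shows "S h \<in> X"
proof -
  obtain a b where a: "a \<in> X\<^sub>0" "b \<in> X\<^sub>1" "AE u in M. h u = a u + b u"
    using h by (auto simp: sum_space_def)
  note aX = X0_subset[OF a(1)] and bX = X1_subset[OF a(2)]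
  have "AE u in M. S h u = S (\<lambda>u. a u + b u) u"
    by (intro S_cong h sum_space_add aX bX a)
  then have "AE u in M. S h u = S a u + S b u"
    using S_add[OF aX bX] by eventually_elim simp
  then show ?thesis
    using S_X0[OF a(1)] S_X1[OF a(2)] S_meas[OF h] by (intro sum_spaceI) auto
qed

theorem admissible: "admissible_contraction M N\<^sub>0 N S"
  unfolding admissible_contraction_def
  using S_X S_cong S_add S_cmult S_X0 S_X1 by (intro conjI ballI allI impI) auto

lemma S_g:
  assumes g: "g \<in> X" and f: "f \<in> X" and Tg: "AE u in M. T (eabs g) u = eabs f u"
  shows "AE u in M. S g u = f u"
proof -
  have "up g = eabs g" by (auto simp: up_def eabs_def fun_eq_iff)
  moreover have "dn g = (\<lambda>u. ennreal 0 * eabs g u)"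
    by (auto simp: dn_def eabs_def fun_eq_iff e2ennreal_neg)
  ultimately show ?thesis
    using Tg T_cmult[OF tempered_eabs[OF g], of 0] AE_finite[OF f]
  proof (elim AE_mp, intro AE_I2 impI)
    fix u assume eqs: "up g = eabs g" "dn g = (\<lambda>u. ennreal 0 * eabs g u)"
      and u: "T (eabs g) u = eabs f u" "T (\<lambda>u. ennreal 0 * eabs g u) u = ennreal 0 * T (eabs g) u"
      "\<bar>f u\<bar> \<noteq> \<infinity>"
    show "S g u = f u"
      using u by (cases "f u") (auto simp: S_eq eqs sgn_f_def eabs_def)
  qed
qed

end

context down_couple
begin

theorem exact_Calderon: "exact_Calderon_couple M N\<^sub>0 N"
  unfolding exact_Calderon_couple_def
proof (intro ballI impI)
  fix f g assume fX: "f \<in> X" and gX: "g \<in> X"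
    and K: "\<forall>t>0. K_functional M N\<^sub>0 N f t \<le> K_functional M N\<^sub>0 N g t"
  interpret source_target M p \<Lambda> "eabs f" "eabs g"
    using fX gX K by (intro source_targetI) auto
  obtain T where PT: "positive_contraction T" "AE u in M. T (eabs g) u = eabs f u"
    by (rule positive_contraction_exists)
  interpret signed_operator M p \<Lambda> N f g T
    using X_meas[OF fX] X_meas[OF gX] PT(1) by unfold_locales
  show "\<exists>S. admissible_contraction M N\<^sub>0 N S \<and> (AE u in M. S g u = f u)"
    using admissible S_g[OF gX fX PT(2)] by blast
qed

end

section \<open>Position map of an ordered core\<close>

text \<open>Inequalities between two measures on superlevel sets pass to integrals by writing
  \<open>\<phi>(u)\<close> as the integral over \<open>s > 0\<close> of the indicator of \<open>s < \<phi>(u)\<close>.\<close>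

lemma nn_integral_layer_cake_le:
  fixes h \<phi> :: "'a \<Rightarrow> ennreal"
  assumes "sigma_finite_measure M"
    and [measurable]: "h \<in> borel_measurable M" "\<phi> \<in> borel_measurable M"
    and le: "\<And>s. 0 < s \<Longrightarrow> emeasure (density M h) {u \<in> space M. ennreal s < \<phi> u} \<le>
      C * emeasure M {u \<in> space M. ennreal s < \<phi> u}"
  shows "(\<integral>\<^sup>+u. h u * \<phi> u \<partial>M) \<le> C * (\<integral>\<^sup>+u. \<phi> u \<partial>M)"
proof -
  interpret sigma_finite_measure M by fact
  interpret pair_sigma_finite M lborel ..
  let ?L = "\<lambda>s u. indicator {s. 0 < s \<and> ennreal s < \<phi> u} s :: ennreal"
  have cake: "\<phi> u = (\<integral>\<^sup>+s. ?L s u \<partial>lborel)" for u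
  proof (cases "\<phi> u")
    case (real r)
    then have "{s. 0 < s \<and> ennreal s < \<phi> u} = {0<..<r}"
      by (auto simp: ennreal_less_iff)
    then show ?thesis using real by simp
  next
    case top
    then have "{s. 0 < s \<and> ennreal s < \<phi> u} = {0<..}" by auto
    moreover have "emeasure lborel {0::real<..} = top"
    proof (rule ccontr)
      assume "emeasure lborel {0::real<..} \<noteq> top"
      then obtain n where n: "emeasure lborel {0::real<..} < of_nat n"
        using ennreal_Ex_less_of_nat top.not_eq_extremum by auto
      have "emeasure lborel {0<..<real n} \<le> emeasure lborel {0::real<..}"
        by (intro emeasure_mono) auto
      with n show False by (simp add: ennreal_of_nat_eq_real_of_nat)
    qed
    ultimately show ?thesis using top by simp
  qed
  have swap: "(\<integral>\<^sup>+u. k u * \<phi> u \<partial>M) = (\<integral>\<^sup>+s. (\<integral>\<^sup>+u. k u * ?L s u \<partial>M) \<partial>lborel)"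
    if [measurable]: "k \<in> borel_measurable M" for k
  proof -
    have "(\<integral>\<^sup>+u. k u * \<phi> u \<partial>M) = (\<integral>\<^sup>+u. (\<integral>\<^sup>+s. k u * ?L s u \<partial>lborel) \<partial>M)"
      by (intro nn_integral_cong) (subst cake, subst nn_integral_cmult, auto)
    also have "\<dots> = (\<integral>\<^sup>+s. (\<integral>\<^sup>+u. k u * ?L s u \<partial>M) \<partial>lborel)"
      by (rule Fubini'[symmetric]) measurable
    finally show ?thesis .
  qed
  have "(\<integral>\<^sup>+u. h u * \<phi> u \<partial>M) = (\<integral>\<^sup>+s. (\<integral>\<^sup>+u. h u * ?L s u \<partial>M) \<partial>lborel)"
    by (rule swap) measurable
  also have "\<dots> \<le> (\<integral>\<^sup>+s. C * (\<integral>\<^sup>+u. 1 * ?L s u \<partial>M) \<partial>lborel)"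
  proof (rule nn_integral_mono)
    fix s :: real
    show "(\<integral>\<^sup>+u. h u * ?L s u \<partial>M) \<le> C * (\<integral>\<^sup>+u. 1 * ?L s u \<partial>M)"
    proof (cases "0 < s")
      case True
      have "(\<integral>\<^sup>+u. h u * ?L s u \<partial>M) = (\<integral>\<^sup>+u. h u * indicator {u \<in> space M. ennreal s < \<phi> u} u \<partial>M)"
        using True by (intro nn_integral_cong) (auto simp: indicator_def)
      also have "\<dots> = emeasure (density M h) {u \<in> space M. ennreal s < \<phi> u}"
        by (subst emeasure_density) auto
      also have "\<dots> \<le> C * emeasure M {u \<in> space M. ennreal s < \<phi> u}" by (rule le[OF True])
      also have "emeasure M {u \<in> space M. ennreal s < \<phi> u} =
          (\<integral>\<^sup>+u. indicator {u \<in> space M. ennreal s < \<phi> u} u \<partial>M)" by simp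
      also have "\<dots> = (\<integral>\<^sup>+u. 1 * ?L s u \<partial>M)"
        using True by (intro nn_integral_cong) (auto simp: indicator_def)
      finally show ?thesis .
    qed simp
  qed
  also have "\<dots> = C * (\<integral>\<^sup>+s. (\<integral>\<^sup>+u. 1 * ?L s u \<partial>M) \<partial>lborel)"
    by (intro nn_integral_cmult) measurable
  also have "(\<integral>\<^sup>+s. (\<integral>\<^sup>+u. 1 * ?L s u \<partial>M) \<partial>lborel) = (\<integral>\<^sup>+u. 1 * \<phi> u \<partial>M)"
    by (rule swap[symmetric]) simp
  finally show ?thesis by simp
qed

lemma sigma_sets_countably_determined:
  assumes "D \<in> sigma_sets \<Omega> \<A>" "\<A> \<subseteq> Pow \<Omega>"
  shows "\<exists>\<C>\<subseteq>\<A>. countable \<C> \<and>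
    (\<forall>u\<in>\<Omega>. \<forall>v\<in>\<Omega>. (\<forall>C\<in>\<C>. u \<in> C \<longleftrightarrow> v \<in> C) \<longrightarrow> (u \<in> D \<longleftrightarrow> v \<in> D))"
  using assms(1)
proof induction
  case (Basic A)
  then show ?case by (intro exI[of _ "{A}"]) auto
next
  case Empty
  show ?case by (intro exI[of _ "{}"]) auto
next
  case (Compl A)
  then show ?case by auto
next
  case (Union A)
  then obtain \<C> where C: "\<And>i. \<C> i \<subseteq> \<A>" "\<And>i. countable (\<C> i)"
    "\<And>i. \<forall>u\<in>\<Omega>. \<forall>v\<in>\<Omega>. (\<forall>C\<in>\<C> i. u \<in> C \<longleftrightarrow> v \<in> C) \<longrightarrow> (u \<in> A i \<longleftrightarrow> v \<in> A i)"
    by metis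
  show ?case
  proof (intro exI[of _ "\<Union>i. \<C> i"] conjI ballI impI)
    fix u v assume u: "u \<in> \<Omega>" "v \<in> \<Omega>" and *: "\<forall>C\<in>\<Union>i. \<C> i. u \<in> C \<longleftrightarrow> v \<in> C"
    have "u \<in> A i \<longleftrightarrow> v \<in> A i" for i
    proof -
      have "\<forall>C\<in>\<C> i. u \<in> C \<longleftrightarrow> v \<in> C" using * by simp
      then show ?thesis using C(3)[of i, THEN bspec, OF u(1), THEN bspec, OF u(2)] by (rule rev_mp)
    qed
    then show "u \<in> (\<Union>i. A i) \<longleftrightarrow> v \<in> (\<Union>i. A i)" by simp
  next
    show "(\<Union>i. \<C> i) \<subseteq> \<A>" using C(1) by (intro UN_least)
    show "countable (\<Union>i. \<C> i)" using C(2) by (intro countable_UN) auto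
  qed
qed

locale full_core = sigma_finite_measure M for M :: "'a measure" +
  fixes \<A> :: "'a set set"
  assumes core: "full_ordered_core M \<A>"
begin

lemma core_sets: "A \<in> \<A> \<Longrightarrow> A \<in> sets M"
  and core_chain: "A \<in> \<A> \<Longrightarrow> B \<in> \<A> \<Longrightarrow> A \<subseteq> B \<or> B \<subseteq> A"
  and core_empty: "{} \<in> \<A>"
  and core_Union: "\<Union>\<A> = space M"
  using core by (auto simp: full_ordered_core_def ordered_core_def)

lemma core_measure: "A \<in> \<A> \<Longrightarrow> emeasure M A = ennreal (measure M A)"
  using core by (intro emeasure_eq_ennreal_measure) (auto simp: full_ordered_core_def ordered_core_def)

lemma core_Pow: "\<A> \<subseteq> Pow (space M)"
  using core_Union by auto

lemma sigma_core_subset: "sets (sigma (space M) \<A>) \<subseteq> sets M"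
proof -
  have "\<A> \<subseteq> sets M" using core_sets by auto
  then show ?thesis using sets.sigma_sets_subset core_Pow by simp
qed

lemma finite_Union_core:
  assumes "finite \<C>" "\<C> \<noteq> {}" "\<C> \<subseteq> \<A>"
  shows "\<Union>\<C> \<in> \<C> \<and> \<Inter>\<C> \<in> \<C>"
  using assms
proof (induction rule: finite_ne_induct)
  case (insert A \<C>)
  then have "\<Union>\<C> \<in> \<C>" "\<Inter>\<C> \<in> \<C>" "A \<in> \<A>" "\<C> \<subseteq> \<A>" by auto
  moreover from this have "\<Union>\<C> \<in> \<A>" "\<Inter>\<C> \<in> \<A>" by (simp_all only: subsetD)
  ultimately have "A \<union> \<Union>\<C> = A \<or> A \<union> \<Union>\<C> = \<Union>\<C>" "A \<inter> \<Inter>\<C> = A \<or> A \<inter> \<Inter>\<C> = \<Inter>\<C>"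
    using core_chain by (metis Un_absorb1 Un_absorb2, metis Int_absorb1 Int_absorb2)
  then show ?case
    using \<open>\<Union>\<C> \<in> \<C>\<close> \<open>\<Inter>\<C> \<in> \<C>\<close> unfolding Union_insert Inter_insert by (metis insertCI)
qed simp

lemma countable_Union_core_le:
  assumes \<C>: "\<C> \<subseteq> \<A>" "countable \<C>" and sets: "sets \<nu> = sets M"
    and le: "\<And>A. A \<in> \<C> \<Longrightarrow> emeasure \<nu> A \<le> K"
  shows "emeasure \<nu> (\<Union>\<C>) \<le> K"
proof (cases "\<C> = {}")
  case False
  define E where "E n = \<Union>(from_nat_into \<C> ` {..n})" for n
  have E: "E n \<in> \<C>" for n
  proof -
    have sub: "from_nat_into \<C> ` {..n} \<subseteq> \<C>" using from_nat_into[OF False] by auto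
    have "E n \<in> from_nat_into \<C> ` {..n}"
      using finite_Union_core[OF _ _ subset_trans[OF sub \<C>(1)]] unfolding E_def by simp
    with sub show ?thesis by (rule subsetD)
  qed
  have "\<Union>\<C> = (\<Union>n. from_nat_into \<C> n)"
    using range_from_nat_into[OF False \<C>(2)] by simp
  also have "\<dots> = (\<Union>n. E n)" unfolding E_def by blast
  also have "emeasure \<nu> \<dots> = (SUP n. emeasure \<nu> (E n))"
  proof (rule SUP_emeasure_incseq[symmetric])
    show "range E \<subseteq> sets \<nu>" using E \<C>(1) core_sets sets by auto
    show "incseq E"
      unfolding incseq_def E_def by (intro allI impI Union_mono image_mono) simp
  qed
  also have "\<dots> \<le> K" using E le by (intro SUP_least) auto
  finally show ?thesis .
qed simp

lemma countable_Inter_core_le: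
  assumes \<C>: "\<C> \<subseteq> \<A>" "countable \<C>" "\<C> \<noteq> {}" and sets: "sets \<nu> = sets M"
    and le: "\<And>A. A \<in> \<A> \<Longrightarrow> emeasure \<nu> A \<le> ennreal C * emeasure M A"
  shows "emeasure \<nu> (\<Inter>\<C>) \<le> ennreal C * emeasure M (\<Inter>\<C>)"
proof -
  define E where "E n = \<Inter>(from_nat_into \<C> ` {..n})" for n
  have E: "E n \<in> \<C>" for n
  proof -
    have sub: "from_nat_into \<C> ` {..n} \<subseteq> \<C>" using from_nat_into[OF \<C>(3)] by auto
    have "E n \<in> from_nat_into \<C> ` {..n}"
      using finite_Union_core[OF _ _ subset_trans[OF sub \<C>(1)]] unfolding E_def by simp
    with sub show ?thesis by (rule subsetD)
  qed
  then have EA: "E n \<in> \<A>" for n using \<C>(1) by auto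
  have "\<Inter>\<C> = (\<Inter>n. from_nat_into \<C> n)"
    using range_from_nat_into[OF \<C>(3,2)] by simp
  also have "\<dots> = (\<Inter>n. E n)" unfolding E_def by blast
  finally have eq: "\<Inter>\<C> = (\<Inter>n. E n)" .
  have lim: "(\<lambda>n. ennreal C * emeasure M (E n)) \<longlonglongrightarrow> ennreal C * emeasure M (\<Inter>\<C>)"
    unfolding eq
  proof (intro ennreal_tendsto_cmult Lim_emeasure_decseq)
    show "range E \<subseteq> sets M" using EA core_sets by auto
    show "decseq E"
      unfolding decseq_def E_def by (intro allI impI Inter_anti_mono image_mono) simp
    show "emeasure M (E i) \<noteq> \<infinity>" for i using core_measure[OF EA] by simp
  qed simp
  show ?thesis
  proof (rule LIMSEQ_le_const[OF lim], intro exI allI impI)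
    fix n
    have "emeasure \<nu> (\<Inter>\<C>) \<le> emeasure \<nu> (E n)"
      using EA core_sets sets unfolding eq by (intro emeasure_mono) auto
    also have "\<dots> \<le> ennreal C * emeasure M (E n)" by (rule le[OF EA])
    finally show "emeasure \<nu> (\<Inter>\<C>) \<le> ennreal C * emeasure M (E n)" .
  qed
qed

text \<open>A down-set that is measurable over the core is comparable with every member of the core. It is
  determined by a countable subfamily \<open>\<C>\<close>, and therefore it is the union of the members of \<open>\<C>\<close>
  inside it, or the intersection of those containing it, or the whole space. The bound on the
  core passes to such monotone limits.\<close>

lemma down_set_le:
  assumes D: "D \<in> sets (sigma (space M) \<A>)"
    and down: "\<And>u v. u \<in> space M \<Longrightarrow> v \<in> D \<Longrightarrow> core_le \<A> u v \<Longrightarrow> u \<in> D"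
    and sets: "sets \<nu> = sets M"
    and le: "\<And>A. A \<in> \<A> \<Longrightarrow> emeasure \<nu> A \<le> ennreal C * emeasure M A"
  shows "emeasure \<nu> D \<le> ennreal C * emeasure M D"
proof -
  have D': "D \<in> sigma_sets (space M) \<A>" using D core_Pow by simp
  obtain \<C> where \<C>: "\<C> \<subseteq> \<A>" "countable \<C>" and
    det: "\<And>u v. u \<in> space M \<Longrightarrow> v \<in> space M \<Longrightarrow> (\<forall>C\<in>\<C>. u \<in> C \<longleftrightarrow> v \<in> C) \<Longrightarrow> u \<in> D \<longleftrightarrow> v \<in> D"
    using sigma_sets_countably_determined[OF D' core_Pow] by metis
  have "D \<in> sets M" using D sigma_core_subset by (rule rev_subsetD)
  then have DM: "D \<in> sets M" "D \<subseteq> space M" using sets.sets_into_space by simp_all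
  have comparable: "A \<subseteq> D \<or> D \<subseteq> A" if A: "A \<in> \<A>" for A
  proof (rule ccontr)
    assume "\<not> ?thesis"
    then obtain u v where uv: "u \<in> A" "u \<notin> D" "v \<in> D" "v \<notin> A" by auto
    have "core_le \<A> u v"
      unfolding core_le_def using core_chain[OF A] uv by blast
    moreover have "u \<in> space M" using uv(1) A core_Union by auto
    ultimately show False using down uv by blast
  qed
  have union: "emeasure \<nu> (\<Union>\<B>) \<le> ennreal C * emeasure M D" if "\<B> \<subseteq> \<A>" "countable \<B>" "\<Union>\<B> = D" for \<B>
  proof (rule countable_Union_core_le[OF that(1,2) sets])
    fix A assume A: "A \<in> \<B>"
    then have "emeasure \<nu> A \<le> ennreal C * emeasure M A" using that(1) by (intro le) auto
    also have "\<dots> \<le> ennreal C * emeasure M D"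
      using A that(3) DM by (intro mult_left_mono emeasure_mono) auto
    finally show "emeasure \<nu> A \<le> ennreal C * emeasure M D" .
  qed
  define \<C>\<^sub>1 where "\<C>\<^sub>1 = {A \<in> \<C>. A \<subseteq> D}"
  define \<C>\<^sub>2 where "\<C>\<^sub>2 = {A \<in> \<C>. \<not> A \<subseteq> D}"
  have sub1: "\<Union>\<C>\<^sub>1 \<subseteq> D" by (auto simp: \<C>\<^sub>1_def)
  have sub2: "D \<subseteq> A" if "A \<in> \<C>\<^sub>2" for A
    using comparable[of A] that \<C>(1) by (auto simp: \<C>\<^sub>2_def)
  show ?thesis
  proof (cases "D = \<Union>\<C>\<^sub>1")
    case True
    have "\<C>\<^sub>1 \<subseteq> \<A>" "countable \<C>\<^sub>1" using \<C> by (auto simp: \<C>\<^sub>1_def)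
    from union[OF this True[symmetric]] True show ?thesis by simp
  next
    case False
    then obtain w where w: "w \<in> D" "w \<notin> \<Union>\<C>\<^sub>1" using sub1 by auto
    have D_eq: "v \<in> D" if v: "v \<in> space M" "\<And>A. A \<in> \<C>\<^sub>2 \<Longrightarrow> v \<in> A" for v
    proof (cases "v \<in> \<Union>\<C>\<^sub>1")
      case False
      have iff: "\<forall>A\<in>\<C>. v \<in> A \<longleftrightarrow> w \<in> A"
      proof
        fix A assume A: "A \<in> \<C>"
        show "v \<in> A \<longleftrightarrow> w \<in> A"
        proof (cases "A \<subseteq> D")
          case True
          then have "A \<in> \<C>\<^sub>1" using A by (simp add: \<C>\<^sub>1_def)
          then show ?thesis using False w(2) by blast
        next
          case notsub: False
          then have "A \<in> \<C>\<^sub>2" using A by (simp add: \<C>\<^sub>2_def)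
          then show ?thesis using v(2) sub2 w(1) by blast
        qed
      qed
      have "w \<in> space M" using w(1) DM(2) by (rule rev_subsetD)
      from det[OF v(1) this iff] show ?thesis using w(1) by simp
    qed (use sub1 in auto)
    show ?thesis
    proof (cases "\<C>\<^sub>2 = {}")
      case True
      then have "D = space M" using D_eq DM(2) by auto
      moreover obtain \<A>\<^sub>0 where "\<A>\<^sub>0 \<subseteq> \<A>" "countable \<A>\<^sub>0" "\<Union>\<A>\<^sub>0 = space M"
        using core unfolding full_ordered_core_def sigma_bounded_def by metis
      ultimately show ?thesis using union[of \<A>\<^sub>0] by simp
    next
      case False
      have sub: "\<C>\<^sub>2 \<subseteq> \<A>" "countable \<C>\<^sub>2" using \<C> by (auto simp: \<C>\<^sub>2_def)
      have "\<Inter>\<C>\<^sub>2 \<subseteq> space M" using False sub(1) core_Pow by blast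
      then have "D = \<Inter>\<C>\<^sub>2" using D_eq sub2 by blast
      then show ?thesis using countable_Inter_core_le[OF sub False sets le] by simp
    qed
  qed
qed

end

text \<open>A countable part of the core whose measures are dense among the measures of core members. The
  infimum of measures over the full core could fail to be measurable when the core is uncountable.\<close>

locale core_skeleton = full_core +
  fixes \<D> :: "'a set set"
  assumes skeleton: "\<D> \<subseteq> \<A>" and countable_skeleton: "countable \<D>" and empty_skeleton: "{} \<in> \<D>"
    and Union_skeleton: "\<Union>\<D> = space M"
    and dense_skeleton: "\<And>A e. A \<in> \<A> \<Longrightarrow> 0 < e \<Longrightarrow> \<exists>B\<in>\<D>. \<bar>measure M B - measure M A\<bar> < e"

lemma (in full_core) skeleton_exists: "\<exists>\<D>. core_skeleton M \<A> \<D>"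
proof -
  obtain \<A>\<^sub>0 where A0: "\<A>\<^sub>0 \<subseteq> \<A>" "countable \<A>\<^sub>0" "\<Union>\<A>\<^sub>0 = space M"
    using core unfolding full_ordered_core_def sigma_bounded_def by metis
  obtain R where R: "countable R" "R \<subseteq> measure M ` \<A>" "measure M ` \<A> \<subseteq> closure R"
    using separable by metis
  then obtain \<B> where B: "\<B> \<subseteq> \<A>" "countable \<B>" "measure M ` \<B> = R"
    using countable_subset_image[of R "measure M" \<A>] by metis
  show ?thesis
  proof (intro exI[of _ "insert {} (\<A>\<^sub>0 \<union> \<B>)"] core_skeleton.intro full_core_axioms core_skeleton_axioms.intro)
    fix A e assume A: "A \<in> \<A>" and e: "(0::real) < e"
    then have "measure M A \<in> closure R" using R(3) by auto
    then obtain r where "r \<in> R" "dist r (measure M A) < e"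
      using e by (meson closure_approachable)
    then show "\<exists>B\<in>insert {} (\<A>\<^sub>0 \<union> \<B>). \<bar>measure M B - measure M A\<bar> < e"
      using B(3) by (auto simp: dist_real_def)
  next
    show "\<Union> (insert {} (\<A>\<^sub>0 \<union> \<B>)) = space M"
      using A0(3) B(1) core_Pow by auto
  qed (use A0 B core_empty in auto)
qed

context core_skeleton
begin

definition pos :: "'a \<Rightarrow> real" where
  "pos u = Inf (measure M ` {A \<in> \<D>. u \<in> A})"

definition levels :: "real set" where
  "levels = closure (measure M ` \<D>)"

lemma pos_less_iff:
  assumes "u \<in> space M" shows "pos u < x \<longleftrightarrow> (\<exists>A\<in>\<D>. u \<in> A \<and> measure M A < x)"
proof -
  have "{A \<in> \<D>. u \<in> A} \<noteq> {}" using assms Union_skeleton by auto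
  moreover have "bdd_below (measure M ` {A \<in> \<D>. u \<in> A})"
    by (intro bdd_belowI[of _ 0]) (auto simp: measure_nonneg)
  ultimately show ?thesis unfolding pos_def by (subst cInf_less_iff) auto
qed

lemma pos_le: "A \<in> \<D> \<Longrightarrow> u \<in> A \<Longrightarrow> pos u \<le> measure M A"
  unfolding pos_def by (intro cInf_lower bdd_belowI[of _ 0]) (auto simp: measure_nonneg)

lemma pos_in_levels:
  assumes "u \<in> space M" shows "pos u \<in> levels"
proof -
  have "{A \<in> \<D>. u \<in> A} \<noteq> {}" using assms Union_skeleton by auto
  then have "pos u \<in> closure (measure M ` {A \<in> \<D>. u \<in> A})"
    unfolding pos_def by (intro closure_contains_Inf bdd_belowI[of _ 0]) (auto simp: measure_nonneg)
  also have "\<dots> \<subseteq> levels" unfolding levels_def by (intro closure_mono) auto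
  finally show ?thesis .
qed

lemma skeleton_space: "A \<in> \<D> \<Longrightarrow> u \<in> A \<Longrightarrow> u \<in> space M"
  using Union_skeleton by blast

lemma pos_less_set: "{u \<in> space M. pos u < x} = \<Union>{A \<in> \<D>. measure M A < x}"
proof (intro set_eqI iffI)
  fix u assume "u \<in> \<Union>{A \<in> \<D>. measure M A < x}"
  then obtain A where A: "A \<in> \<D>" "u \<in> A" "measure M A < x" by auto
  then show "u \<in> {u \<in> space M. pos u < x}"
    using pos_less_iff[of u x] skeleton_space[OF A(1,2)] by auto
qed (auto simp: pos_less_iff)

lemma pos_antimono: "u \<in> space M \<Longrightarrow> v \<in> space M \<Longrightarrow> core_le \<A> u v \<Longrightarrow> pos u \<le> pos v"
  unfolding core_le_def using skeleton pos_less_iff[of v] pos_less_iff[of u]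
  by (meson linorder_not_less less_irrefl subsetD)

lemma measurable_pos_core: "pos \<in> borel_measurable (sigma (space M) \<A>)"
proof (rule borel_measurableI_less)
  fix x
  have "{u \<in> space M. pos u < x} = (\<Union>A\<in>{A \<in> \<D>. measure M A < x}. A)"
    by (simp add: pos_less_set)
  also have "\<dots> \<in> sets (sigma (space M) \<A>)"
    using countable_skeleton skeleton core_Pow by (intro sets.countable_UN') auto
  finally show "{u \<in> space (sigma (space M) \<A>). pos u < x} \<in> sets (sigma (space M) \<A>)"
    using core_Pow by simp
qed

lemma measurable_pos[measurable]: "pos \<in> borel_measurable M"
  using measurable_pos_core sigma_core_subset core_Pow
  by (auto simp: measurable_def)

lemma levels_props: "closed levels" "0 \<in> levels" "levels \<subseteq> {0..}"
proof -
  show "closed levels" by (simp add: levels_def)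
  have "0 \<in> measure M ` \<D>" using empty_skeleton by force
  then show "0 \<in> levels" unfolding levels_def by (rule subsetD[OF closure_subset])
  show "levels \<subseteq> {0..}"
    unfolding levels_def by (intro closure_minimal) (auto simp: measure_nonneg)
qed

lemma measure_in_levels: "A \<in> \<D> \<Longrightarrow> measure M A \<in> levels"
  unfolding levels_def by (intro subsetD[OF closure_subset]) auto

lemma levels_approx: "x \<in> levels \<Longrightarrow> 0 < e \<Longrightarrow> \<exists>B\<in>\<D>. \<bar>measure M B - x\<bar> < e"
  unfolding levels_def closure_approachable by (auto simp: dist_real_def)

lemma core_measure_in_levels: "A \<in> \<A> \<Longrightarrow> measure M A \<in> levels"
  unfolding levels_def closure_approachable using dense_skeleton by (auto simp: dist_real_def)

lemma emeasure_pos_less: "0 \<le> x \<Longrightarrow> emeasure M {u \<in> space M. pos u < x} \<le> ennreal x"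
proof -
  assume x: "0 \<le> x"
  have "emeasure M (\<Union>{A \<in> \<D>. measure M A < x}) \<le> ennreal x"
    using skeleton countable_skeleton
    by (intro countable_Union_core_le) (auto simp: core_measure subset_iff intro!: ennreal_leI)
  then show ?thesis by (simp add: pos_less_set)
qed

text \<open>The set \<open>{pos \<le> x}\<close> is the decreasing limit of \<open>{pos \<le> x + 1/n}\<close>; each of these contains a
  skeleton member of measure close to \<open>x\<close>, and \<open>{pos < y}\<close> is a union of a chain of sets of measure
  below \<open>y\<close>.\<close>

lemma emeasure_pos_le:
  assumes x: "x \<in> levels"
  shows "emeasure M {u \<in> space M. pos u \<le> x} = ennreal x"
proof (rule antisym)
  have x0: "0 \<le> x" using x levels_props by auto
  show "emeasure M {u \<in> space M. pos u \<le> x} \<le> ennreal x"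
  proof (rule ennreal_le_epsilon)
    fix e :: real assume e: "0 < e"
    have "emeasure M {u \<in> space M. pos u \<le> x} \<le> emeasure M {u \<in> space M. pos u < x + e}"
      using e by (intro emeasure_mono) auto
    also have "\<dots> \<le> ennreal (x + e)" using e x0 by (intro emeasure_pos_less) auto
    also have "\<dots> = ennreal x + ennreal e" using e x0 by simp
    finally show "emeasure M {u \<in> space M. pos u \<le> x} \<le> ennreal x + ennreal e" .
  qed
  define E where "E n = {u \<in> space M. pos u \<le> x + 1 / real (Suc n)}" for n
  have lower: "ennreal x \<le> emeasure M (E n)" for n
  proof (rule ennreal_le_epsilon)
    fix e :: real assume e: "0 < e"
    obtain B where B: "B \<in> \<D>" "\<bar>measure M B - x\<bar> < min e (1 / real (Suc n))"
      using levels_approx[OF x, of "min e (1 / real (Suc n))"] e by auto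
    have "B \<subseteq> E n"
      using pos_le[OF B(1)] B skeleton core_Pow by (force simp: E_def)
    then have "emeasure M B \<le> emeasure M (E n)"
      by (intro emeasure_mono) (auto simp: E_def)
    then have "ennreal (measure M B) \<le> emeasure M (E n)"
      using core_measure[of B] B(1) skeleton by auto
    moreover have "ennreal x \<le> ennreal (measure M B + e)"
      using B(2) by (intro ennreal_leI) auto
    then have "ennreal x \<le> ennreal (measure M B) + ennreal e"
      using e by (simp add: measure_nonneg)
    ultimately show "ennreal x \<le> emeasure M (E n) + ennreal e"
      by (meson add_right_mono order_trans)
  qed
  have "(\<lambda>n. emeasure M (E n)) \<longlonglongrightarrow> emeasure M (\<Inter>n. E n)"
  proof (rule Lim_emeasure_decseq)
    show "decseq E"
      unfolding decseq_def E_def by (auto intro: order_trans simp: frac_le)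
    show "emeasure M (E i) \<noteq> \<infinity>" for i
    proof -
      have "1 / real (Suc i) < 2" by (simp add: divide_simps)
      then have "emeasure M (E i) \<le> emeasure M {u \<in> space M. pos u < x + 2}"
        unfolding E_def by (intro emeasure_mono) auto
      also have "\<dots> \<le> ennreal (x + 2)" using x0 by (intro emeasure_pos_less) auto
      finally show ?thesis by (auto simp: top_unique)
    qed
  qed (auto simp: E_def)
  then have "ennreal x \<le> emeasure M (\<Inter>n. E n)"
    using lower by (intro LIMSEQ_le_const) auto
  also have "(\<Inter>n. E n) \<subseteq> {u \<in> space M. pos u \<le> x}"
  proof safe
    fix u assume u: "u \<in> (\<Inter>n. E n)"
    show "u \<in> space M" using u by (auto simp: E_def)
    show "pos u \<le> x"
    proof (rule ccontr)
      assume "\<not> pos u \<le> x"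
      then obtain n where "1 / real (Suc n) < pos u - x"
        using reals_Archimedean[of "pos u - x"] by (auto simp: inverse_eq_divide)
      moreover have "pos u \<le> x + 1 / real (Suc n)" using u by (auto simp: E_def)
      ultimately show False by simp
    qed
  qed
  then have "emeasure M (\<Inter>n. E n) \<le> emeasure M {u \<in> space M. pos u \<le> x}"
    by (intro emeasure_mono) auto
  finally show "ennreal x \<le> emeasure M {u \<in> space M. pos u \<le> x}" .
qed

sublocale position M pos levels
  using levels_props pos_in_levels emeasure_pos_le by unfold_locales auto

lemma cum_density:
  assumes [measurable]: "h \<in> borel_measurable M"
  shows "cum h x = emeasure (density M h) {u \<in> space M. pos u \<le> x}"
  unfolding cum_def by (subst emeasure_density) (auto intro!: nn_integral_cong simp: indicator_def)

text \<open>Passing from skeleton members to an arbitrary core member \<open>A\<close>: either skeleton members of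
  almost the same measure contain \<open>A\<close>, or those of nearby measure are contained in \<open>A\<close> and exhaust it up
  to a null set.\<close>

lemma core_density_le:
  assumes [measurable]: "h \<in> borel_measurable M" and C: "0 \<le> C"
    and le: "\<And>x. x \<in> levels \<Longrightarrow> cum h x \<le> ennreal (C * x)" and A: "A \<in> \<A>"
  shows "emeasure (density M h) A \<le> ennreal C * emeasure M A"
proof -
  let ?\<nu> = "density M h" and ?x = "measure M A"
  have AM: "A \<in> sets M" using core_sets[OF A] .
  have skel: "emeasure ?\<nu> B \<le> ennreal (C * measure M B)" if B: "B \<in> \<D>" for B
  proof -
    have "emeasure ?\<nu> B \<le> cum h (measure M B)"
      unfolding cum_density[OF assms(1)] using pos_le[OF B] B skeleton core_Pow
      by (intro emeasure_mono) auto
    then show ?thesis using le[OF measure_in_levels[OF B]] by simp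
  qed
  have "emeasure ?\<nu> A \<le> ennreal (C * ?x)"
  proof (cases "\<forall>e>0. \<exists>B\<in>\<D>. A \<subseteq> B \<and> measure M B < ?x + e")
    case True
    show ?thesis
    proof (rule ennreal_le_epsilon)
      fix e :: real assume e: "0 < e"
      define d where "d = e / (C + 1)"
      have d: "0 < d" "C * d \<le> e" using e C by (auto simp: d_def divide_simps)
      obtain B where B: "B \<in> \<D>" "A \<subseteq> B" "measure M B < ?x + d" using True d by blast
      have "emeasure ?\<nu> A \<le> emeasure ?\<nu> B"
        using B skeleton core_sets by (intro emeasure_mono) auto
      also have "\<dots> \<le> ennreal (C * measure M B)" by (rule skel[OF B(1)])
      also have "\<dots> \<le> ennreal (C * (?x + d))"
        using B(3) C by (intro ennreal_leI mult_left_mono) auto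
      also have "\<dots> \<le> ennreal (C * ?x + e)"
        using d(2) by (intro ennreal_leI) (simp add: distrib_left)
      also have "\<dots> = ennreal (C * ?x) + ennreal e"
        using C e by (intro ennreal_plus) (auto simp: measure_nonneg)
      finally show "emeasure ?\<nu> A \<le> ennreal (C * ?x) + ennreal e" .
    qed
  next
    case False
    then obtain e\<^sub>0 where e0: "0 < e\<^sub>0" "\<And>B. B \<in> \<D> \<Longrightarrow> A \<subseteq> B \<Longrightarrow> ?x + e\<^sub>0 \<le> measure M B"
      by (auto simp: not_less)
    let ?P = "{u \<in> space M. pos u \<le> ?x}"
    have small: "emeasure M (A - ?P) \<le> 0 + ennreal e" if e: "0 < e" for e
    proof -
      obtain B where B: "B \<in> \<D>" "\<bar>measure M B - ?x\<bar> < min e e\<^sub>0"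
        using dense_skeleton[OF A, of "min e e\<^sub>0"] e e0(1) by auto
      have BA: "B \<in> \<A>" using B skeleton by auto
      have "\<not> A \<subseteq> B" using e0(2)[OF B(1)] B(2) by auto
      then have sub: "B \<subseteq> A" using core_chain[OF A BA] by auto
      have "ennreal (measure M B) \<le> ennreal ?x"
        using emeasure_mono[OF sub AM] core_measure A BA by simp
      then have Bx: "measure M B \<le> ?x" by (simp add: ennreal_le_iff measure_nonneg)
      have "B \<subseteq> ?P" using pos_le[OF B(1)] Bx BA core_Pow by force
      then have "emeasure M (A - ?P) \<le> emeasure M (A - B)"
        using AM core_sets[OF BA] by (intro emeasure_mono) auto
      also have "\<dots> = ennreal ?x - ennreal (measure M B)"
        using AM core_sets[OF BA] sub core_measure[OF A] core_measure[OF BA]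
        by (subst emeasure_Diff) auto
      also have "\<dots> \<le> ennreal e"
        unfolding ennreal_minus[OF measure_nonneg] using B(2) by (intro ennreal_leI) linarith
      finally show ?thesis by simp
    qed
    have "emeasure M (A - ?P) \<le> 0" by (rule ennreal_le_epsilon) (rule small)
    then have "A - ?P \<in> null_sets M" using AM by (intro null_setsI) auto
    then have "A - ?P \<in> null_sets ?\<nu>"
      using absolutely_continuousI_density[of h M] by (auto simp: absolutely_continuous_def)
    then have null: "emeasure ?\<nu> (A - ?P) = 0" by auto
    have "emeasure ?\<nu> A \<le> emeasure ?\<nu> (?P \<union> (A - ?P))"
      using AM by (intro emeasure_mono) auto
    also have "\<dots> \<le> emeasure ?\<nu> ?P + emeasure ?\<nu> (A - ?P)"
      using AM by (intro emeasure_subadditive) auto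
    also have "\<dots> = cum h ?x" by (simp add: null cum_density)
    also have "\<dots> \<le> ennreal (C * ?x)" by (rule le[OF core_measure_in_levels[OF A]])
    finally show ?thesis .
  qed
  also have "\<dots> = ennreal C * emeasure M A"
    using C by (simp add: core_measure[OF A] ennreal_mult measure_nonneg)
  finally show ?thesis .
qed

text \<open>Testing with the normalised indicator of \<open>{pos \<le> x}\<close> gives one direction. For the other, the
  superlevel sets of a core decreasing function are down-sets measurable over the core.\<close>

lemma Linf_down_norm_le_iff:
  assumes f[measurable]: "f \<in> borel_measurable M" and C: "0 \<le> C"
  shows "Linf_down_norm M \<A> f \<le> ennreal C \<longleftrightarrow> (\<forall>x\<in>levels. cum (eabs f) x \<le> ennreal (C * x))"
proof
  assume le: "Linf_down_norm M \<A> f \<le> ennreal C"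
  show "\<forall>x\<in>levels. cum (eabs f) x \<le> ennreal (C * x)"
  proof
    fix x assume x: "x \<in> levels"
    show "cum (eabs f) x \<le> ennreal (C * x)"
    proof (cases "x = 0")
      case True
      then show ?thesis by (simp add: cum_0)
    next
      case False
      then have x0: "0 < x" using x levels_props by force
      define \<phi> where "\<phi> u = ennreal (1 / x) * indicator {..x} (pos u)" for u
      note measurable_pos_core[measurable]
      have "\<phi> \<in> borel_measurable (sigma (space M) \<A>)"
        unfolding \<phi>_def[abs_def] by measurable
      moreover have "\<phi> v \<le> \<phi> u" if "u \<in> space M" "v \<in> space M" "core_le \<A> u v" for u v
        using pos_antimono[OF that] by (auto simp: \<phi>_def indicator_def)
      ultimately have \<phi>: "\<phi> \<in> core_decreasing M \<A>" by (auto simp: core_decreasing_def)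
      have "(\<integral>\<^sup>+u. \<phi> u \<partial>M) = ennreal (1 / x) * (\<integral>\<^sup>+u. indicator {u \<in> space M. pos u \<le> x} u \<partial>M)"
        unfolding \<phi>_def by (subst nn_integral_cmult[symmetric])
          (auto intro!: nn_integral_cong simp: indicator_def)
      also have "\<dots> = ennreal (1 / x) * ennreal x"
        by (simp add: emeasure_pos_le[OF x])
      also have "\<dots> = 1" using x0 by (simp flip: ennreal_mult)
      finally have "(\<integral>\<^sup>+u. e2ennreal \<bar>f u\<bar> * \<phi> u \<partial>M) \<le> Linf_down_norm M \<A> f"
        unfolding Linf_down_norm_def using \<phi> by (intro SUP_upper) auto
      also have "(\<integral>\<^sup>+u. e2ennreal \<bar>f u\<bar> * \<phi> u \<partial>M) = ennreal (1 / x) * cum (eabs f) x"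
        unfolding cum_def by (subst nn_integral_cmult[symmetric])
          (auto intro!: nn_integral_cong simp: \<phi>_def eabs_def mult_ac)
      finally have "ennreal (1 / x) * cum (eabs f) x \<le> ennreal C" using le by simp
      then have "ennreal x * (ennreal (1 / x) * cum (eabs f) x) \<le> ennreal x * ennreal C"
        by (rule mult_left_mono) simp
      moreover have "ennreal x * (ennreal (1 / x) * cum (eabs f) x) = cum (eabs f) x"
        using x0 by (simp flip: mult.assoc ennreal_mult)
      moreover have "ennreal x * ennreal C = ennreal (C * x)"
        using x0 C by (simp add: mult.commute flip: ennreal_mult)
      ultimately show ?thesis by simp
    qed
  qed
next
  assume le: "\<forall>x\<in>levels. cum (eabs f) x \<le> ennreal (C * x)"
  show "Linf_down_norm M \<A> f \<le> ennreal C"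
    unfolding Linf_down_norm_def
  proof (rule SUP_least, clarify)
    fix \<phi> assume \<phi>: "\<phi> \<in> core_decreasing M \<A>" and int: "(\<integral>\<^sup>+u. \<phi> u \<partial>M) \<le> 1"
    have \<phi>_core: "\<phi> \<in> borel_measurable (sigma (space M) \<A>)"
      and \<phi>_down: "\<And>u v. u \<in> space M \<Longrightarrow> v \<in> space M \<Longrightarrow> core_le \<A> u v \<Longrightarrow> \<phi> v \<le> \<phi> u"
      using \<phi> by (auto simp: core_decreasing_def)
    have [measurable]: "\<phi> \<in> borel_measurable M"
      using \<phi>_core sigma_core_subset core_Pow by (auto simp: measurable_def)
    have "(\<integral>\<^sup>+u. eabs f u * \<phi> u \<partial>M) \<le> ennreal C * (\<integral>\<^sup>+u. \<phi> u \<partial>M)"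
    proof (rule nn_integral_layer_cake_le[OF sigma_finite_measure_axioms])
      fix s :: real
      have meas: "{u \<in> space (sigma (space M) \<A>). ennreal s < \<phi> u} \<in> sets (sigma (space M) \<A>)"
        using \<phi>_core by measurable
      show "emeasure (density M (eabs f)) {u \<in> space M. ennreal s < \<phi> u} \<le>
          ennreal C * emeasure M {u \<in> space M. ennreal s < \<phi> u}"
      proof (rule down_set_le)
        show "{u \<in> space M. ennreal s < \<phi> u} \<in> sets (sigma (space M) \<A>)"
          using meas core_Pow by simp
        show "u \<in> {u \<in> space M. ennreal s < \<phi> u}"
          if "u \<in> space M" "v \<in> {u \<in> space M. ennreal s < \<phi> u}" "core_le \<A> u v" for u v
          using that \<phi>_down[of u v] by auto
        show "emeasure (density M (eabs f)) A \<le> ennreal C * emeasure M A" if "A \<in> \<A>" for A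
          using that le by (intro core_density_le C) auto
      qed simp
    qed auto
    also have "\<dots> \<le> ennreal C * 1" using int by (rule mult_left_mono) simp
    finally show "(\<integral>\<^sup>+u. e2ennreal \<bar>f u\<bar> * \<phi> u \<partial>M) \<le> ennreal C" by (simp add: eabs_def)
  qed
qed

sublocale down_couple M pos levels "Linf_down_norm M \<A>"
  by unfold_locales (rule Linf_down_norm_le_iff)

end

theorem theorem8p6:
  fixes M :: "'a measure" and \<A> :: "'a set set"
  assumes "sigma_finite_measure M"
    and "full_ordered_core M \<A>"
  shows "exact_Calderon_couple M (L1_norm M) (Linf_down_norm M \<A>)"
proof -
  interpret full_core M \<A>
    using assms by (intro full_core.intro full_core_axioms.intro)
  obtain \<D> where "core_skeleton M \<A> \<D>" using skeleton_exists by blast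
  then interpret core_skeleton M \<A> \<D> .
  show ?thesis by (rule exact_Calderon)
qed

end
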